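(* (1) Let $\Pi \subset \mathbb{R}_{\geq 0}^2$ be a polygon and let $K = K(\Pi,\mathcal{T},\delta)$ be any T-curve with Newton polygon $\Pi$. Then the number of connected components of $K$ is at most the number of integer points in the interior of $\Pi$, plus one. (2) For every polygon $\Pi \subset \mathbb{R}_{\geq 0}^2$ there exists a T-curve with Newton polygon $\Pi$ whose number of connected components equals the number of integer points in the interior of $\Pi$, plus one.
   Context: Polygons. A segment is a straight segment in $\mathbb{R}^2$ with integer endpoints. A closed polygonal line is a finite cyclic union of segments, consecutive ones sharing an endpoint, the union of two consecutive segments never being a segment. A polygon is a (possibly non-convex) subset of $\mathbb{R}^2$ homeomorphic to a disk and bounded by a closed polygonal line; its edges are the segments of that line. Parity. The parity of an integer point $(p_1,p_2)$ is $(p_1 \bmod 2, p_2 \bmod 2)\in(\mathbb{Z}/2)^2$. The integer points of a segment take exactly two parities; the parity of the segment is their sum (it is never $(0,0)$). Ambient surface. For $a,b\in\{0,1\}$ let $\sigma_{a,b}(x,y)=((-1)^a x,(-1)^b y)$. Given a polygon $\Pi\subset\mathbb{R}_{\ge0}^2$, the ambient surface $S(\Pi)$ is the quotient of the disjoint union $\bigsqcup_{a,b\in\{0,1\}}\sigma_{a,b}\cdot\Pi$ obtained as follows: for each copy $\sigma_{g,h}\cdot\Pi$ and each edge $e$ of $\Pi$ of (segment) parity $(c,d)$, every point $P\in\sigma_{g,h}\cdot e$ of this copy is identified with the point $\sigma_{a,b}(P)$ of the copy $\sigma_{a,b}\sigma_{g,h}\cdot\Pi$, where $(a,b)=(d,c)$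 mod 2 is the unique nonzero pair with $ac+bd=0$ mod 2. $S(\Pi)$ is a closed surface; $\mu:S(\Pi)\to\Pi$ denotes the natural projection. T-curves. A primitive triangulation $\mathcal{T}$ of $\Pi$ is a (rectilinear) triangulation whose vertex set is exactly $\Pi\cap\mathbb{Z}^2$. It induces by reflections a triangulation $\mu^{-1}(\mathcal{T})$ of $S(\Pi)$. A sign distribution is a function $\delta:\Pi\cap\mathbb{Z}^2\to\{+1,-1\}$; it is extended to the integer points of the four copies by $\delta((-1)^ax,(-1)^by)=(-1)^{ax+by}\delta(x,y)$. Each edge of the triangulation of the copies gets the product of the signs of its endpoints; this is compatible with the gluing and gives signs to the edges of $\mu^{-1}(\mathcal{T})$. Every triangle has 0 or 2 negative edges. Let $G$ be the 1-skeleton of the cell decomposition of $S(\Pi)$ dual to $\mu^{-1}(\mathcal{T})$, each edge of $G$ receiving the sign of the dual edge. The T-curve $K(\Pi,\mathcal{T},\delta)$ is the union of the negative edges of $G$; it is a disjoint union of embedded circles in $S(\Pi)$. The polygon $\Pi$ is called the Newton polygon of the T-curve. *)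

theory Defs
  imports "HOL-Analysis.Analysis" "HOL-Library.Z2"
begin

subsection \<open>Lattice polygons\<close>

type_synonym point = "real \<times> real"

abbreviation lattice :: "point set"
  where "lattice \<equiv> \<int> \<times> \<int>"

definition lattice_segment :: "point set \<Rightarrow> bool"
  where "lattice_segment s \<longleftrightarrow>
    (\<exists>p\<in>lattice. \<exists>q\<in>lattice. p \<noteq> q \<and> s = closed_segment p q)"

text \<open>
  A closed polygonal line is given by the cyclic list of its vertices; its \<open>i\<close>-th segment joins
  the \<open>i\<close>-th vertex to the cyclically next one.
\<close>

definition cyc_segment :: "point list \<Rightarrow> nat \<Rightarrow> point set"
  where "cyc_segment vs i =
    closed_segment (vs ! (i mod length vs)) (vs ! (Suc i mod length vs))"

definition closed_polygonal_line :: "point list \<Rightarrow> bool"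
  where "closed_polygonal_line vs \<longleftrightarrow>
    vs \<noteq> [] \<and> set vs \<subseteq> lattice \<and>
    (\<forall>i. lattice_segment (cyc_segment vs i)) \<and>
    (\<forall>i. \<not> lattice_segment (cyc_segment vs i \<union> cyc_segment vs (Suc i)))"

text \<open>
  \<open>polygon P E\<close>: the set \<open>P\<close> is a polygon and \<open>E\<close> is the set of its edges. The last condition
  expresses that the polygonal line bounds \<open>P\<close>; it forces this line to be a simple closed
  curve turning at each vertex, so \<open>E\<close> is determined by \<open>P\<close>.
\<close>

definition polygon :: "point set \<Rightarrow> point set set \<Rightarrow> bool"
  where "polygon P E \<longleftrightarrow>
    P homeomorphic (cball 0 1 :: point set) \<and>
    (\<exists>vs. closed_polygonal_line vs \<and> E = range (cyc_segment vs) \<and> frontier P = \<Union>E)"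

subsection \<open>Parity\<close>

text \<open>\<open>(\<int>/2)\<^sup>2\<close> is \<^typ>\<open>bit \<times> bit\<close>, with componentwise addition.\<close>

definition parity :: "point \<Rightarrow> bit \<times> bit"
  where "parity p = (of_int \<lfloor>fst p\<rfloor>, of_int \<lfloor>snd p\<rfloor>)"

definition segment_parity :: "point set \<Rightarrow> bit \<times> bit"
  where "segment_parity s = (\<Sum>\<pi>\<in>parity ` (s \<inter> lattice). \<pi>)"

subsection \<open>The ambient surface\<close>

text \<open>\<open>m1pow a\<close> is \<open>(-1)\<^sup>a\<close> for \<open>a \<in> \<int>/2\<close>.\<close>

definition m1pow :: "bit \<Rightarrow> 'a::ring_1"
  where "m1pow a = (if a = 0 then 1 else - 1)"

definition refl_map :: "bit \<times> bit \<Rightarrow> point \<Rightarrow> point"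
  where "refl_map \<epsilon> p = (m1pow (fst \<epsilon>) * fst p, m1pow (snd \<epsilon>) * snd p)"

definition four_copies :: "point set \<Rightarrow> ((bit \<times> bit) \<times> point) topology"
  where "four_copies P = sum_topology (\<lambda>\<epsilon>. top_of_set (refl_map \<epsilon> ` P)) UNIV"

text \<open>
  For an edge of parity \<open>(c,d)\<close> the identification is by the reflection indexed by \<open>(d,c)\<close>, which
  is the only nonzero \<open>(a,b)\<close> with \<open>a c + b d = 0\<close>.
\<close>

definition glue :: "point set set \<Rightarrow> (bit \<times> bit) \<times> point \<Rightarrow> (bit \<times> bit) \<times> point \<Rightarrow> bool"
  where "glue E z w \<longleftrightarrow>
    (\<exists>e\<in>E. snd z \<in> refl_map (fst z) ` e \<and>
      w = (prod.swap (segment_parity e) + fst z, refl_map (prod.swap (segment_parity e)) (snd z)))"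

definition glue_equiv :: "point set set \<Rightarrow> ((bit \<times> bit) \<times> point) rel"
  where "glue_equiv E = {(z, w). equivclp (glue E) z w}"

definition quotient_topology :: "'a topology \<Rightarrow> 'a rel \<Rightarrow> 'a set topology"
  where "quotient_topology X r =
    topology (\<lambda>U. U \<subseteq> topspace X // r \<and> openin X {x \<in> topspace X. r `` {x} \<in> U})"

lemma istopology_quotient:
  "istopology (\<lambda>U. U \<subseteq> topspace X // r \<and> openin X {x \<in> topspace X. r `` {x} \<in> U})"
proof -
  have 1: "{x \<in> topspace X. r `` {x} \<in> S \<inter> T} =
      {x \<in> topspace X. r `` {x} \<in> S} \<inter> {x \<in> topspace X. r `` {x} \<in> T}" for S T
    by auto
  have 2: "{x \<in> topspace X. r `` {x} \<in> \<Union>\<K>} =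
      (\<Union>K\<in>\<K>. {x \<in> topspace X. r `` {x} \<in> K})" for \<K>
    by auto
  show ?thesis
    unfolding istopology_def 1 2 by blast
qed

lemma openin_quotient_topology:
  "openin (quotient_topology X r) U \<longleftrightarrow>
    U \<subseteq> topspace X // r \<and> openin X {x \<in> topspace X. r `` {x} \<in> U}"
  by (simp add: quotient_topology_def istopology_quotient)

lemma topspace_quotient_topology: "topspace (quotient_topology X r) = topspace X // r"
proof
  show "topspace (quotient_topology X r) \<subseteq> topspace X // r"
    using openin_quotient_topology openin_topspace by blast
  have "{x \<in> topspace X. r `` {x} \<in> topspace X // r} = topspace X"
    by (auto simp: quotientI)
  then have "openin (quotient_topology X r) (topspace X // r)"
    by (simp add: openin_quotient_topology)
  then show "topspace X // r \<subseteq> topspace (quotient_topology X r)"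
    by (rule openin_subset)
qed

lemma quotient_map_quotient_topology:
  "quotient_map X (quotient_topology X r) (\<lambda>x. r `` {x})"
  by (auto simp: quotient_map_def topspace_quotient_topology openin_quotient_topology quotient_def)

definition ambient_surface ::
    "point set \<Rightarrow> point set set \<Rightarrow> ((bit \<times> bit) \<times> point) set topology"
  where "ambient_surface P E = quotient_topology (four_copies P) (glue_equiv E)"

subsection \<open>T-curves\<close>

definition primitive_triangulation :: "point set \<Rightarrow> point set set \<Rightarrow> bool"
  where "primitive_triangulation P \<T> \<longleftrightarrow>
    simplicial_complex \<T> \<and> \<Union>\<T> = P \<and> {v. {v} \<in> \<T>} = P \<inter> lattice"

definition sign_distribution :: "point set \<Rightarrow> (point \<Rightarrow> int) \<Rightarrow> bool"
  where "sign_distribution P \<delta> \<longleftrightarrow> (\<forall>p\<in>P \<inter> lattice. \<delta> p \<in> {1, - 1})"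

abbreviation vertices :: "point set \<Rightarrow> point set"
  where "vertices s \<equiv> {v. v extreme_point_of s}"

definition barycenter :: "point set \<Rightarrow> point"
  where "barycenter s = (\<Sum>v\<in>vertices s. v) /\<^sub>R real (card (vertices s))"

text \<open>
  \<open>copy_sign \<delta> \<epsilon> p\<close> is the value of the extended sign distribution at the point \<open>refl_map \<epsilon> p\<close> of
  the copy \<open>\<epsilon>\<close>, where \<open>p\<close> is a lattice point of the polygon itself. Likewise, simplices of the
  reflected triangulation are indexed by a copy and a simplex of \<open>\<T>\<close>.
\<close>

definition copy_sign :: "(point \<Rightarrow> int) \<Rightarrow> bit \<times> bit \<Rightarrow> point \<Rightarrow> int"
  where "copy_sign \<delta> \<epsilon> p =
    m1pow (fst \<epsilon> * fst (parity p) + snd \<epsilon> * snd (parity p)) * \<delta> p"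

definition edge_sign :: "(point \<Rightarrow> int) \<Rightarrow> bit \<times> bit \<Rightarrow> point set \<Rightarrow> int"
  where "edge_sign \<delta> \<epsilon> e = (\<Prod>v\<in>vertices e. copy_sign \<delta> \<epsilon> v)"

text \<open>
  The dual cell decomposition is realized inside the barycentric subdivision: the edge dual to an
  edge \<open>e\<close> of the glued triangulation is made of two halves, each joining, in one of the two
  triangles \<open>t\<close> containing \<open>e\<close>, the barycenter of \<open>t\<close> to the midpoint of \<open>e\<close>.
\<close>

definition dual_half_edge :: "bit \<times> bit \<Rightarrow> point set \<Rightarrow> point set \<Rightarrow> ((bit \<times> bit) \<times> point) set"
  where "dual_half_edge \<epsilon> t e =
    {\<epsilon>} \<times> refl_map \<epsilon> ` closed_segment (barycenter t) (barycenter e)"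

definition T_curve ::
    "point set set \<Rightarrow> point set set \<Rightarrow> (point \<Rightarrow> int) \<Rightarrow> ((bit \<times> bit) \<times> point) set set"
  where "T_curve E \<T> \<delta> =
    (\<lambda>z. glue_equiv E `` {z}) `
      \<Union>{dual_half_edge \<epsilon> t e |\<epsilon> t e.
          t \<in> \<T> \<and> 2 simplex t \<and> e \<in> \<T> \<and> 1 simplex e \<and> e \<subseteq> t \<and> edge_sign \<delta> \<epsilon> e = - 1}"

definition T_curve_components ::
    "point set \<Rightarrow> point set set \<Rightarrow> point set set \<Rightarrow> (point \<Rightarrow> int)
      \<Rightarrow> ((bit \<times> bit) \<times> point) set set set"
  where "T_curve_components P E \<T> \<delta> =
    connected_components_of (subtopology (ambient_surface P E) (T_curve E \<T> \<delta>))"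

end

theory Submission
  imports Defs
begin

text \<open>
  Every edge of the triangulation is negative in exactly two copies, and on the frontier these two
  are glued, so the T-curve is the boundary of a ribbon thickening of the dual graph of the
  triangulation. For a set \<open>S\<close> of components, the edges with exactly one of their two negative
  copies in \<open>S\<close> form a cocycle mod 2 that vanishes on the frontier. As the polygon is simply
  connected, this cocycle is the coboundary of a function on the lattice points that is constant
  on the frontier, that is, it is given by a set of interior lattice points; and it determines
  \<open>S\<close> up to complement, because the dual graph is connected. Hence \<open>2\<^sup>k \<le> 2 \<cdot> 2\<^sup>n\<close> for \<open>k\<close>
  components and \<open>n\<close> interior lattice points.

  For the Harnack sign distribution, which is negative on one parity class only, the T-curve
  splits into one closed piece around each interior lattice point and one further piece along the
  frontier, so the bound is attained for every primitive triangulation. A primitive triangulation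
  is obtained from the standard one of a large square: the primitive segments of the frontier do
  not cross, and each can be made an edge by flipping, repeatedly, a highest edge that crosses it.
\<close>

subsection \<open>The topology of polygons\<close>

text \<open>Both counts rest on one parity fact. In the copy \<open>\<epsilon>\<close>, an edge with
  ends \<open>p\<close>, \<open>q\<close> has the sign \<open>\<delta> p * \<delta> q\<close> times
  (-1) to the pairing of \<open>\<epsilon>\<close> with \<open>parity p + parity q\<close>. The ends
  of a primitive segment differ in parity, so this sign depends on \<open>\<epsilon>\<close>, and
  the two copies where the edge is negative differ by the vector orthogonal to the edge parity. That
  vector is the reflection by which frontier edges of this parity are glued. The polygon is known
  only up to homeomorphism and need not be convex, so simple connectivity enters through a
  two-sheeted covering. For the Harnack signs, disjoint closed pieces are exhibited, and the upper
  bound then forces each of them to be connected. The obstacle in the existence of triangulations is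
  that a flip needs a convex quadrilateral. Heights over the segment to be inserted are integers;
  maximality of the crossing edge together with integrality forces the two adjacent triangles to
  form a parallelogram.\<close>

lemma polygon_topology:
  assumes "polygon P E"
  shows polygon_compact: "compact P"
    and polygon_connected_interior: "connected (interior P)"
    and polygon_closure_interior: "closure (interior P) = P"
    and polygon_frontier_sphere: "frontier P homeomorphic (sphere 0 1 :: point set)"
proof -
  have "(cball 0 1 :: point set) homeomorphic P"
    using assms by (subst homeomorphic_sym) (simp add: polygon_def)
  then obtain f g where hom: "homeomorphism (cball 0 1 :: point set) P f g"
    by (auto simp: homeomorphic_def)
  then have cf: "continuous_on (cball 0 1) f" and cg: "continuous_on P g"
    and fim: "f ` cball 0 1 = P" and gim: "g ` P = cball 0 1"
    and gf: "\<And>x. x \<in> cball 0 1 \<Longrightarrow> g (f x) = x" and fg: "\<And>y. y \<in> P \<Longrightarrow> f (g y) = y"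
    unfolding homeomorphism_def by blast+
  show "compact P"
    using compact_continuous_image[OF cf] by (simp add: fim)
  then have "closed P"
    by (rule compact_imp_closed)
  have injf: "inj_on f (cball 0 1)" and injg: "inj_on g P"
    using gf fg by (metis inj_onI)+
  \<comment> \<open>Invariance of domain, applied to \<open>f\<close> on the open disc and to
    \<open>g\<close> on \<open>interior P\<close>, identifies \<open>interior P\<close> with the
    image of the open disc. The remaining claims are transported along \<open>f\<close>.\<close>
  have "open (f ` ball 0 1)"
    by (intro invariance_of_domain continuous_on_subset[OF cf] inj_on_subset[OF injf]) auto
  then have 1: "f ` ball 0 1 \<subseteq> interior P"
    by (intro interior_maximal) (auto simp flip: fim)
  have "open (g ` interior P)"
    by (intro invariance_of_domain continuous_on_subset[OF cg] inj_on_subset[OF injg])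
      (simp_all add: interior_subset)
  moreover have "g ` interior P \<subseteq> cball 0 1"
    using image_mono[OF interior_subset, of g P] by (simp add: gim)
  ultimately have "g ` interior P \<subseteq> interior (cball 0 1)"
    by (rule interior_maximal[rotated])
  then have 2: "interior P \<subseteq> f ` ball 0 1"
  proof (intro subsetI)
    fix x assume "x \<in> interior P"
    moreover have "g ` interior P \<subseteq> ball 0 1"
      using \<open>g ` interior P \<subseteq> interior (cball 0 1)\<close> unfolding interior_cball .
    ultimately have "g x \<in> ball 0 1" "f (g x) = x"
      using fg interior_subset[of P] by blast+
    then show "x \<in> f ` ball 0 1"
      by (metis imageI)
  qed
  have int: "interior P = f ` ball 0 1"
    using 1 2 by blast
  show "connected (interior P)"
    unfolding int
    by (intro connected_continuous_image continuous_on_subset[OF cf]) auto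
  have "f ` closure (ball 0 1) \<subseteq> closure (f ` ball 0 1)"
    using cf by (intro image_closure_subset) (simp_all add: closure_subset)
  then have "P \<subseteq> closure (interior P)"
    by (simp add: int fim)
  then show "closure (interior P) = P"
    using \<open>closed P\<close> by (simp add: closure_minimal interior_subset subset_antisym)
  have "frontier P = P - interior P"
    using \<open>closed P\<close> by (simp add: frontier_def)
  also have "\<dots> = f ` cball 0 1 - f ` ball 0 1"
    by (simp only: int fim)
  also have "\<dots> = f ` (cball 0 1 - ball 0 1)"
    by (rule inj_on_image_set_diff[OF injf, symmetric]) auto
  also have "(cball 0 1 - ball 0 1 :: point set) = sphere 0 1"
    by auto
  finally have "f ` sphere 0 1 = frontier P" by simp
  then have "homeomorphism (sphere 0 1) (frontier P) f g"
    using \<open>closed P\<close> 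
    by (intro homeomorphism_of_subsets[OF hom, of "sphere 0 1" "frontier P"]) (simp_all add: frontier_subset_closed sphere_cball)
  then show "frontier P homeomorphic (sphere 0 1 :: point set)"
    unfolding homeomorphic_sym[of "frontier P"] by (auto simp: homeomorphic_def)
qed

lemma polygon_frontier:
  assumes "polygon P E"
  shows polygon_frontier_edges: "frontier P = \<Union>E"
    and polygon_edges_lattice_segments: "\<And>s. s \<in> E \<Longrightarrow> lattice_segment s"
proof -
  obtain vs where vs: "closed_polygonal_line vs" "E = range (cyc_segment vs)" "frontier P = \<Union>E"
    using assms by (auto simp: polygon_def)
  then show "frontier P = \<Union>E" "\<And>s. s \<in> E \<Longrightarrow> lattice_segment s"
    by (auto simp: closed_polygonal_line_def)
qed

lemma
  assumes "polygon P E"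
  shows polygon_simply_connected: "simply_connected P"
    and polygon_locally_path_connected: "locally path_connected P"
    and polygon_connected_frontier: "connected (frontier P)"
    and polygon_infinite_frontier: "infinite (frontier P)"
proof -
  have hom: "P homeomorphic (cball 0 1 :: point set)"
    using assms by (simp add: polygon_def)
  show "simply_connected P"
    unfolding homeomorphic_simply_connected_eq[OF hom] by (simp add: convex_imp_simply_connected)
  have "locally path_connected (cball 0 1 :: point set)"
    by (simp add: convex_imp_locally_path_connected)
  then show "locally path_connected P"
    by (subst homeomorphic_locally[OF hom homeomorphic_path_connectedness])
  note fr = polygon_frontier_sphere[OF assms]
  have "connected (sphere 0 1 :: point set)"
    by (intro connected_sphere) simp
  then show "connected (frontier P)"
    by (subst homeomorphic_connectedness[OF fr])
  have "(1, 0) \<in> (sphere 0 1 :: point set)" "(0, 1) \<in> (sphere 0 1 :: point set)"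
    by (simp_all add: norm_Pair)
  then have "infinite (sphere 0 1 :: point set)"
    using connected_finite_iff_sing[OF \<open>connected (sphere 0 1 :: point set)\<close>]
    by (metis empty_iff one_neq_zero prod.inject singletonD)
  then show "infinite (frontier P)"
    using fr unfolding homeomorphic_def homeomorphism_def by (metis finite_imageI)
qed

subsection \<open>Lattice triangles in the plane\<close>

text \<open>Twice the signed area of the triangle spanned by two vectors. It serves for barycentric
  coordinates, unimodularity, crossings and heights over a line.\<close>

definition det2 :: "point \<Rightarrow> point \<Rightarrow> real"
  where "det2 u v = fst u * snd v - snd u * fst v"

text \<open>The barycentric coordinate belonging to the third vertex.\<close>

definition bary :: "point \<Rightarrow> point \<Rightarrow> point \<Rightarrow> point \<Rightarrow> real"
  where "bary a b c x = det2 (b - a) (x - a) / det2 (b - a) (c - a)"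

text \<open>Gives the three barycentric coordinates of a triangle a common denominator.\<close>

lemma det2_cycle: "det2 (c - b) (a - b) = det2 (b - a) (c - a)"
  by (simp add: det2_def algebra_simps)

lemma det2_flip: "det2 (a - b) (x - b) = - det2 (b - a) (x - a)"
  by (simp add: det2_def algebra_simps)

lemma det2_swap: "det2 v u = - det2 u v"
  by (simp add: det2_def)

lemma det2_self [simp]: "det2 u u = 0" "det2 0 u = 0" "det2 u 0 = 0"
  by (simp_all add: det2_def)

lemma det2_zeroD:
  assumes "det2 u w = 0" "u \<noteq> 0"
  obtains k where "w = k *\<^sub>R u"
proof (cases "fst u = 0")
  case True
  then have "snd u \<noteq> 0" "fst w = 0"
    using assms by (auto simp: det2_def prod_eq_iff)
  then have "w = (snd w / snd u) *\<^sub>R u"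
    using True by (simp add: prod_eq_iff)
  then show ?thesis ..
next
  case False
  then have "w = (fst w / fst u) *\<^sub>R u"
    using assms by (simp add: prod_eq_iff det2_def field_simps)
  then show ?thesis ..
qed

text \<open>The coordinates of \<open>x\<close> at \<open>a\<close>, \<open>b\<close>,
  \<open>c\<close> are \<open>bary b c a x\<close>, \<open>bary c a b x\<close>,
  \<open>bary a b c x\<close>. Facts are proved for the third vertex and carried to the others by
  interpreting the rotated triangles as \<open>n1\<close> and \<open>n2\<close>.\<close>

locale nondeg =
  fixes a b c :: point
  assumes nondeg: "det2 (b - a) (c - a) \<noteq> 0"
begin

lemma distinct: "a \<noteq> b" "a \<noteq> c" "b \<noteq> c"
  using nondeg by auto

lemma nondeg_cycle: "nondeg b c a"
  using nondeg by (simp add: nondeg_def det2_cycle[of c b a])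

lemma nondeg_flip: "nondeg b a c"
  using nondeg by (simp add: nondeg_def det2_flip[of a b c])

lemma bary_affine:
  "bary a b c ((1 - t) *\<^sub>R x + t *\<^sub>R y) = (1 - t) * bary a b c x + t * bary a b c y"
proof -
  have "det2 (b - a) ((1 - t) *\<^sub>R x + t *\<^sub>R y - a) =
      (1 - t) * det2 (b - a) (x - a) + t * det2 (b - a) (y - a)"
    by (simp add: det2_def algebra_simps)
  then show ?thesis
    by (simp add: bary_def add_divide_distrib)
qed

lemma bary_add: "bary a b c (x + t *\<^sub>R v) = bary a b c x + t * (det2 (b - a) v / det2 (b - a) (c - a))"
proof -
  have "det2 (b - a) (x + t *\<^sub>R v - a) = det2 (b - a) (x - a) + t * det2 (b - a) v"
    by (simp add: det2_def algebra_simps)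
  then show ?thesis
    by (simp add: bary_def add_divide_distrib)
qed

lemma bary_sum: "bary b c a x + bary c a b x + bary a b c x = 1"
proof -
  have "det2 (c - b) (x - b) + det2 (a - c) (x - c) + det2 (b - a) (x - a) = det2 (b - a) (c - a)"
    by (simp add: det2_def algebra_simps)
  then show ?thesis
    using nondeg det2_cycle[of c b a] det2_cycle[of a c b]
    by (simp add: bary_def flip: add_divide_distrib)
qed

text \<open>Cramer's rule; multiplied by the determinant it is a polynomial identity.\<close>

lemma bary_expand: "x = bary b c a x *\<^sub>R a + bary c a b x *\<^sub>R b + bary a b c x *\<^sub>R c"
proof -
  let ?D = "det2 (b - a) (c - a)"
  have "?D *\<^sub>R x = det2 (c - b) (x - b) *\<^sub>R a + det2 (a - c) (x - c) *\<^sub>R b + det2 (b - a) (x - a) *\<^sub>R c"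
    by (simp add: det2_def prod_eq_iff algebra_simps)
  then have "x = (1 / ?D) *\<^sub>R (det2 (c - b) (x - b) *\<^sub>R a + det2 (a - c) (x - c) *\<^sub>R b + det2 (b - a) (x - a) *\<^sub>R c)"
    using nondeg by (metis divide_self_if scaleR_one scaleR_scaleR times_divide_eq_left mult_1)
  then show ?thesis
    using det2_cycle[of c b a] det2_cycle[of a c b] by (simp add: bary_def scaleR_add_right)
qed

lemma bary_comb:
  assumes "u + v + w = 1"
  shows "bary a b c (u *\<^sub>R a + v *\<^sub>R b + w *\<^sub>R c) = w"
proof -
  have u: "u = 1 - v - w" using assms by simp
  have "det2 (b - a) (u *\<^sub>R a + v *\<^sub>R b + w *\<^sub>R c - a) = w * det2 (b - a) (c - a)"
    unfolding u by (simp add: det2_def algebra_simps)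
  then show ?thesis
    using nondeg by (simp add: bary_def)
qed

lemma bary_vertex [simp]: "bary a b c a = 0" "bary a b c b = 0" "bary a b c c = 1"
  using nondeg by (simp_all add: bary_def)

lemma not_collinear: "\<not> collinear {a, b, c}"
proof
  assume "collinear {a, b, c}"
  then have "collinear {0, b - a, c - a}"
    by (subst (asm) collinear_3[of b a c, simplified insert_commute]) (simp add: insert_commute)
  then consider "b - a = 0" | "c - a = 0" | k where "c - a = k *\<^sub>R (b - a)"
    by (auto simp: collinear_lemma)
  then show False
    using nondeg by cases (auto simp: det2_def)
qed

lemma indep: "\<not> affine_dependent {a, b, c}"
  using not_collinear by (auto simp: collinear_3_eq_affine_dependent)

lemma mem_hull:
  "x \<in> convex hull {a, b, c} \<longleftrightarrow> 0 \<le> bary b c a x \<and> 0 \<le> bary c a b x \<and> 0 \<le> bary a b c x"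
proof
  interpret n1: nondeg b c a by (rule nondeg_cycle)
  interpret n2: nondeg c a b by (rule n1.nondeg_cycle)
  assume "x \<in> convex hull {a, b, c}"
  then obtain u v w where *: "0 \<le> u" "0 \<le> v" "0 \<le> w" "u + v + w = 1"
    "x = u *\<^sub>R a + v *\<^sub>R b + w *\<^sub>R c"
    by (auto simp: convex_hull_3)
  then have "bary a b c x = w" "bary b c a x = u" "bary c a b x = v"
    using bary_comb[of u v w] n1.bary_comb[of v w u] n2.bary_comb[of w u v]
    by (simp_all add: algebra_simps)
  then show "0 \<le> bary b c a x \<and> 0 \<le> bary c a b x \<and> 0 \<le> bary a b c x"
    using * by simp
next
  assume "0 \<le> bary b c a x \<and> 0 \<le> bary c a b x \<and> 0 \<le> bary a b c x"
  then show "x \<in> convex hull {a, b, c}"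
    unfolding convex_hull_3 using bary_sum[of x] bary_expand[of x] by blast
qed

lemma mem_interior:
  "x \<in> interior (convex hull {a, b, c}) \<longleftrightarrow> 0 < bary b c a x \<and> 0 < bary c a b x \<and> 0 < bary a b c x"
proof
  interpret n1: nondeg b c a by (rule nondeg_cycle)
  interpret n2: nondeg c a b by (rule n1.nondeg_cycle)
  assume "x \<in> interior (convex hull {a, b, c})"
  then obtain u v w where *: "0 < u" "0 < v" "0 < w" "u + v + w = 1"
    "x = u *\<^sub>R a + v *\<^sub>R b + w *\<^sub>R c"
    by (auto simp: interior_convex_hull_3_minimal[OF not_collinear])
  then have "bary a b c x = w" "bary b c a x = u" "bary c a b x = v"
    using bary_comb[of u v w] n1.bary_comb[of v w u] n2.bary_comb[of w u v]
    by (simp_all add: algebra_simps)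
  then show "0 < bary b c a x \<and> 0 < bary c a b x \<and> 0 < bary a b c x"
    using * by simp
next
  assume "0 < bary b c a x \<and> 0 < bary c a b x \<and> 0 < bary a b c x"
  moreover have "DIM(point) = 2" by simp
  ultimately show "x \<in> interior (convex hull {a, b, c})"
    unfolding interior_convex_hull_3_minimal[OF not_collinear \<open>DIM(point) = 2\<close>]
    using bary_sum[of x] bary_expand[of x, symmetric] by blast
qed

lemma bary_segment:
  assumes "x \<in> closed_segment a b"
  shows "bary a b c x = 0"
  using assms by (auto simp: in_segment bary_affine)

lemma mem_segment:
  "x \<in> closed_segment a b \<longleftrightarrow> x \<in> convex hull {a, b, c} \<and> bary a b c x = 0"
proof
  assume x: "x \<in> closed_segment a b"
  moreover have "closed_segment a b \<subseteq> convex hull {a, b, c}"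
    unfolding segment_convex_hull by (intro hull_mono) auto
  ultimately show "x \<in> convex hull {a, b, c} \<and> bary a b c x = 0"
    using bary_segment by blast
next
  assume *: "x \<in> convex hull {a, b, c} \<and> bary a b c x = 0"
  then have "0 \<le> bary b c a x" "0 \<le> bary c a b x" "bary b c a x = 1 - bary c a b x"
    using bary_sum[of x] by (auto simp: mem_hull)
  then show "x \<in> closed_segment a b"
    using bary_expand[of x] * unfolding in_segment by (intro exI[of _ "bary c a b x"]) auto
qed

lemma frontier_cases:
  assumes "x \<in> convex hull {a, b, c}" "x \<notin> interior (convex hull {a, b, c})"
  shows "x \<in> closed_segment a b \<or> x \<in> closed_segment b c \<or> x \<in> closed_segment c a"
proof -
  interpret n1: nondeg b c a by (rule nondeg_cycle)
  interpret n2: nondeg c a b by (rule n1.nondeg_cycle)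
  have "insert b {c, a} = {a, b, c}" "insert c {a, b} = {a, b, c}" by auto
  then show ?thesis
    using assms mem_segment[of x] n1.mem_segment[of x] n2.mem_segment[of x]
    by (auto simp: mem_hull mem_interior)
qed

lemma barycenter_interior: "(1 / 3) *\<^sub>R (a + b + c) \<in> interior (convex hull {a, b, c})"
proof -
  have "DIM(point) = 2" by simp
  show ?thesis
    unfolding interior_convex_hull_3_minimal[OF not_collinear \<open>DIM(point) = 2\<close>]
    by (auto intro!: exI[of _ "1/3"] simp: scaleR_add_right)
qed

text \<open>Such a face lies in a side of the triangle, where one barycentric coordinate
  vanishes.\<close>

lemma proper_face_not_interior:
  assumes "C \<subseteq> {a, b, c}" "C \<noteq> {a, b, c}" "x \<in> convex hull C"
  shows "x \<notin> interior (convex hull {a, b, c})"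
proof -
  interpret n1: nondeg b c a by (rule nondeg_cycle)
  interpret n2: nondeg c a b by (rule n1.nondeg_cycle)
  have "C \<subseteq> {a, b} \<or> C \<subseteq> {b, c} \<or> C \<subseteq> {c, a}"
    using assms by blast
  then have "x \<in> closed_segment a b \<or> x \<in> closed_segment b c \<or> x \<in> closed_segment c a"
    using assms(3) unfolding segment_convex_hull by (meson hull_mono subsetD)
  then show ?thesis
    unfolding mem_interior
    using bary_segment[of x] n1.bary_segment[of x] n2.bary_segment[of x] by auto
qed

end

lemma nondeg_if_indep:
  assumes "\<not> affine_dependent {a, b, c}" "a \<noteq> b" "a \<noteq> c" "b \<noteq> c"
  shows "nondeg a b (c :: point)"
proof (rule ccontr)
  assume "\<not> nondeg a b c"
  then obtain k where k: "c - a = k *\<^sub>R (b - a)"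
    using assms(2) by (metis det2_zeroD nondeg_def right_minus_eq)
  then have "collinear {0, b - a, c - a}"
    by (auto simp: collinear_lemma)
  then have "collinear {a, b, c}"
    by (subst collinear_3[of b a c, simplified insert_commute]) (simp add: insert_commute)
  then show False
    using assms by (auto simp: collinear_3_eq_affine_dependent)
qed

section \<open>Lattice points, primitive segments and parity\<close>

lemma lattice_iff: "x \<in> lattice \<longleftrightarrow> (\<exists>i j. x = (of_int i, of_int j))"
  by (cases x) (auto elim!: Ints_cases)

lemma lattice_add: "x \<in> lattice \<Longrightarrow> y \<in> lattice \<Longrightarrow> x + y \<in> lattice"
  and lattice_diff: "x \<in> lattice \<Longrightarrow> y \<in> lattice \<Longrightarrow> x - y \<in> lattice"
  and lattice_scale: "k \<in> \<int> \<Longrightarrow> x \<in> lattice \<Longrightarrow> k *\<^sub>R x \<in> lattice"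
  by (auto simp: mem_Times_iff)

lemma det2_Ints: "u \<in> lattice \<Longrightarrow> v \<in> lattice \<Longrightarrow> det2 u v \<in> \<int>"
  by (auto simp: det2_def mem_Times_iff)

lemma of_int_bit_eq_0: "(of_int k :: bit) = 0 \<longleftrightarrow> even k"
  by (simp only: Z2.bit_eq_iff even_of_int_iff even_zero simp_thms)

lemma of_int_bit_eq: "(of_int k :: bit) = of_int l \<longleftrightarrow> (even k \<longleftrightarrow> even l)"
  by (simp only: Z2.bit_eq_iff even_of_int_iff)

lemma parity_of_int: "parity (of_int i, of_int j) = (of_int i, of_int j)"
  by (simp add: parity_def)

lemma finite_lattice:
  assumes "bounded S"
  shows "finite (S \<inter> lattice)"
proof -
  obtain r where r: "\<And>x. x \<in> S \<Longrightarrow> norm x \<le> r"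
    using assms unfolding bounded_iff by blast
  have "S \<inter> lattice \<subseteq> (\<lambda>(i, j). (of_int i, of_int j)) ` ({-\<lfloor>r\<rfloor>..\<lfloor>r\<rfloor>} \<times> {-\<lfloor>r\<rfloor>..\<lfloor>r\<rfloor>})"
  proof
    fix x assume x: "x \<in> S \<inter> lattice"
    then obtain i j where ij: "x = (of_int i, of_int j)"
      by (auto simp: lattice_iff)
    have "\<bar>fst x\<bar> \<le> norm x" "\<bar>snd x\<bar> \<le> norm x"
      using norm_fst_le[of "fst x" "snd x"] norm_snd_le[of "snd x" "fst x"] by simp_all
    then have "\<bar>real_of_int i\<bar> \<le> r" "\<bar>real_of_int j\<bar> \<le> r"
      using r[of x] x ij by auto
    then have "\<bar>i\<bar> \<le> \<lfloor>r\<rfloor>" "\<bar>j\<bar> \<le> \<lfloor>r\<rfloor>"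
      by (simp_all add: le_floor_iff)
    then show "x \<in> (\<lambda>(i, j). (of_int i, of_int j)) ` ({-\<lfloor>r\<rfloor>..\<lfloor>r\<rfloor>} \<times> {-\<lfloor>r\<rfloor>..\<lfloor>r\<rfloor>})"
      unfolding ij by (intro image_eqI[of _ _ "(i, j)"]) auto
  qed
  then show ?thesis
    by (rule finite_subset) simp
qed

definition primitive_segment :: "point \<Rightarrow> point \<Rightarrow> bool"
  where "primitive_segment p q \<longleftrightarrow> p \<in> lattice \<and> q \<in> lattice \<and> p \<noteq> q \<and> closed_segment p q \<inter> lattice = {p, q}"

lemma primitive_segmentD:
  assumes "primitive_segment p q"
  shows "p \<in> lattice" "q \<in> lattice" "p \<noteq> q" "closed_segment p q \<inter> lattice = {p, q}"
  using assms[unfolded primitive_segment_def] by (simp_all only: simp_thms)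

lemma primitive_segment_sym: "primitive_segment p q \<Longrightarrow> primitive_segment q p"
  by (auto simp: primitive_segment_def closed_segment_commute)

text \<open>Subtracting \<open>\<lfloor>t\<rfloor>\<close> times \<open>q - p\<close> moves the
  point into the segment and keeps it in the lattice, where it can only be \<open>p\<close>. So
  \<open>q - p\<close> generates the lattice points of its line.\<close>

lemma primitive_segment_line:
  assumes "primitive_segment p q" "p + t *\<^sub>R (q - p) \<in> lattice"
  shows "t \<in> \<int>"
proof -
  have pq: "p \<in> lattice" "q \<in> lattice" "p \<noteq> q" "closed_segment p q \<inter> lattice = {p, q}"
    by (fact primitive_segmentD[OF assms(1)])+
  let ?y = "p + frac t *\<^sub>R (q - p)"
  have "?y = (p + t *\<^sub>R (q - p)) - of_int \<lfloor>t\<rfloor> *\<^sub>R (q - p)"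
    by (simp add: frac_def algebra_simps)
  then have "?y \<in> lattice"
    by (simp only:) (intro lattice_diff assms(2) lattice_scale pq Ints_of_int)
  moreover have "?y \<in> closed_segment p q"
    unfolding in_segment using frac_ge_0[of t] frac_lt_1[of t]
    by (intro exI[of _ "frac t"]) (auto simp: algebra_simps less_imp_le)
  ultimately have "?y \<in> closed_segment p q \<inter> lattice"
    by (rule IntI[rotated])
  then have "?y = p \<or> ?y = q"
    unfolding pq(4) by (simp only: insert_iff empty_iff simp_thms)
  then have "frac t *\<^sub>R (q - p) = 0 \<or> (1 - frac t) *\<^sub>R (q - p) = 0"
    by (auto simp: algebra_simps)
  then have "frac t = 0"
    using pq frac_lt_1[of t] by auto
  then show ?thesis
    by simp
qed

text \<open>Equal parities would make the midpoint a lattice point. Hence edges have nonzero parity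
  and the three vertices of a triangle have three different parities.\<close>

lemma primitive_segment_parity:
  assumes "primitive_segment p q"
  shows "parity p \<noteq> parity q"
proof
  assume par: "parity p = parity q"
  obtain i j k l where pq: "p = (of_int i, of_int j)" "q = (of_int k, of_int l)"
    using assms by (auto simp: primitive_segment_def lattice_iff)
  then have "(of_int (k - i) :: bit) = 0" "(of_int (l - j) :: bit) = 0"
    using par unfolding pq parity_of_int by simp_all
  then have "even (k - i)" "even (l - j)"
    by (simp_all only: of_int_bit_eq_0)
  then obtain m n where "k = i + 2 * m" "l = j + 2 * n"
    by (metis add.commute diff_add_cancel dvdE)
  then have "p + (1/2) *\<^sub>R (q - p) = (of_int (i + m), of_int (j + n))"
    by (simp add: pq)
  then have "p + (1/2) *\<^sub>R (q - p) \<in> lattice"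
    unfolding lattice_iff by blast
  then have "(1/2::real) \<in> \<int>"
    by (rule primitive_segment_line[OF assms])
  then obtain z where "(1/2::real) = of_int z"
    by (rule Ints_cases)
  then have "real_of_int (2 * z) = of_int 1"
    by simp
  then have "2 * z = 1"
    by (simp only: of_int_eq_iff)
  then show False
    by presburger
qed

text \<open>On the common line, in the coordinate that is 0 at \<open>p\<close> and 1 at
  \<open>q\<close>, the points \<open>u\<close> and \<open>v\<close> are integers. The coordinate of
  \<open>x\<close> lies strictly between 0 and 1, so one of the two integers is at most 0 and the
  other at least 1.\<close>

lemma primitive_subset_collinear:
  assumes prim: "primitive_segment p q" and uv: "u \<in> lattice" "v \<in> lattice" "u \<noteq> v"
    and x: "x \<in> closed_segment p q" "x \<in> closed_segment u v" "x \<notin> lattice"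
    and det: "det2 (q - p) (v - u) = 0"
  shows "closed_segment p q \<subseteq> closed_segment u v"
proof -
  have pq: "p \<in> lattice" "q \<in> lattice" "p \<noteq> q"
    by (fact primitive_segmentD[OF prim])+
  obtain k where k: "v - u = k *\<^sub>R (q - p)"
    using det2_zeroD[OF det] pq by auto
  obtain l where l: "0 \<le> l" "l \<le> 1" "x = (1 - l) *\<^sub>R p + l *\<^sub>R q"
    using x by (auto simp: in_segment)
  obtain t where t: "0 \<le> t" "t \<le> 1" "x = (1 - t) *\<^sub>R u + t *\<^sub>R v"
    using x by (auto simp: in_segment)
  have "l \<noteq> 0" "l \<noteq> 1"
    using l x pq by auto
  then have l01: "0 < l" "l < 1"
    using l by auto
  have "u = x - t *\<^sub>R (v - u)" using t by (simp add: algebra_simps)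
  then have u: "u = p + (l - t * k) *\<^sub>R (q - p)"
    using l unfolding k by (simp add: algebra_simps)
  have "v = u + k *\<^sub>R (q - p)" using k by (simp add: algebra_simps)
  also have "\<dots> = p + (l - t * k + k) *\<^sub>R (q - p)"
    unfolding u by (simp add: algebra_simps)
  finally have v: "v = p + (l - t * k + k) *\<^sub>R (q - p)" .
  have "l - t * k \<in> \<int>" "l - t * k + k \<in> \<int>"
    by (rule primitive_segment_line[OF prim], simp only: u[symmetric] v[symmetric] uv)+
  then obtain m n where mn: "l - t * k = of_int m" "l - t * k + k = of_int n"
    unfolding Ints_def by blast
  have u': "u = p + of_int m *\<^sub>R (q - p)" and v': "v = p + of_int n *\<^sub>R (q - p)"
    using u by (simp only: mn(1)) (use v in \<open>simp only: mn(2)\<close>)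
  \<comment> \<open>Stated for arbitrary ends, because \<open>u\<close> and \<open>v\<close>
    exchange their roles when \<open>k\<close> is negative.\<close>
  have sub: "closed_segment p q \<subseteq> closed_segment u v"
    if u: "u = p + of_int m *\<^sub>R (q - p)" and v: "v = p + of_int n *\<^sub>R (q - p)"
      and mn: "m \<le> 0" "1 \<le> n" for u v and m n :: int
  proof -
    have nm: "real_of_int n - of_int m > 0"
      using mn by (simp add: algebra_simps)
    have comb: "(1 - s) *\<^sub>R u + s *\<^sub>R v = p + (of_int m + s * (of_int n - of_int m)) *\<^sub>R (q - p)" for s
      unfolding u v by (simp add: algebra_simps)
    have "p = (1 - s) *\<^sub>R u + s *\<^sub>R v" if "s = - of_int m / (of_int n - of_int m)" for s
      unfolding comb that using nm by simp
    moreover have "q = (1 - s) *\<^sub>R u + s *\<^sub>R v" if "s = (1 - of_int m) / (of_int n - of_int m)" for s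
      unfolding comb that using nm by simp
    moreover have "0 \<le> - of_int m / (of_int n - of_int m :: real)" "- of_int m / (of_int n - of_int m :: real) \<le> 1"
      "0 \<le> (1 - of_int m) / (of_int n - of_int m :: real)" "(1 - of_int m) / (of_int n - of_int m :: real) \<le> 1"
      using nm mn by (simp_all add: divide_simps)
    ultimately have "p \<in> closed_segment u v" "q \<in> closed_segment u v"
      unfolding in_segment by blast+
    then show ?thesis
      by (simp add: closed_segment_subset)
  qed
  have "v - u \<noteq> 0" using uv by simp
  then have "k \<noteq> 0" using k by auto
  then consider "k > 0" | "k < 0" by linarith
  then show ?thesis
  proof cases
    case 1
    have "t * k \<ge> 0" "t * k \<le> k" using 1 t by (auto simp: mult_left_le_one_le)
    then have "real_of_int m < 1" "real_of_int n > 0"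
      using mn l01 by linarith+
    then have "m \<le> 0" "1 \<le> n" by linarith+
    then show ?thesis
      by (rule sub[OF u' v'])
  next
    case 2
    have "t * k \<le> 0" "t * k \<ge> k" using 2 t mult_right_mono_neg[of t 1 k] by (auto simp: mult_nonneg_nonpos)
    then have "real_of_int n < 1" "real_of_int m > 0"
      using mn l01 by linarith+
    then have "n \<le> 0" "1 \<le> m" by linarith+
    then have "closed_segment p q \<subseteq> closed_segment v u"
      by (rule sub[OF v' u'])
    then show ?thesis
      by (simp add: closed_segment_commute)
  qed
qed

text \<open>The lattice points of the longer segment are \<open>p + m (q - p)\<close> with integer
  \<open>m\<close>, so their parities alternate between the two distinct ones of \<open>p\<close>
  and \<open>q\<close>. Thus a polygon edge is glued by the reflection that belongs to any
  triangulation edge inside it.\<close>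

lemma primitive_segment_parity_eq:
  assumes prim: "primitive_segment p q" and uv: "u \<in> lattice" "v \<in> lattice"
    and sub: "closed_segment p q \<subseteq> closed_segment u v"
  shows "segment_parity (closed_segment u v) = parity p + parity q"
proof -
  note pq = primitive_segmentD[OF prim]
  obtain i j k l where ij: "p = (of_int i, of_int j)" and kl: "q = (of_int k, of_int l)"
    using pq(1,2) unfolding lattice_iff by blast
  have "p \<in> closed_segment u v" "q \<in> closed_segment u v"
    using sub by auto
  then obtain s t where st: "p = (1 - s) *\<^sub>R u + s *\<^sub>R v" "q = (1 - t) *\<^sub>R u + t *\<^sub>R v"
    unfolding in_segment by blast
  then have "s \<noteq> t"
    using pq(3) by blast
  have par: "parity x = parity p \<or> parity x = parity q" if x: "x \<in> closed_segment u v" "x \<in> lattice" for x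
  proof -
    obtain r where r: "x = (1 - r) *\<^sub>R u + r *\<^sub>R v"
      using x unfolding in_segment by blast
    have "(t - s) * ((r - s) / (t - s)) = r - s"
      using \<open>s \<noteq> t\<close> by simp
    moreover have "q - p = (t - s) *\<^sub>R (v - u)"
      unfolding st by (simp add: algebra_simps)
    ultimately have "((r - s) / (t - s)) *\<^sub>R (q - p) = (r - s) *\<^sub>R (v - u)"
      by (simp add: mult.commute)
    also have "\<dots> = x - p"
      unfolding st r by (simp add: algebra_simps)
    finally have xp: "x = p + ((r - s) / (t - s)) *\<^sub>R (q - p)"
      by (simp add: algebra_simps)
    then have "(r - s) / (t - s) \<in> \<int>"
      using x(2) primitive_segment_line[OF prim] by metis
    then obtain m where "(r - s) / (t - s) = of_int m"
      by (rule Ints_cases)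
    then have "x = (of_int (i + m * (k - i)), of_int (j + m * (l - j)))"
      unfolding xp ij kl by simp
    then have px: "parity x = (of_int (i + m * (k - i)), of_int (j + m * (l - j)))"
      by (simp only: parity_of_int)
    show ?thesis
    proof (cases "even m")
      case True
      then have "parity x = parity p"
        unfolding px ij parity_of_int by (simp only: of_int_bit_eq prod.inject even_add even_mult_iff) simp
      then show ?thesis ..
    next
      case False
      then have "parity x = parity q"
        unfolding px kl parity_of_int
        by (simp only: of_int_bit_eq prod.inject even_add even_mult_iff even_diff) auto
      then show ?thesis ..
    qed
  qed
  have "parity ` (closed_segment u v \<inter> lattice) = {parity p, parity q}"
  proof
    show "parity ` (closed_segment u v \<inter> lattice) \<subseteq> {parity p, parity q}"
      using par by blast
    have "p \<in> closed_segment u v \<inter> lattice" "q \<in> closed_segment u v \<inter> lattice"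
      using sub pq(1,2) by (simp_all only: IntI ends_in_segment subsetD)
    then show "{parity p, parity q} \<subseteq> parity ` (closed_segment u v \<inter> lattice)"
      by blast
  qed
  then show ?thesis
    using primitive_segment_parity[OF prim] by (simp add: segment_parity_def)
qed

section \<open>Discs triangulated by lattice triangles\<close>

lemma hull_inter_faces:
  fixes A B C D :: "point set"
  assumes ind: "\<not> affine_dependent A" "\<not> affine_dependent B"
    and inter: "convex hull A \<inter> convex hull B = convex hull (A \<inter> B)"
    and sub: "C \<subseteq> A" "D \<subseteq> B"
  shows "convex hull C \<inter> convex hull D = convex hull (C \<inter> D)"
proof
  show "convex hull (C \<inter> D) \<subseteq> convex hull C \<inter> convex hull D"
    by (simp add: hull_mono)
  have 1: "convex hull S \<inter> convex hull T = convex hull (S \<inter> T)" if "S \<union> T \<subseteq> A" for S T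
    by (intro convex_hull_Int[symmetric]) (use ind(1) that affine_dependent_subset in blast)
  have 2: "convex hull S \<inter> convex hull T = convex hull (S \<inter> T)" if "S \<union> T \<subseteq> B" for S T
    by (intro convex_hull_Int[symmetric]) (use ind(2) that affine_dependent_subset in blast)
  have "convex hull C \<inter> convex hull D \<subseteq> convex hull (A \<inter> B)"
    using inter hull_mono[OF sub(1)] hull_mono[OF sub(2)] by blast
  then have "convex hull C \<inter> convex hull D \<subseteq>
      (convex hull C \<inter> convex hull (A \<inter> B)) \<inter> (convex hull D \<inter> convex hull (A \<inter> B))"
    by blast
  also have "\<dots> = convex hull (C \<inter> (A \<inter> B)) \<inter> convex hull (D \<inter> (A \<inter> B))"
    using 1[of C "A \<inter> B"] 2[of D "A \<inter> B"] sub by auto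
  also have "\<dots> = convex hull ((C \<inter> (A \<inter> B)) \<inter> (D \<inter> (A \<inter> B)))"
    by (rule 1) blast
  also have "\<dots> \<subseteq> convex hull (C \<inter> D)"
    by (intro hull_mono) blast
  finally show "convex hull C \<inter> convex hull D \<subseteq> convex hull (C \<inter> D)" .
qed

text \<open>A primitive triangulation seen through its triangles only, each given as a set of three
  vertices; an edge is a pair of distinct points of one such set. That all lattice points of
  \<open>P\<close> are vertices follows from \<open>lat\<close> and \<open>cover\<close>.\<close>

locale lattice_disc =
  fixes P :: "point set" and E :: "point set set" and tris :: "point set set"
  assumes poly: "polygon P E"
    and fin: "finite tris"
    and tri: "\<And>A. A \<in> tris \<Longrightarrow> \<exists>a b c. A = {a, b, c} \<and> nondeg a b c"
    and lat: "\<And>A. A \<in> tris \<Longrightarrow> convex hull A \<inter> lattice = A"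
    and cover: "(\<Union>A\<in>tris. convex hull A) = P"
    and inter: "\<And>A B. A \<in> tris \<Longrightarrow> B \<in> tris \<Longrightarrow> convex hull A \<inter> convex hull B = convex hull (A \<inter> B)"
begin

lemma triE:
  assumes "A \<in> tris" "p \<in> A" "q \<in> A" "p \<noteq> q"
  obtains r where "A = {p, q, r}" "nondeg p q r"
proof -
  obtain a b c where A: "A = {a, b, c}" and n: "nondeg a b c"
    using tri[OF assms(1)] by blast
  have ns: "nondeg b c a" "nondeg c a b" "nondeg b a c" "nondeg c b a" "nondeg a c b"
    using n nondeg.nondeg_cycle nondeg.nondeg_flip by blast+
  have eqs: "{a, b, c} = {b, c, a}" "{a, b, c} = {c, a, b}" "{a, b, c} = {b, a, c}"
    "{a, b, c} = {c, b, a}" "{a, b, c} = {a, c, b}"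
    by blast+
  have "(p = a \<or> p = b \<or> p = c) \<and> (q = a \<or> q = b \<or> q = c)"
    using assms(2,3) A by simp
  then show ?thesis
    using that n ns eqs assms(4) A by metis
qed

lemma tri_card: "A \<in> tris \<Longrightarrow> card A = 3"
  using tri[of A] nondeg.distinct by auto

lemma tri_finite: "A \<in> tris \<Longrightarrow> finite A"
  using tri[of A] by auto

lemma tri_indep: "A \<in> tris \<Longrightarrow> \<not> affine_dependent A"
  using tri[of A] nondeg.indep by auto

lemma tri_two:
  assumes "A \<in> tris" "p \<in> A"
  obtains q where "q \<in> A" "q \<noteq> p"
  using tri[OF assms(1)] nondeg.distinct by (metis insertCI)

lemma hull_subset_P: "A \<in> tris \<Longrightarrow> convex hull A \<subseteq> P"
  using cover by blast

lemma tri_lattice: "A \<in> tris \<Longrightarrow> A \<subseteq> lattice"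
  using lat by blast

lemma tri_subset_P: "A \<in> tris \<Longrightarrow> A \<subseteq> P"
  using hull_subset_P hull_subset by fast

lemma vertex_set: "\<Union>tris = P \<inter> lattice"
proof
  show "\<Union>tris \<subseteq> P \<inter> lattice"
    using tri_lattice tri_subset_P by fast
  show "P \<inter> lattice \<subseteq> \<Union>tris"
  proof
    fix x assume x: "x \<in> P \<inter> lattice"
    then obtain A where "A \<in> tris" "x \<in> convex hull A"
      using cover by blast
    then show "x \<in> \<Union>tris"
      using lat[of A] x by blast
  qed
qed

lemma edge_subset_hull: "A \<in> tris \<Longrightarrow> p \<in> A \<Longrightarrow> q \<in> A \<Longrightarrow> closed_segment p q \<subseteq> convex hull A"
  unfolding segment_convex_hull by (intro hull_mono) auto

lemma prim:
  assumes "A \<in> tris" "p \<in> A" "q \<in> A" "p \<noteq> q"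
  shows "primitive_segment p q"
proof -
  obtain r where A: "A = {p, q, r}" and n: "nondeg p q r"
    using triE[OF assms] .
  interpret nondeg p q r by (rule n)
  have "r \<notin> closed_segment p q"
    using bary_segment[of r] by auto
  moreover have "closed_segment p q \<inter> lattice \<subseteq> A"
    using edge_subset_hull[OF assms(1-3)] lat[OF assms(1)] by fast
  moreover have "p \<in> lattice" "q \<in> lattice"
    using tri_lattice[OF assms(1)] assms(2,3) by (simp_all only: subsetD)
  moreover have "p \<in> closed_segment p q" "q \<in> closed_segment p q"
    by simp_all
  ultimately have "closed_segment p q \<inter> lattice = {p, q}"
    unfolding A by fast
  then show ?thesis
    unfolding primitive_segment_def using \<open>p \<in> lattice\<close> \<open>q \<in> lattice\<close> assms(4) by (intro conjI)
qed

lemma hull_inter: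
  assumes "A \<in> tris" "B \<in> tris" "C \<subseteq> A" "D \<subseteq> B"
  shows "convex hull C \<inter> convex hull D = convex hull (C \<inter> D)"
  by (rule hull_inter_faces[OF tri_indep[OF assms(1)] tri_indep[OF assms(2)] inter[OF assms(1,2)] assms(3,4)])

text \<open>Two hulls meet in the hull of the common vertices. For distinct triangles, both with
  three vertices, this is a proper face.\<close>

lemma interior_meets_hull:
  assumes "A \<in> tris" "B \<in> tris" "x \<in> interior (convex hull A)" "x \<in> convex hull B"
  shows "A = B"
proof (rule ccontr)
  assume "A \<noteq> B"
  have "A \<inter> B \<noteq> A"
  proof
    assume "A \<inter> B = A"
    then have "A \<subseteq> B" by blast
    then show False
      using \<open>A \<noteq> B\<close> tri_card assms(1,2) tri_finite card_subset_eq by metis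
  qed
  moreover obtain a b c where "A = {a, b, c}" "nondeg a b c"
    using tri[OF assms(1)] by blast
  moreover have "x \<in> convex hull (A \<inter> B)"
    using inter[OF assms(1,2)] assms(3,4) interior_subset by blast
  ultimately show False
    using nondeg.proper_face_not_interior[of a b c "A \<inter> B" x] assms(3) by blast
qed

lemma interior_hull_subset: "A \<in> tris \<Longrightarrow> interior (convex hull A) \<subseteq> interior P"
  by (intro interior_mono hull_subset_P)

lemma barycenter_tri_interior:
  assumes "A \<in> tris"
  shows "barycenter (convex hull A) \<in> interior (convex hull A)"
proof -
  obtain a b c where A: "A = {a, b, c}" and n: "nondeg a b c"
    using tri[OF assms] by blast
  have v: "{v. v extreme_point_of convex hull A} = A"
    using extreme_point_of_convex_hull_affine_independent[OF tri_indep[OF assms]] by blast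
  have "barycenter (convex hull A) = (1 / 3) *\<^sub>R (a + b + c)"
    unfolding barycenter_def v tri_card[OF assms] using nondeg.distinct[OF n]
    by (simp add: A add.assoc inverse_eq_divide)
  then show ?thesis
    using nondeg.barycenter_interior[OF n] A by simp
qed

text \<open>Used with \<open>m\<close> the midpoint of an edge: a half edge of the curve lies in the
  open triangle except at that midpoint, the only place where it can meet another triangle or be
  glued.\<close>

lemma half_open_interior:
  assumes "A \<in> tris" "m \<in> convex hull A" "x \<in> closed_segment (barycenter (convex hull A)) m" "x \<noteq> m"
  shows "x \<in> interior (convex hull A)"
proof (cases "x = barycenter (convex hull A)")
  case True
  then show ?thesis
    using barycenter_tri_interior[OF assms(1)] by simp
next
  case False
  then have "x \<in> open_segment (barycenter (convex hull A)) m"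
    using assms by (simp add: open_segment_def)
  then show ?thesis
    using in_interior_closure_convex_segment[OF convex_convex_hull barycenter_tri_interior[OF assms(1)]]
      assms(2) closure_subset by blast
qed

lemma frontier_disjoint_interior: "A \<in> tris \<Longrightarrow> x \<in> interior (convex hull A) \<Longrightarrow> x \<notin> frontier P"
  using interior_hull_subset by (auto simp: frontier_def)

text \<open>If \<open>s\<close> were not parallel to \<open>p q\<close>, it would run into the open
  triangle near \<open>x\<close>; but \<open>s\<close> lies in the frontier and the open triangle in
  the interior of \<open>P\<close>. Once they are parallel, primitivity gives the inclusion.\<close>

lemma edge_in_polygon_edge:
  assumes A: "A \<in> tris" "p \<in> A" "q \<in> A" "p \<noteq> q"
    and x: "x \<in> closed_segment p q" "x \<notin> lattice" and s: "s \<in> E" "x \<in> s"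
  shows "closed_segment p q \<subseteq> s" "segment_parity s = parity p + parity q"
proof -
  obtain r where Ar: "A = {p, q, r}" and n: "nondeg p q r"
    using triE[OF A] .
  interpret nondeg p q r by (rule n)
  interpret n1: nondeg q r p by (rule nondeg_cycle)
  interpret n2: nondeg r p q by (rule n1.nondeg_cycle)
  obtain u v where uv: "u \<in> lattice" "v \<in> lattice" "u \<noteq> v" "s = closed_segment u v"
    using polygon_edges_lattice_segments[OF poly s(1)] unfolding lattice_segment_def by blast
  have pq: "p \<in> lattice" "q \<in> lattice"
    using tri_lattice[OF A(1)] A(2,3) by (simp_all only: subsetD)
  obtain l where l: "0 \<le> l" "l \<le> 1" "x = (1 - l) *\<^sub>R p + l *\<^sub>R q"
    using x(1) unfolding in_segment by blast
  have "l \<noteq> 0"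
  proof
    assume "l = 0"
    then have "x = p" using l(3) by simp
    then show False using x(2) pq by blast
  qed
  moreover have "l \<noteq> 1"
  proof
    assume "l = 1"
    then have "x = q" using l(3) by simp
    then show False using x(2) pq by blast
  qed
  ultimately have l01: "0 < l" "l < 1"
    using l(1,2) by linarith+
  obtain t where t: "0 \<le> t" "t \<le> 1" "x = (1 - t) *\<^sub>R u + t *\<^sub>R v"
    using s(2) unfolding uv(4) in_segment by blast
  have "t \<noteq> 0"
  proof
    assume "t = 0"
    then have "x = u" using t(3) by simp
    then show False using x(2) uv(1) by blast
  qed
  moreover have "t \<noteq> 1"
  proof
    assume "t = 1"
    then have "x = v" using t(3) by simp
    then show False using x(2) uv(2) by blast
  qed
  ultimately have t01: "0 < t" "t < 1"
    using t(1,2) by linarith+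
  have det: "det2 (q - p) (v - u) = 0"
  proof (rule ccontr)
    assume det: "det2 (q - p) (v - u) \<noteq> 0"
    \<comment> \<open>The rate at which the coordinate at \<open>r\<close> changes in the direction
      \<open>v - u\<close>. Moving by \<open>\<sigma> * \<kappa>\<close> with small positive
      \<open>\<sigma>\<close> raises this coordinate by \<open>\<sigma>\<close> times the square of
      \<open>\<kappa>\<close>, whatever the sign of \<open>\<kappa>\<close>.\<close>
    define \<kappa> where "\<kappa> = det2 (q - p) (v - u) / det2 (q - p) (r - p)"
    have "\<kappa> \<noteq> 0"
      using det nondeg by (simp add: \<kappa>_def)
    define y where "y \<sigma> = x + (\<sigma> * \<kappa>) *\<^sub>R (v - u)" for \<sigma> :: real
    have b: "bary p q r (y \<sigma>) = \<sigma> * \<kappa> * \<kappa>" for \<sigma>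
      unfolding y_def bary_add \<kappa>_def[symmetric] using bary_segment[OF x(1)] by simp
    have bp: "bary q r p x = 1 - l" and bq: "bary r p q x = l"
      unfolding l(3) n1.bary_affine n2.bary_affine by simp_all
    have lim1: "((\<lambda>\<sigma>. bary q r p (y \<sigma>)) \<longlongrightarrow> 1 - l) (at_right 0)"
      unfolding y_def n1.bary_add bp by (auto intro!: tendsto_eq_intros simp: n1.nondeg)
    have lim2: "((\<lambda>\<sigma>. bary r p q (y \<sigma>)) \<longlongrightarrow> l) (at_right 0)"
      unfolding y_def n2.bary_add bq by (auto intro!: tendsto_eq_intros simp: n2.nondeg)
    have lim3: "((\<lambda>\<sigma>. t + \<sigma> * \<kappa>) \<longlongrightarrow> t) (at_right 0)"
      by (auto intro!: tendsto_eq_intros)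
    have "\<forall>\<^sub>F \<sigma> in at_right (0::real). 0 < \<sigma> \<and> 0 < bary q r p (y \<sigma>) \<and> 0 < bary r p q (y \<sigma>) \<and>
        0 < t + \<sigma> * \<kappa> \<and> t + \<sigma> * \<kappa> < 1"
      using l01 t01
      by (intro eventually_conj order_tendstoD[OF lim1] order_tendstoD[OF lim2] order_tendstoD[OF lim3])
        (simp_all add: eventually_at_right_less)
    from eventually_happens'[OF trivial_limit_at_right_real this]
    obtain \<sigma> where \<sigma>: "0 < \<sigma>" "0 < bary q r p (y \<sigma>)" "0 < bary r p q (y \<sigma>)"
        "0 < t + \<sigma> * \<kappa>" "t + \<sigma> * \<kappa> < 1"
      by blast
    have "0 < bary p q r (y \<sigma>)"
      unfolding b using \<sigma>(1) \<open>\<kappa> \<noteq> 0\<close> by (simp add: mult.assoc flip: power2_eq_square)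
    then have "y \<sigma> \<in> interior (convex hull A)"
      unfolding Ar mem_interior using \<sigma> by blast
    moreover have "y \<sigma> = (1 - (t + \<sigma> * \<kappa>)) *\<^sub>R u + (t + \<sigma> * \<kappa>) *\<^sub>R v"
      unfolding y_def t(3) by (simp add: algebra_simps)
    then have "y \<sigma> \<in> s"
      unfolding uv(4) in_segment using \<sigma> by (intro exI[of _ "t + \<sigma> * \<kappa>"]) simp
    then have "y \<sigma> \<in> frontier P"
      using s(1) polygon_frontier_edges[OF poly] by blast
    ultimately show False
      using frontier_disjoint_interior[OF A(1)] by blast
  qed
  show "closed_segment p q \<subseteq> s"
    unfolding uv(4) using x s(2) uv det
    by (intro primitive_subset_collinear[OF prim[OF A], of u v x]) simp_all
  then show "segment_parity s = parity p + parity q"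
    unfolding uv(4) using primitive_segment_parity_eq[OF prim[OF A] uv(1,2)] by blast
qed

definition frontier_edges :: "(point \<times> point) set"
  where "frontier_edges = {(p, q). p \<noteq> q \<and> (\<exists>A\<in>tris. p \<in> A \<and> q \<in> A) \<and> closed_segment p q \<subseteq> frontier P}"

lemma finite_frontier_edges: "finite frontier_edges"
proof -
  have "frontier_edges \<subseteq> \<Union>tris \<times> \<Union>tris"
    by (auto simp: frontier_edges_def)
  then show ?thesis
    using fin tri_finite by (auto intro: finite_subset)
qed

lemma frontier_edges_prim: "(p, q) \<in> frontier_edges \<Longrightarrow> primitive_segment p q"
  unfolding frontier_edges_def using prim by blast

lemma nonlattice_frontier:
  assumes x: "x \<in> frontier P" "x \<notin> lattice"
  shows "\<exists>p q. (p, q) \<in> frontier_edges \<and> x \<in> closed_segment p q"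
proof -
  have "x \<in> P"
    using x(1) polygon_compact[OF poly] compact_imp_closed frontier_subset_closed by blast
  then obtain A where A: "A \<in> tris" "x \<in> convex hull A"
    using cover by blast
  obtain a b c where abc: "A = {a, b, c}" and n: "nondeg a b c"
    using tri[OF A(1)] by blast
  have "x \<in> closed_segment a b \<or> x \<in> closed_segment b c \<or> x \<in> closed_segment c a"
    using nondeg.frontier_cases[OF n] A frontier_disjoint_interior x(1) unfolding abc by blast
  then obtain p q where pq: "p \<in> A" "q \<in> A" "p \<noteq> q" "x \<in> closed_segment p q"
    unfolding abc using nondeg.distinct[OF n] by blast
  obtain s where s: "s \<in> E" "x \<in> s"
    using x(1) polygon_frontier_edges[OF poly] by blast
  have "closed_segment p q \<subseteq> s"
    by (rule edge_in_polygon_edge(1)[OF A(1) pq x(2) s])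
  then have "closed_segment p q \<subseteq> frontier P"
    using s(1) polygon_frontier_edges[OF poly] by blast
  then show ?thesis
    unfolding frontier_edges_def using pq A(1) by blast
qed

text \<open>Frontier points outside the union of these edges are lattice points, hence finite in
  number and closed. Since the frontier is connected and infinite, there are none.\<close>

lemma frontier_eq: "frontier P = (\<Union>(p, q)\<in>frontier_edges. closed_segment p q)"
proof
  let ?B = "\<Union>(p, q)\<in>frontier_edges. closed_segment p q"
  let ?F = "frontier P \<inter> lattice - ?B"
  show sub: "?B \<subseteq> frontier P"
    by (auto simp: frontier_edges_def)
  have finF: "finite (frontier P \<inter> lattice)"
    using polygon_compact[OF poly] by (intro finite_lattice compact_imp_bounded compact_frontier)
  have un: "frontier P \<subseteq> ?B \<union> ?F"
    using nonlattice_frontier by fast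
  have "closed ?B"
    using finite_frontier_edges by (intro closed_UN) auto
  moreover have "closed ?F"
    using finF by (intro finite_imp_closed) blast
  moreover have "?B \<inter> frontier P \<noteq> {}"
  proof
    assume "?B \<inter> frontier P = {}"
    then have "frontier P \<subseteq> frontier P \<inter> lattice"
      using un by blast
    then show False
      using finF polygon_infinite_frontier[OF poly] finite_subset by blast
  qed
  ultimately have "?F \<inter> frontier P = {}"
    using polygon_connected_frontier[OF poly] un unfolding connected_closed by blast
  then show "frontier P \<subseteq> ?B"
    using un by blast
qed

lemma frontier_vertex_edge:
  assumes "p \<in> frontier P" "p \<in> lattice"
  obtains a b where "(a, b) \<in> frontier_edges" "p = a \<or> p = b"
proof -
  obtain a b where ab: "(a, b) \<in> frontier_edges" "p \<in> closed_segment a b"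
    using assms(1) unfolding frontier_eq by blast
  then have "p \<in> {a, b}"
    using assms(2) primitive_segmentD(4)[OF frontier_edges_prim[OF ab(1)]] by blast
  then show ?thesis
    using that ab(1) by blast
qed

lemma frontier_vertex:
  obtains v where "v \<in> frontier P" "v \<in> lattice"
proof -
  have "frontier_edges \<noteq> {}"
    using frontier_eq polygon_infinite_frontier[OF poly] by auto
  then obtain p q where pq: "(p, q) \<in> frontier_edges"
    by auto
  then have "p \<in> frontier P"
    unfolding frontier_edges_def by auto
  then show ?thesis
    using that primitive_segmentD(1)[OF frontier_edges_prim[OF pq]] by blast
qed

text \<open>The frontier edges on which \<open>f\<close> has the value \<open>f p\<close> and the
  remaining ones cover the frontier by two closed sets. They are disjoint, since two edges that meet
  share a vertex, so connectedness of the frontier leaves only one of them.\<close>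

lemma frontier_const:
  assumes f: "\<And>p q. (p, q) \<in> frontier_edges \<Longrightarrow> f p = f q"
    and p: "p \<in> frontier P" "p \<in> lattice" and q: "q \<in> frontier P" "q \<in> lattice"
  shows "f p = f q"
proof (rule ccontr)
  assume ne: "f p \<noteq> f q"
  let ?B = "\<lambda>\<phi>. \<Union>(a, b)\<in>{(a, b) \<in> frontier_edges. \<phi> (f a)}. closed_segment a b"
  let ?B1 = "?B (\<lambda>z. z = f p)" and ?B2 = "?B (\<lambda>z. z \<noteq> f p)"
  have cl: "closed (?B \<phi>)" for \<phi>
    using finite_frontier_edges by (intro closed_UN) (auto intro: finite_subset)
  have un: "frontier P \<subseteq> ?B1 \<union> ?B2"
    unfolding frontier_eq by blast
  have "?B1 \<inter> ?B2 = {}"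
  proof (rule ccontr)
    assume "?B1 \<inter> ?B2 \<noteq> {}"
    then obtain x a b c d where x: "(a, b) \<in> frontier_edges" "(c, d) \<in> frontier_edges"
      "f a = f p" "f c \<noteq> f p" "x \<in> closed_segment a b" "x \<in> closed_segment c d"
      by blast
    obtain A C where AC: "A \<in> tris" "C \<in> tris" "{a, b} \<subseteq> A" "{c, d} \<subseteq> C"
      using x(1,2) unfolding frontier_edges_def by blast
    have "x \<in> convex hull ({a, b} \<inter> {c, d})"
      using x(5,6) hull_inter[OF AC] unfolding segment_convex_hull by blast
    then have "{a, b} \<inter> {c, d} \<noteq> {}"
      by (metis convex_hull_empty empty_iff)
    then have "f a = f c"
      using f[OF x(1)] f[OF x(2)] by auto
    then show False
      using x by simp
  qed
  moreover have "p \<in> ?B1"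
  proof -
    obtain a b where ab: "(a, b) \<in> frontier_edges" "p = a \<or> p = b"
      using frontier_vertex_edge[OF p] .
    then have "f a = f p"
      using f by blast
    moreover have "p \<in> closed_segment a b"
      using ab(2) by auto
    ultimately show ?thesis
      using ab(1) by blast
  qed
  moreover have "q \<in> ?B2"
  proof -
    obtain a b where ab: "(a, b) \<in> frontier_edges" "q = a \<or> q = b"
      using frontier_vertex_edge[OF q] .
    then have "f a \<noteq> f p"
      using f ne by metis
    moreover have "q \<in> closed_segment a b"
      using ab(2) by auto
    ultimately show ?thesis
      using ab(1) by blast
  qed
  moreover note un cl[of "\<lambda>z. z = f p"] cl[of "\<lambda>z. z \<noteq> f p"]
  moreover define B1 B2 where "B1 = ?B1" and "B2 = ?B2"
  ultimately have "closed B1" "closed B2" "frontier P \<subseteq> B1 \<union> B2" "B1 \<inter> B2 = {}" "p \<in> B1" "q \<in> B2"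
    by simp_all
  then have "B1 \<inter> frontier P = {} \<or> B2 \<inter> frontier P = {}"
    by (intro connected_closedD[OF polygon_connected_frontier[OF poly]]) simp_all
  then show False
    using \<open>p \<in> B1\<close> \<open>q \<in> B2\<close> p(1) q(1) by blast
qed

text \<open>\<open>interior P\<close> stays connected when the finitely many lattice points are
  removed, and two triangles that meet outside the lattice share an edge. So the triangles in
  \<open>\<D>\<close> and those outside it cut a connected set into two disjoint relatively closed
  parts.\<close>

lemma dual_connected:
  assumes sub: "\<D> \<subseteq> tris"
    and step: "\<And>A B p q. A \<in> \<D> \<Longrightarrow> B \<in> tris \<Longrightarrow> p \<noteq> q \<Longrightarrow> {p, q} \<subseteq> A \<inter> B \<Longrightarrow> B \<in> \<D>"
  shows "\<D> = {} \<or> \<D> = tris"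
proof -
  let ?O = "interior P - P \<inter> lattice"
  let ?C1 = "\<Union>A\<in>\<D>. convex hull A" and ?C2 = "\<Union>A\<in>tris - \<D>. convex hull A"
  have "finite (P \<inter> lattice)"
    using polygon_compact[OF poly] by (intro finite_lattice compact_imp_bounded)
  then have conn: "connected ?O"
    using polygon_connected_interior[OF poly]
    by (intro connected_open_diff_countable) (auto simp: countable_finite)
  have clh: "closed (convex hull A)" if "A \<in> tris" for A
    using tri_finite[OF that] by (intro compact_imp_closed finite_imp_compact_convex_hull)
  have cl: "closed ?C1" "closed ?C2"
    using finite_subset[OF sub fin] fin sub clh by (auto intro!: closed_UN)
  have un: "?O \<subseteq> ?C1 \<union> ?C2"
  proof
    fix x assume "x \<in> ?O"
    then have "x \<in> P"
      using interior_subset by blast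
    then obtain A where "A \<in> tris" "x \<in> convex hull A"
      using cover by blast
    then show "x \<in> ?C1 \<union> ?C2"
      by (cases "A \<in> \<D>") blast+
  qed
  have dis: "?C1 \<inter> ?C2 \<inter> ?O = {}"
  proof (rule ccontr)
    assume "?C1 \<inter> ?C2 \<inter> ?O \<noteq> {}"
    then obtain x A B where x: "A \<in> \<D>" "B \<in> tris" "B \<notin> \<D>" "x \<in> convex hull A" "x \<in> convex hull B"
      "x \<in> P" "x \<notin> lattice"
      using interior_subset by blast
    have A: "A \<in> tris"
      using x(1) sub by blast
    have x': "x \<in> convex hull (A \<inter> B)"
      using inter[OF A x(2)] x(4,5) by blast
    then obtain w where w: "w \<in> A \<inter> B"
      by (metis convex_hull_empty empty_iff equals0I)
    have "A \<inter> B \<subseteq> {w}"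
      using step[OF x(1,2)] x(3) w by blast
    then have "x \<in> convex hull {w}"
      using x' hull_mono by blast
    then show False
      using w tri_lattice[OF A] x(7) by auto
  qed
  have meets: "convex hull A \<inter> ?O \<noteq> {}" if A: "A \<in> tris" for A
  proof -
    let ?b = "barycenter (convex hull A)"
    have b: "?b \<in> interior (convex hull A)"
      by (rule barycenter_tri_interior[OF A])
    obtain a b c where abc: "A = {a, b, c}" "nondeg a b c"
      using tri[OF A] by blast
    have "?b \<notin> A"
    proof
      assume "?b \<in> A"
      moreover have "{?b} \<noteq> A"
      proof
        assume "{?b} = A"
        then have "card A = card {?b}" by simp
        then show False using tri_card[OF A] by simp
      qed
      ultimately have "?b \<in> convex hull {?b}" "{?b} \<subseteq> A" "{?b} \<noteq> A"
        by simp_all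
      then show False
        using nondeg.proper_face_not_interior[OF abc(2), of "{?b}" ?b] b abc(1) by blast
    qed
    moreover have bA: "?b \<in> convex hull A"
      using b interior_subset by blast
    ultimately have "?b \<notin> lattice"
      using lat[OF A] by (metis IntI)
    then have "?b \<in> ?O"
      using b interior_hull_subset[OF A] by (metis DiffI IntE subsetD)
    then show ?thesis
      using bA by (metis IntI empty_iff)
  qed
  have "?C1 \<inter> ?O = {} \<or> ?C2 \<inter> ?O = {}"
    using connected_closedD[OF conn dis un cl] .
  then show ?thesis
  proof
    assume "?C1 \<inter> ?O = {}"
    then show ?thesis
      using meets sub by blast
  next
    assume "?C2 \<inter> ?O = {}"
    then have "tris - \<D> = {}"
      using meets by blast
    then show ?thesis
      using sub by blast
  qed
qed

end

subsection \<open>Cocycles on a triangulated disc\<close>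

text \<open>The graphs of all local sections and of their negatives form a two-sheeted covering of
  \<open>S\<close>. Over a simply connected and locally path connected base the identity lifts to
  it, which is a consistent choice of sign.\<close>

lemma orient_line_field:
  fixes S :: "'a::real_normed_vector set" and s :: "'i \<Rightarrow> 'a \<Rightarrow> 'b::euclidean_space"
  assumes S: "simply_connected S" "locally path_connected S"
    and cov: "\<And>x. x \<in> S \<Longrightarrow> \<exists>i\<in>I. x \<in> U i"
    and op: "\<And>i. i \<in> I \<Longrightarrow> openin (top_of_set S) (U i)"
    and cont: "\<And>i. i \<in> I \<Longrightarrow> continuous_on (U i) (s i)"
    and nz: "\<And>i x. i \<in> I \<Longrightarrow> x \<in> U i \<Longrightarrow> s i x \<noteq> 0"
    and agree: "\<And>i j x. i \<in> I \<Longrightarrow> j \<in> I \<Longrightarrow> x \<in> U i \<Longrightarrow> x \<in> U j \<Longrightarrow> s i x = s j x \<or> s i x = - s j x"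
  obtains g where "continuous_on S g" "\<And>i x. i \<in> I \<Longrightarrow> x \<in> U i \<Longrightarrow> g x = s i x \<or> g x = - s i x"
proof -
  define C where "C = {z. \<exists>i\<in>I. fst z \<in> U i \<and> (snd z = s i (fst z) \<or> snd z = - s i (fst z))}"
  have US: "U i \<subseteq> S" if "i \<in> I" for i
    using op[OF that] openin_imp_subset by blast
  have Ci: "snd z = s i (fst z) \<or> snd z = - s i (fst z)" if "z \<in> C" "i \<in> I" "fst z \<in> U i" for z i
  proof -
    obtain j where j: "j \<in> I" "fst z \<in> U j" "snd z = s j (fst z) \<or> snd z = - s j (fst z)"
      using \<open>z \<in> C\<close> unfolding C_def by blast
    then show ?thesis
      using agree[OF that(2) j(1) that(3) j(2)] by auto
  qed
  have "covering_space C fst S"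
    unfolding covering_space_def
  proof (intro conjI ballI)
    show "continuous_on C fst"
      by (intro continuous_intros)
    show "fst ` C = S"
    proof
      show "fst ` C \<subseteq> S"
        using US unfolding C_def by blast
      show "S \<subseteq> fst ` C"
      proof
        fix x assume "x \<in> S"
        then obtain i where "i \<in> I" "x \<in> U i"
          using cov by blast
        then have "(x, s i x) \<in> C"
          unfolding C_def by auto
        then show "x \<in> fst ` C"
          by (metis fst_conv imageI)
      qed
    qed
    fix x assume "x \<in> S"
    then obtain i where i: "i \<in> I" "x \<in> U i"
      using cov by blast
    \<comment> \<open>The sign of this inner product tells the two sheets over \<open>U i\<close>
      apart and makes each of them open.\<close>
    define \<phi> where "\<phi> z = snd z \<bullet> s i (fst z)" for z :: "'a \<times> 'b"
    define C' where "C' = C \<inter> fst -` U i"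
    define V where "V \<sigma> = (\<lambda>x. (x, \<sigma> *\<^sub>R s i x)) ` U i" for \<sigma> :: real
    have opC': "openin (top_of_set C) C'"
      unfolding C'_def using \<open>fst ` C = S\<close> op[OF i(1)]
      by (intro continuous_openin_preimage[of C fst S]) (auto intro!: continuous_intros)
    have VC: "V \<sigma> \<subseteq> C'" if "\<sigma> = 1 \<or> \<sigma> = -1" for \<sigma>
      using that i(1) unfolding V_def C'_def C_def by auto
    have pos: "0 < s i y \<bullet> s i y" if "y \<in> U i" for y
      using nz[OF i(1) that] by simp
    have Veq: "V \<sigma> = C' \<inter> (\<lambda>z. \<sigma> * \<phi> z) -` {0<..}" if "\<sigma> = 1 \<or> \<sigma> = -1" for \<sigma>
    proof
      show "V \<sigma> \<subseteq> C' \<inter> (\<lambda>z. \<sigma> * \<phi> z) -` {0<..}"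
        using VC[OF that] pos that unfolding V_def \<phi>_def by auto
      show "C' \<inter> (\<lambda>z. \<sigma> * \<phi> z) -` {0<..} \<subseteq> V \<sigma>"
      proof
        fix z assume z: "z \<in> C' \<inter> (\<lambda>z. \<sigma> * \<phi> z) -` {0<..}"
        then have zU: "fst z \<in> U i" and zC: "z \<in> C" and zp: "0 < \<sigma> * \<phi> z"
          unfolding C'_def by auto
        have "snd z = \<sigma> *\<^sub>R s i (fst z)"
          using Ci[OF zC i(1) zU] zp pos[OF zU] that unfolding \<phi>_def
          by (auto simp: leD[OF inner_ge_zero])
        then have "z = (fst z, \<sigma> *\<^sub>R s i (fst z))"
          by (simp add: prod_eq_iff)
        then show "z \<in> V \<sigma>"
          unfolding V_def using zU by blast
      qed
    qed
    have cont\<phi>: "continuous_on C' (\<lambda>z. \<sigma> * \<phi> z)" for \<sigma>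
    proof -
      have "continuous_on C' (\<lambda>z. s i (fst z))"
        by (intro continuous_on_compose2[OF cont[OF i(1)]] continuous_intros) (auto simp: C'_def)
      then show ?thesis
        unfolding \<phi>_def by (intro continuous_intros)
    qed
    have opV: "openin (top_of_set C) (V \<sigma>)" if "\<sigma> = 1 \<or> \<sigma> = -1" for \<sigma>
    proof -
      have "openin (top_of_set C') (V \<sigma>)"
        unfolding Veq[OF that] by (intro continuous_openin_preimage_gen cont\<phi>) auto
      then show ?thesis
        using opC' openin_trans by blast
    qed
    show "\<exists>T. x \<in> T \<and> openin (top_of_set S) T \<and>
        (\<exists>v. \<Union>v = C \<inter> fst -` T \<and> (\<forall>u\<in>v. openin (top_of_set C) u) \<and>
             pairwise disjnt v \<and> (\<forall>u\<in>v. \<exists>q. homeomorphism u T fst q))"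
    proof (intro exI[of _ "U i"] exI[of _ "{V 1, V (-1)}"] conjI ballI)
      show "x \<in> U i" "openin (top_of_set S) (U i)"
        using i op by auto
      have "C' \<subseteq> V 1 \<union> V (-1)"
      proof
        fix z assume z: "z \<in> C'"
        then have zU: "fst z \<in> U i" and zC: "z \<in> C"
          unfolding C'_def by auto
        have "\<phi> z \<noteq> 0"
          using Ci[OF zC i(1) zU] pos[OF zU] unfolding \<phi>_def by auto
        then show "z \<in> V 1 \<union> V (-1)"
          using z Veq[of 1] Veq[of "-1"] by auto
      qed
      then show "\<Union>{V 1, V (- 1)} = C \<inter> fst -` U i"
        using VC[of 1] VC[of "-1"] unfolding C'_def by auto
      show "openin (top_of_set C) u" if "u \<in> {V 1, V (- 1)}" for u
        using that opV by auto
      have "V 1 \<inter> V (-1) = {}"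
        using Veq[of 1] Veq[of "-1"] by auto
      then show "pairwise disjnt {V 1, V (- 1)}"
        by (auto simp: pairwise_def disjnt_def)
      show "\<exists>q. homeomorphism u (U i) fst q" if "u \<in> {V 1, V (- 1)}" for u
      proof -
        obtain \<sigma> where u: "u = V \<sigma>"
          using \<open>u \<in> {V 1, V (- 1)}\<close> by blast
        have "homeomorphism u (U i) fst (\<lambda>x. (x, \<sigma> *\<^sub>R s i x))"
          unfolding homeomorphism_def u V_def
          by (auto intro!: continuous_intros cont[OF i(1)] simp: image_image)
        then show ?thesis
          by (intro exI[of _ "\<lambda>x. (x, \<sigma> *\<^sub>R s i x)"])
      qed
    qed
  qed
  then obtain g where g: "continuous_on S g" "g \<in> S \<rightarrow> C" "\<And>y. y \<in> S \<Longrightarrow> fst (g y) = y"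
    using covering_space_lift[OF _ S continuous_on_id, of C fst S] by auto
  show ?thesis
  proof (rule that[of "\<lambda>x. snd (g x)"])
    show "continuous_on S (\<lambda>x. snd (g x))"
      by (intro continuous_intros g(1))
    show "snd (g x) = s i x \<or> snd (g x) = - s i x" if "i \<in> I" "x \<in> U i" for i x
    proof -
      have "x \<in> S" using US that by blast
      then show ?thesis
        using Ci[of "g x" i] g(2,3) that by auto
    qed
  qed
qed

section \<open>Potentials from line fields\<close>

context lattice_disc
begin

text \<open>
  \<open>bump w\<close> replaces the barycentric coordinate of the vertex \<open>w\<close>: on \<open>P\<close> it is positive exactly
  on the open star of \<open>w\<close>, and it is continuous by construction.
\<close>

definition opp :: "point \<Rightarrow> point set"
  where "opp w = (\<Union>A\<in>tris. convex hull (A - {w}))"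

definition bump :: "point \<Rightarrow> point \<Rightarrow> real"
  where "bump w x = infdist x (opp w)"

lemma tris_nonempty: "tris \<noteq> {}"
proof
  assume "tris = {}"
  then have "frontier P = {}"
    using cover by auto
  then show False
    using polygon_infinite_frontier[OF poly] by simp
qed

lemma opp_closed: "closed (opp w)" and opp_nonempty: "opp w \<noteq> {}"
proof -
  have "closed (convex hull (A - {w}))" if "A \<in> tris" for A
    using tri_finite[OF that] by (intro compact_imp_closed finite_imp_compact_convex_hull) simp
  then show "closed (opp w)"
    unfolding opp_def by (intro closed_UN ballI fin) blast
  obtain A where A: "A \<in> tris"
    using tris_nonempty by blast
  then obtain a b c where "A = {a, b, c}" "nondeg a b c"
    using tri by blast
  then have "\<exists>q\<in>A. q \<noteq> w"
    using nondeg.distinct(1) by (metis insertCI)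
  then have "A - {w} \<noteq> {}"
    by blast
  then show "opp w \<noteq> {}"
    unfolding opp_def using A convex_hull_eq_empty by blast
qed

lemma bump_cont: "continuous_on S (bump w)"
  unfolding bump_def by (intro continuous_intros)

lemma bump_nonneg: "0 \<le> bump w x"
  by (simp add: bump_def infdist_nonneg)

lemma bump_zero_iff: "bump w x = 0 \<longleftrightarrow> x \<in> opp w"
  using in_closed_iff_infdist_zero[OF opp_closed opp_nonempty] by (simp add: bump_def)

text \<open>A face of another triangle that avoids \<open>w\<close> meets the hull of
  \<open>A\<close> in a face of \<open>A\<close> that avoids \<open>w\<close>. So membership can be
  tested in any single triangle containing \<open>x\<close>.\<close>

lemma opp_iff:
  assumes "A \<in> tris" "x \<in> convex hull A"
  shows "x \<in> opp w \<longleftrightarrow> x \<in> convex hull (A - {w})"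
proof
  assume "x \<in> opp w"
  then obtain B where B: "B \<in> tris" "x \<in> convex hull (B - {w})"
    unfolding opp_def by blast
  then have "x \<in> convex hull (A \<inter> (B - {w}))"
    using hull_inter[OF assms(1) B(1) subset_refl, of "B - {w}"] assms(2) by blast
  moreover have "A \<inter> (B - {w}) \<subseteq> A - {w}"
    by blast
  ultimately show "x \<in> convex hull (A - {w})"
    using hull_mono by blast
next
  assume "x \<in> convex hull (A - {w})"
  then show "x \<in> opp w"
    unfolding opp_def using assms(1) by blast
qed

lemma bump_pos_vertex:
  assumes "A \<in> tris" "x \<in> convex hull A" "bump w x \<noteq> 0"
  shows "w \<in> A"
proof (rule ccontr)
  assume "w \<notin> A"
  then have "A - {w} = A" by simp
  then have "x \<in> opp w"
    using opp_iff[OF assms(1,2), of w] assms(2) by simp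
  then show False
    using assms(3) bump_zero_iff by blast
qed

lemma bump_cover:
  assumes "A \<in> tris" "x \<in> convex hull A"
  shows "\<exists>w\<in>A. 0 < bump w x"
proof (rule ccontr)
  assume "\<not> (\<exists>w\<in>A. 0 < bump w x)"
  then have z: "x \<in> convex hull (A - {w})" if "w \<in> A" for w
    using that opp_iff[OF assms] bump_nonneg[of w x] bump_zero_iff by (metis order_le_less)
  obtain a b c where A: "A = {a, b, c}" and n: "nondeg a b c"
    using tri[OF assms(1)] by blast
  have "convex hull (A - {a}) \<inter> convex hull (A - {b}) = convex hull ((A - {a}) \<inter> (A - {b}))"
    by (intro hull_inter[OF assms(1,1)]) auto
  moreover have "convex hull ((A - {a}) \<inter> (A - {b})) \<inter> convex hull (A - {c}) =
      convex hull (((A - {a}) \<inter> (A - {b})) \<inter> (A - {c}))"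
    by (intro hull_inter[OF assms(1,1)]) auto
  moreover have "((A - {a}) \<inter> (A - {b})) \<inter> (A - {c}) = {}"
    unfolding A by blast
  ultimately have "x \<in> convex hull {}"
    using z[of a] z[of b] z[of c] A by auto
  then show False by simp
qed

text \<open>A cocycle with values in \<open>{1, -1}\<close> defines a line field on the disc; orienting it gives a
  potential.\<close>

lemma cocycle_potential:
  fixes Z :: "point \<Rightarrow> point \<Rightarrow> real"
  assumes Z1: "\<And>p q. Z p q = 1 \<or> Z p q = - 1"
    and cocycle: "\<And>A p q r. A \<in> tris \<Longrightarrow> p \<in> A \<Longrightarrow> q \<in> A \<Longrightarrow> r \<in> A \<Longrightarrow> Z p q * Z q r = Z p r"
  obtains f :: "point \<Rightarrow> real" where "\<And>p. f p = 1 \<or> f p = - 1"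
    "\<And>A p q. A \<in> tris \<Longrightarrow> p \<in> A \<Longrightarrow> q \<in> A \<Longrightarrow> Z p q = f p * f q"
proof -
  define V where "V = \<Union>tris"
  have finV: "finite V"
    unfolding V_def using fin tri_finite by blast
  define U where "U v = {x \<in> P. 0 < bump v x}" for v
  \<comment> \<open>The additional coordinate 1 makes the vertices of a triangle linearly
    independent, so \<open>s v x\<close> is nonzero wherever \<open>bump v x\<close> is positive. By
    the cocycle rule, changing the base vertex from \<open>u\<close> to \<open>v\<close> multiplies
    by \<open>Z u v\<close>, hence the line spanned by the vector is independent of it.\<close>
  define s :: "point \<Rightarrow> point \<Rightarrow> real \<times> point"
    where "s v x = (\<Sum>w\<in>V. (Z v w * bump w x) *\<^sub>R (1, w))" for v x
  have Zpp: "Z p p = 1" if "A \<in> tris" "p \<in> A" for A p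
    using cocycle[OF that that(2) that(2)] Z1[of p p] by auto
  have s_tri: "s v x = (\<Sum>w\<in>A. (Z v w * bump w x) *\<^sub>R (1, w))" if "A \<in> tris" "x \<in> convex hull A" for A v x
    unfolding s_def
  proof (rule sum.mono_neutral_right)
    show "finite V" by (rule finV)
    show "A \<subseteq> V" unfolding V_def using that(1) by blast
    show "\<forall>i\<in>V - A. (Z v i * bump i x) *\<^sub>R (1, i) = 0"
    proof
      fix i assume "i \<in> V - A"
      then have "bump i x = 0"
        using bump_pos_vertex[OF that] by blast
      then show "(Z v i * bump i x) *\<^sub>R (1, i) = 0"
        by (simp only: mult_zero_right scaleR_zero_left)
    qed
  qed
  have tri_of: "\<exists>A\<in>tris. x \<in> convex hull A" if "x \<in> P" for x
    using that cover by blast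
  have s_rel: "s u x = Z u v *\<^sub>R s v x" if "A \<in> tris" "x \<in> convex hull A" "u \<in> A" "v \<in> A" for A u v x
  proof -
    have "s u x = (\<Sum>w\<in>A. Z u v *\<^sub>R ((Z v w * bump w x) *\<^sub>R (1, w)))"
      unfolding s_tri[OF that(1,2)]
    proof (rule sum.cong[OF refl])
      fix w assume "w \<in> A"
      then have "Z u w = Z u v * Z v w"
        using cocycle[OF that(1,3,4)] by simp
      then show "(Z u w * bump w x) *\<^sub>R (1, w) = Z u v *\<^sub>R ((Z v w * bump w x) *\<^sub>R (1, w))"
        by simp
    qed
    then show ?thesis
      unfolding s_tri[OF that(1,2)] by (simp only: scaleR_sum_right)
  qed
  have U_vertex: "v \<in> A" if "A \<in> tris" "x \<in> convex hull A" "x \<in> U v" for A v x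
    using bump_pos_vertex[OF that(1,2)] that(3) by (auto simp: U_def)
  have s_nz: "s v x \<noteq> 0" if x: "x \<in> U v" for v x
  proof
    assume 0: "s v x = 0"
    obtain A where A: "A \<in> tris" "x \<in> convex hull A"
      using tri_of x unfolding U_def by blast
    have v: "v \<in> A"
      by (rule U_vertex[OF A x])
    obtain q where "q \<in> A" "q \<noteq> v"
      using tri_two[OF A(1) v] .
    then obtain r where Ar: "A = {v, q, r}" and n: "nondeg v q r"
      using triE[OF A(1) v, of q] by metis
    define c where "c w = Z v w * bump w x" for w
    have "c v *\<^sub>R (1, v) + c q *\<^sub>R (1, q) + c r *\<^sub>R (1, r) = (0 :: real \<times> point)"
      using 0 nondeg.distinct[OF n] unfolding s_tri[OF A] Ar by (simp add: c_def add.assoc)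
    then have sum0: "c v + c q + c r = 0" and vec0: "c v *\<^sub>R v + c q *\<^sub>R q + c r *\<^sub>R r = 0"
      by (simp_all add: prod_eq_iff)
    have "c q = - c v - c r"
      using sum0 by simp
    then have "c v *\<^sub>R (v - q) + c r *\<^sub>R (r - q) = 0"
      using vec0 unfolding \<open>c q = - c v - c r\<close> by (simp add: algebra_simps)
    then have "det2 (r - q) (c v *\<^sub>R (v - q) + c r *\<^sub>R (r - q)) = 0"
      by simp
    moreover have "det2 (r - q) (c v *\<^sub>R (v - q) + c r *\<^sub>R (r - q)) = c v * det2 (r - q) (v - q)"
      by (simp add: det2_def algebra_simps)
    moreover have "det2 (r - q) (v - q) \<noteq> 0"
      using n by (simp add: nondeg_def det2_cycle[of r q v])
    ultimately have "c v = 0"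
      by simp
    then show False
      using Zpp[OF A(1) v] x by (simp add: c_def U_def)
  qed
  have s_cont: "continuous_on S (s v)" for v S
    unfolding s_def by (intro continuous_intros bump_cont)
  obtain g where gc: "continuous_on P g" and g: "\<And>v x. v \<in> V \<Longrightarrow> x \<in> U v \<Longrightarrow> g x = s v x \<or> g x = - s v x"
  proof (rule orient_line_field[of P V U s])
    show "simply_connected P" "locally path_connected P"
      by (fact polygon_simply_connected[OF poly] polygon_locally_path_connected[OF poly])+
    show "\<exists>i\<in>V. x \<in> U i" if xP: "x \<in> P" for x
    proof -
      obtain A where A: "A \<in> tris" "x \<in> convex hull A"
        using tri_of[OF xP] by blast
      then obtain w where "w \<in> A" "0 < bump w x"
        using bump_cover by blast
      then show ?thesis
        using A(1) xP unfolding V_def U_def by blast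
    qed
    show "openin (top_of_set P) (U i)" if "i \<in> V" for i
    proof -
      have "U i = P \<inter> bump i -` {0<..}"
        unfolding U_def by auto
      then show ?thesis
        using continuous_openin_preimage_gen[OF bump_cont open_greaterThan, of P i 0] by simp
    qed
    show "continuous_on (U i) (s i)" if "i \<in> V" for i
      by (rule s_cont)
    show "s i x \<noteq> 0" if "i \<in> V" "x \<in> U i" for i x
      using s_nz that by blast
    show "s i x = s j x \<or> s i x = - s j x" if ij: "i \<in> V" "j \<in> V" "x \<in> U i" "x \<in> U j" for i j x
    proof -
      obtain A where A: "A \<in> tris" "x \<in> convex hull A"
        using tri_of ij(3) unfolding U_def by blast
      have "s i x = Z i j *\<^sub>R s j x"
        by (rule s_rel[OF A U_vertex[OF A ij(3)] U_vertex[OF A ij(4)]])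
      then show ?thesis
        using Z1[of i j] by auto
    qed
  qed blast
  \<comment> \<open>The orientation \<open>g\<close> at a vertex, compared with the section based at
    this vertex.\<close>
  define f :: "point \<Rightarrow> real" where "f v = (if g v = s v v then 1 else - 1)" for v
  have f1: "f p = 1 \<or> f p = - 1" for p
    by (simp add: f_def)
  \<comment> \<open>From \<open>p\<close> up to the midpoint the edge stays in the open star of
    \<open>p\<close>, where the product of \<open>g\<close> with the section of \<open>p\<close>
    never vanishes. So the sign found at \<open>p\<close> persists up to the midpoint.\<close>
  have mid: "g ((1/2) *\<^sub>R p + (1/2) *\<^sub>R q) = f p *\<^sub>R s p ((1/2) *\<^sub>R p + (1/2) *\<^sub>R q) \<and>
      (1/2) *\<^sub>R p + (1/2) *\<^sub>R q \<in> U p \<and> (1/2) *\<^sub>R p + (1/2) *\<^sub>R q \<in> convex hull A"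
    if A: "A \<in> tris" "p \<in> A" "q \<in> A" "p \<noteq> q" for A p q
  proof -
    obtain r where Ar: "A = {p, q, r}" and n: "nondeg p q r"
      using triE[OF A] .
    interpret nondeg p q r by (rule n)
    interpret n1: nondeg q r p by (rule nondeg_cycle)
    define \<gamma> where "\<gamma> l = (1 - l) *\<^sub>R p + l *\<^sub>R q" for l :: real
    have \<gamma>A: "\<gamma> l \<in> convex hull A" if "0 \<le> l" "l < 1" for l
      using edge_subset_hull[OF A(1-3)] that unfolding \<gamma>_def
      by (intro subsetD[OF edge_subset_hull[OF A(1-3)]]) (auto simp: in_segment intro!: exI[of _ l])
    have \<gamma>U: "\<gamma> l \<in> U p" if "0 \<le> l" "l < 1" for l
    proof -
      have "bary q r p (\<gamma> l) \<noteq> 0"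
        unfolding \<gamma>_def n1.bary_affine using that by simp
      then have "\<gamma> l \<notin> closed_segment q r"
        using n1.bary_segment by blast
      moreover have "A - {p} = {q, r}"
        unfolding Ar using distinct by blast
      ultimately have "\<gamma> l \<notin> opp p"
        using opp_iff[OF A(1) \<gamma>A[OF that]] by (simp add: segment_convex_hull)
      then have "0 < bump p (\<gamma> l)"
        using bump_zero_iff bump_nonneg by (metis order_le_less)
      then show ?thesis
        unfolding U_def using \<gamma>A[OF that] hull_subset_P[OF A(1)] by blast
    qed
    have pV: "p \<in> V"
      unfolding V_def using A by blast
    define h where "h l = g (\<gamma> l) \<bullet> s p (\<gamma> l)" for l
    have h0: "h l \<noteq> 0" if "0 \<le> l" "l < 1" for l
      using g[OF pV \<gamma>U[OF that]] s_nz[OF \<gamma>U[OF that]] unfolding h_def by auto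
    have \<gamma>c: "continuous_on {0..<1} \<gamma>"
      unfolding \<gamma>_def by (intro continuous_intros)
    have "continuous_on {0..<1} h"
      unfolding h_def
    proof (intro continuous_intros)
      show "continuous_on {0..<1} (\<lambda>l. g (\<gamma> l))"
        using \<gamma>U by (intro continuous_on_compose2[OF gc \<gamma>c]) (auto simp: U_def)
      show "continuous_on {0..<1} (\<lambda>l. s p (\<gamma> l))"
        by (intro continuous_on_compose2[OF s_cont \<gamma>c]) auto
    qed
    then have conn: "connected (h ` {0..<1})"
      by (intro connected_continuous_image) auto
    have same: "0 < h 0 * h (1/2)"
    proof (rule ccontr)
      assume "\<not> 0 < h 0 * h (1/2)"
      then have "h 0 \<le> 0 \<and> 0 \<le> h (1/2) \<or> h (1/2) \<le> 0 \<and> 0 \<le> h 0"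
        by (auto simp: zero_less_mult_iff not_less)
      moreover have "h 0 \<in> h ` {0..<1}" "h (1/2) \<in> h ` {0..<1}"
        by auto
      ultimately have "0 \<in> h ` {0..<1}"
        using connectedD_interval[OF conn] by blast
      then show False
        using h0 by auto
    qed
    have g0: "g p = f p *\<^sub>R s p p"
      using g[OF pV, of p] \<gamma>U[of 0] by (auto simp: f_def \<gamma>_def)
    have "h 0 = f p * (s p p \<bullet> s p p)"
      unfolding h_def using g0 by (simp add: \<gamma>_def)
    moreover have "0 < s p p \<bullet> s p p"
      using s_nz[of p p] \<gamma>U[of 0] by (simp add: \<gamma>_def)
    ultimately have pos: "0 < f p * h (1/2)"
      using same f1[of p] by (auto simp: zero_less_mult_iff leD[OF inner_ge_zero])
    have m: "\<gamma> (1/2) \<in> U p"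
      by (rule \<gamma>U) auto
    have "g (\<gamma> (1/2)) = f p *\<^sub>R s p (\<gamma> (1/2))"
      using g[OF pV m] f1[of p] pos unfolding h_def
      by (auto simp: zero_less_mult_iff leD[OF inner_ge_zero])
    moreover have "\<gamma> (1/2) \<in> convex hull A"
      by (rule \<gamma>A) auto
    ultimately show ?thesis
      using m unfolding \<gamma>_def by simp
  qed
  show ?thesis
  proof (rule that[OF f1])
    fix A p q assume A: "A \<in> tris" "p \<in> A" "q \<in> A"
    show "Z p q = f p * f q"
    proof (cases "p = q")
      case True
      then show ?thesis
        using Zpp[OF A(1,2)] f1[of p] by auto
    next
      case False
      define m where "m = (1/2) *\<^sub>R p + (1/2) *\<^sub>R q"
      have 1: "g m = f p *\<^sub>R s p m" "m \<in> U p" "m \<in> convex hull A"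
        using mid[OF A False] unfolding m_def by blast+
      have 2: "g m = f q *\<^sub>R s q m"
        using mid[OF A(1,3,2)] False unfolding m_def by (simp add: add.commute)
      \<comment> \<open>At the midpoint \<open>g\<close> is compared with the sections of both ends,
        and these differ by the factor \<open>Z q p\<close>.\<close>
      have "s q m = Z q p *\<^sub>R s p m"
        by (rule s_rel[OF A(1) 1(3) A(3,2)])
      then have "(f p - f q * Z q p) *\<^sub>R s p m = 0"
        using 1(1) 2 by (auto simp: algebra_simps)
      then have "f p = f q * Z q p"
        using s_nz[OF 1(2)] by simp
      moreover have "Z p q * Z q p = 1"
        using cocycle[OF A A(2)] Zpp[OF A(1,2)] by simp
      ultimately show ?thesis
        using f1[of p] f1[of q] Z1[of p q] Z1[of q p] by auto
    qed
  qed
qed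

end

subsection \<open>Signs in the four copies\<close>

text \<open>Negativity of the edge \<open>p q\<close> in the copy \<open>\<epsilon>\<close>,
  expressed by its ends instead of the segment.\<close>

definition opposite :: "(point \<Rightarrow> int) \<Rightarrow> bit \<times> bit \<Rightarrow> point \<Rightarrow> point \<Rightarrow> bool"
  where "opposite \<delta> \<epsilon> p q \<longleftrightarrow> copy_sign \<delta> \<epsilon> p * copy_sign \<delta> \<epsilon> q = - 1"

lemma opposite_sym: "opposite \<delta> \<epsilon> p q \<longleftrightarrow> opposite \<delta> \<epsilon> q p"
  by (simp add: opposite_def mult.commute)

lemma bit_pair_all: "(\<forall>\<epsilon>::bit \<times> bit. Q \<epsilon>) \<longleftrightarrow> Q (0, 0) \<and> Q (0, 1) \<and> Q (1, 0) \<and> Q (1, 1)"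
  by (metis bit.exhaust surj_pair)

lemma bit_pair_ex: "(\<exists>\<epsilon>::bit \<times> bit. Q \<epsilon>) \<longleftrightarrow> Q (0, 0) \<or> Q (0, 1) \<or> Q (1, 0) \<or> Q (1, 1)"
  using bit_pair_all[of "\<lambda>\<epsilon>. \<not> Q \<epsilon>"] by blast

lemma copy_sign_pm: "\<delta> p = 1 \<or> \<delta> p = - 1 \<Longrightarrow> copy_sign \<delta> \<epsilon> p = 1 \<or> copy_sign \<delta> \<epsilon> p = - 1"
  by (auto simp: copy_sign_def m1pow_def)

lemma opposite_iff:
  assumes "\<delta> p = 1 \<or> \<delta> p = - 1" "\<delta> q = 1 \<or> \<delta> q = - 1"
  shows "opposite \<delta> \<epsilon> p q \<longleftrightarrow> copy_sign \<delta> \<epsilon> p \<noteq> copy_sign \<delta> \<epsilon> q"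
  using copy_sign_pm[of \<delta> p \<epsilon>] copy_sign_pm[of \<delta> q \<epsilon>] assms by (auto simp: opposite_def)

lemma m1pow_add: "m1pow (a + b) = m1pow a * m1pow b"
  by (cases a; cases b) (simp_all add: m1pow_def)

text \<open>The copy enters only through its pairing with the parity of the edge, so the exponent of
  the sign is an affine function of \<open>\<epsilon>\<close>.\<close>

lemma opposite_alt:
  "opposite \<delta> \<epsilon> p q \<longleftrightarrow>
    m1pow (fst \<epsilon> * fst (parity p + parity q) + snd \<epsilon> * snd (parity p + parity q)) * (\<delta> p * \<delta> q) = - 1"
proof -
  have "fst \<epsilon> * fst (parity p + parity q) + snd \<epsilon> * snd (parity p + parity q) =
      (fst \<epsilon> * fst (parity p) + snd \<epsilon> * snd (parity p)) + (fst \<epsilon> * fst (parity q) + snd \<epsilon> * snd (parity q))"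
    by (simp only: fst_add snd_add distrib_left ac_simps)
  then show ?thesis
    unfolding opposite_def copy_sign_def by (simp only: m1pow_add ac_simps)
qed

text \<open>For a nonzero edge parity the sign is a nonconstant affine function on a plane with four
  points. It is negative on a coset of the line orthogonal to the edge parity, and this line is
  generated by the swapped parity.\<close>

lemma opposite_copies:
  assumes "\<delta> p = 1 \<or> \<delta> p = - 1" "\<delta> q = 1 \<or> \<delta> q = - 1" "parity p \<noteq> parity q"
  shows "\<exists>\<epsilon>0. (\<forall>\<epsilon>. opposite \<delta> \<epsilon> p q \<longleftrightarrow> \<epsilon> = \<epsilon>0 \<or> \<epsilon> = prod.swap (parity p + parity q) + \<epsilon>0) \<and>
    prod.swap (parity p + parity q) + \<epsilon>0 \<noteq> \<epsilon>0"
proof -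
  obtain x y where w: "parity p + parity q = (x, y)"
    by (metis surj_pair)
  have "(x, y) \<noteq> (0, 0)"
  proof
    assume "(x, y) = (0, 0)"
    then have "fst (parity p) + fst (parity q) = 0" "snd (parity p) + snd (parity q) = 0"
      using arg_cong[OF w, of fst] arg_cong[OF w, of snd] by simp_all
    moreover have "a = b" if "a + b = 0" for a b :: bit
      using that by (cases a; cases b) simp_all
    ultimately have "parity p = parity q"
      unfolding prod_eq_iff by blast
    then show False using assms(3) by contradiction
  qed
  moreover have "\<delta> p * \<delta> q = 1 \<or> \<delta> p * \<delta> q = - 1"
    using assms(1,2) by auto
  ultimately show ?thesis
    unfolding opposite_alt w bit_pair_ex bit_pair_all
    by (cases x; cases y; elim disjE) (simp_all add: m1pow_def)
qed

text \<open>A vector of the plane mod 2 is orthogonal to its swap, so the pairing in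
  \<open>opposite_alt\<close> does not change.\<close>

lemma opposite_swap:
  assumes "opposite \<delta> \<epsilon> p q"
  shows "opposite \<delta> (prod.swap (parity p + parity q) + \<epsilon>) p q"
proof -
  have key: "(y + e) * x + (x + f) * y = e * x + f * y" for x y e f :: bit
    by (cases x; cases y; cases e; cases f) simp_all
  obtain x y where w: "parity p + parity q = (x, y)"
    by (metis surj_pair)
  obtain e f where \<epsilon>: "\<epsilon> = (e, f)"
    by (metis surj_pair)
  show ?thesis
    using assms unfolding opposite_alt w \<epsilon> swap_simp add_Pair fst_conv snd_conv key .
qed

lemma UNIV_bit_pair: "(UNIV :: (bit \<times> bit) set) = {(0, 0), (0, 1), (1, 0), (1, 1)}"
proof -
  have "\<forall>\<epsilon>::bit \<times> bit. \<epsilon> \<in> {(0, 0), (0, 1), (1, 0), (1, 1)}"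
    unfolding bit_pair_all by simp
  then show ?thesis by blast
qed

lemma finite_bit_pair: "finite (S :: (bit \<times> bit) set)"
  by (rule finite_subset[OF subset_UNIV]) (simp add: UNIV_bit_pair)

lemma refl_map_add: "refl_map (\<epsilon> + \<eta>) x = refl_map \<epsilon> (refl_map \<eta> x)"
  by (simp only: refl_map_def m1pow_add mult.assoc fst_add snd_add fst_conv snd_conv)

lemma refl_map_involution: "refl_map \<epsilon> (refl_map \<epsilon> x) = x"
  by (simp add: refl_map_def m1pow_def prod_eq_iff)

lemma inj_refl_map: "inj (refl_map \<epsilon>)"
  by (metis injI refl_map_involution)

lemma refl_map_cont: "continuous_on S (refl_map \<epsilon>)"
  unfolding refl_map_def by (intro continuous_intros)

subsection \<open>The curve\<close>

lemma midpoint_in_segment: "(1/2) *\<^sub>R p + (1/2) *\<^sub>R q \<in> closed_segment p (q :: point)"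
  by (auto simp: in_segment intro!: exI[of _ "1/2"])

lemma barycenter_segment:
  assumes "p \<noteq> q"
  shows "barycenter (closed_segment p q) = (1/2) *\<^sub>R p + (1/2) *\<^sub>R q"
proof -
  have v: "{v. v extreme_point_of closed_segment p q} = {p, q}"
    by (auto simp: extreme_point_of_segment)
  have "card {p, q} = 2" "(\<Sum>v\<in>{p, q}. v) = p + q"
    using assms by simp_all
  then show ?thesis
    unfolding barycenter_def v by (simp add: scaleR_add_right)
qed

context lattice_disc
begin

abbreviation proj :: "(bit \<times> bit) \<times> point \<Rightarrow> ((bit \<times> bit) \<times> point) set"
  where "proj z \<equiv> glue_equiv E `` {z}"

definition half_edge :: "bit \<times> bit \<Rightarrow> point set \<Rightarrow> point \<Rightarrow> point \<Rightarrow> ((bit \<times> bit) \<times> point) set"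
  where "half_edge \<epsilon> A p q = dual_half_edge \<epsilon> (convex hull A) (closed_segment p q)"

text \<open>Every half edge is listed with \<open>p\<close> and \<open>q\<close> in both orders;
  \<open>half_edge\<close> gives the same set for them.\<close>

definition negative_half_edges ::
    "(point \<Rightarrow> int) \<Rightarrow> ((bit \<times> bit) \<times> point set \<times> point \<times> point) set"
  where "negative_half_edges \<delta> =
    {(\<epsilon>, A, p, q). A \<in> tris \<and> p \<in> A \<and> q \<in> A \<and> p \<noteq> q \<and> opposite \<delta> \<epsilon> p q}"

definition curve :: "(point \<Rightarrow> int) \<Rightarrow> ((bit \<times> bit) \<times> point) set set"
  where "curve \<delta> = proj ` (\<Union>(\<epsilon>, A, p, q)\<in>negative_half_edges \<delta>. half_edge \<epsilon> A p q)"

abbreviation curve_space :: "(point \<Rightarrow> int) \<Rightarrow> ((bit \<times> bit) \<times> point) set topology"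
  where "curve_space \<delta> \<equiv> subtopology (ambient_surface P E) (curve \<delta>)"

lemma midpoint_in_hull:
  assumes "A \<in> tris" "p \<in> A" "q \<in> A"
  shows "(1/2) *\<^sub>R p + (1/2) *\<^sub>R q \<in> convex hull A"
  by (rule subsetD[OF edge_subset_hull[OF assms]]) (auto simp: in_segment intro!: exI[of _ "1/2"])

lemma half_edge_segment_subset:
  assumes "A \<in> tris" "p \<in> A" "q \<in> A" "p \<noteq> q"
  shows "closed_segment (barycenter (convex hull A)) (barycenter (closed_segment p q)) \<subseteq> convex hull A"
  unfolding barycenter_segment[OF assms(4)]
  using barycenter_tri_interior[OF assms(1)] interior_subset midpoint_in_hull[OF assms(1-3)]
  by (intro closed_segment_subset) auto

lemma topspace_four_copies: "topspace (four_copies P) = Sigma UNIV (\<lambda>\<epsilon>. refl_map \<epsilon> ` P)"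
  by (simp add: four_copies_def o_def)

lemma proj_cont: "continuous_map (four_copies P) (ambient_surface P E) proj"
  unfolding ambient_surface_def by (rule quotient_imp_continuous_map[OF quotient_map_quotient_topology])

lemma copy_cont: "continuous_map (top_of_set P) (four_copies P) (\<lambda>x. (\<epsilon>, refl_map \<epsilon> x))"
proof -
  have "continuous_map (top_of_set P) (top_of_set (refl_map \<epsilon> ` P)) (refl_map \<epsilon>)"
    by (simp add: continuous_map_subtopology_eu refl_map_cont)
  moreover have "continuous_map (top_of_set (refl_map \<epsilon> ` P)) (four_copies P) (\<lambda>x. (\<epsilon>, x))"
    unfolding four_copies_def by (rule continuous_map_component_injection) simp
  ultimately have "continuous_map (top_of_set P) (four_copies P) ((\<lambda>x. (\<epsilon>, x)) \<circ> refl_map \<epsilon>)"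
    by (rule continuous_map_compose)
  then show ?thesis
    by (simp add: o_def)
qed

lemma half_edge_subset_topspace:
  assumes "(\<epsilon>, A, p, q) \<in> negative_half_edges \<delta>"
  shows "half_edge \<epsilon> A p q \<subseteq> topspace (four_copies P)"
  using half_edge_segment_subset[of A p q] hull_subset_P[of A] assms
  unfolding half_edge_def dual_half_edge_def topspace_four_copies negative_half_edges_def by blast

lemma curve_subset: "curve \<delta> \<subseteq> topspace (ambient_surface P E)"
proof -
  have "proj ` topspace (four_copies P) \<subseteq> topspace (ambient_surface P E)"
    using proj_cont by (simp add: continuous_map_image_subset_topspace)
  then show ?thesis
    unfolding curve_def using half_edge_subset_topspace by blast
qed

lemma half_edge_connected:
  assumes n: "(\<epsilon>, A, p, q) \<in> negative_half_edges \<delta>"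
  shows "connectedin (curve_space \<delta>) (proj ` half_edge \<epsilon> A p q)"
proof -
  let ?s = "closed_segment (barycenter (convex hull A)) (barycenter (closed_segment p q))"
  have "?s \<subseteq> P"
    using n half_edge_segment_subset[of A p q] hull_subset_P[of A]
    unfolding negative_half_edges_def by blast
  then have "connectedin (top_of_set P) ?s"
    by (simp add: connectedin_subtopology)
  then have "connectedin (four_copies P) ((\<lambda>x. (\<epsilon>, refl_map \<epsilon> x)) ` ?s)"
    by (rule connectedin_continuous_map_image[OF copy_cont])
  moreover have "(\<lambda>x. (\<epsilon>, refl_map \<epsilon> x)) ` ?s = half_edge \<epsilon> A p q"
    unfolding half_edge_def dual_half_edge_def by auto
  ultimately have "connectedin (ambient_surface P E) (proj ` half_edge \<epsilon> A p q)"
    using connectedin_continuous_map_image[OF proj_cont] by metis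
  moreover have "proj ` half_edge \<epsilon> A p q \<subseteq> curve \<delta>"
    unfolding curve_def using n by blast
  ultimately show ?thesis
    by (simp add: connectedin_subtopology)
qed

text \<open>
  All negative half edges of the copy \<open>\<epsilon>\<close> of a triangle meet in its barycenter, hence lie in one
  component, \<open>comp_at \<delta> \<epsilon> A\<close>. This is junk if that copy has no negative edge.
\<close>

definition comp_at :: "(point \<Rightarrow> int) \<Rightarrow> bit \<times> bit \<Rightarrow> point set \<Rightarrow> ((bit \<times> bit) \<times> point) set set"
  where "comp_at \<delta> \<epsilon> A =
    connected_component_of_set (curve_space \<delta>) (proj (\<epsilon>, refl_map \<epsilon> (barycenter (convex hull A))))"

lemma comp_half_edge:
  assumes n: "(\<epsilon>, A, p, q) \<in> negative_half_edges \<delta>" and z: "z \<in> half_edge \<epsilon> A p q"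
  shows "connected_component_of_set (curve_space \<delta>) (proj z) = comp_at \<delta> \<epsilon> A"
proof -
  have "(\<epsilon>, refl_map \<epsilon> (barycenter (convex hull A))) \<in> half_edge \<epsilon> A p q"
    unfolding half_edge_def dual_half_edge_def by auto
  then have "connected_component_of (curve_space \<delta>) (proj z)
      (proj (\<epsilon>, refl_map \<epsilon> (barycenter (convex hull A))))"
    unfolding connected_component_of_def using half_edge_connected[OF n] z by blast
  then show ?thesis
    unfolding comp_at_def connected_component_of_eq[symmetric]
    by (metis connected_component_of_equiv)
qed

lemma midpoint_half_edge:
  assumes "p \<noteq> q"
  shows "(\<epsilon>, refl_map \<epsilon> ((1/2) *\<^sub>R p + (1/2) *\<^sub>R q)) \<in> half_edge \<epsilon> A p q"
  unfolding half_edge_def dual_half_edge_def barycenter_segment[OF assms] by auto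

text \<open>The two half edges meet in the midpoint of the common edge.\<close>

lemma comp_adjacent:
  assumes "(\<epsilon>, A, p, q) \<in> negative_half_edges \<delta>" "(\<epsilon>, B, p, q) \<in> negative_half_edges \<delta>"
  shows "comp_at \<delta> \<epsilon> A = comp_at \<delta> \<epsilon> B"
proof -
  have "p \<noteq> q"
    using assms(1) by (simp add: negative_half_edges_def)
  then show ?thesis
    using comp_half_edge[OF assms(1) midpoint_half_edge] comp_half_edge[OF assms(2) midpoint_half_edge]
    by simp
qed

lemma midpoint_not_lattice:
  assumes "A \<in> tris" "p \<in> A" "q \<in> A" "p \<noteq> q"
  shows "(1/2) *\<^sub>R p + (1/2) *\<^sub>R q \<notin> lattice"
proof
  assume m: "(1/2) *\<^sub>R p + (1/2) *\<^sub>R q \<in> lattice"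
  have "(1/2) *\<^sub>R p + (1/2) *\<^sub>R q = p + (1/2) *\<^sub>R (q - p)"
    by (simp add: algebra_simps)
      (metis add.commute field_sum_of_halves scaleR_add_left scaleR_one)
  then have "(1/2::real) \<in> \<int>"
    using m primitive_segment_line[OF prim[OF assms], of "1/2"] by simp
  then obtain z where "(1/2::real) = of_int z"
    by (rule Ints_cases)
  then have "real_of_int (2 * z) = of_int 1"
    by simp
  then have "2 * z = 1"
    by (simp only: of_int_eq_iff)
  then show False
    by presburger
qed

text \<open>The midpoint lies on a polygon edge of parity \<open>parity p + parity q\<close>. So it
  is glued to the midpoint in exactly the other copy where the edge is negative.\<close>

lemma comp_frontier:
  assumes n: "(\<epsilon>, A, p, q) \<in> negative_half_edges \<delta>"
    and fr: "closed_segment p q \<subseteq> frontier P"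
  shows "comp_at \<delta> \<epsilon> A = comp_at \<delta> (prod.swap (parity p + parity q) + \<epsilon>) A"
proof -
  let ?m = "(1/2) *\<^sub>R p + (1/2) *\<^sub>R q" and ?w = "prod.swap (parity p + parity q)"
  have A: "A \<in> tris" "p \<in> A" "q \<in> A" "p \<noteq> q" and opp: "opposite \<delta> \<epsilon> p q"
    using n by (simp_all add: negative_half_edges_def)
  have n': "(?w + \<epsilon>, A, p, q) \<in> negative_half_edges \<delta>"
    using A opposite_swap[OF opp] by (simp add: negative_half_edges_def)
  have "?m \<in> frontier P"
    using fr midpoint_in_segment by blast
  then obtain s where s: "s \<in> E" "?m \<in> s"
    using polygon_frontier_edges[OF poly] by blast
  have par: "segment_parity s = parity p + parity q"
    by (rule edge_in_polygon_edge(2)[OF A midpoint_in_segment midpoint_not_lattice[OF A] s])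
  have "glue E (\<epsilon>, refl_map \<epsilon> ?m) (?w + \<epsilon>, refl_map (?w + \<epsilon>) ?m)"
    unfolding glue_def
    using s by (intro bexI[of _ s]) (simp_all add: par refl_map_add)
  then have "equivclp (glue E) (\<epsilon>, refl_map \<epsilon> ?m) (?w + \<epsilon>, refl_map (?w + \<epsilon>) ?m)"
    by (rule r_into_equivclp)
  then have "proj (\<epsilon>, refl_map \<epsilon> ?m) = proj (?w + \<epsilon>, refl_map (?w + \<epsilon>) ?m)"
    unfolding glue_equiv_def by (auto intro: equivclp_sym equivclp_trans)
  then show ?thesis
    using comp_half_edge[OF n midpoint_half_edge[OF A(4)]] comp_half_edge[OF n' midpoint_half_edge[OF A(4)]]
    by simp
qed

definition components :: "(point \<Rightarrow> int) \<Rightarrow> ((bit \<times> bit) \<times> point) set set set"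
  where "components \<delta> = connected_components_of (curve_space \<delta>)"

lemma components_eq: "components \<delta> = (\<lambda>(\<epsilon>, A, p, q). comp_at \<delta> \<epsilon> A) ` negative_half_edges \<delta>"
proof -
  have "topspace (curve_space \<delta>) = curve \<delta>"
    using curve_subset by (simp add: inf_absorb2)
  then have "components \<delta> = (\<lambda>z. connected_component_of_set (curve_space \<delta>) z) ` curve \<delta>"
    unfolding components_def connected_components_of_def by simp
  also have "\<dots> = (\<lambda>(\<epsilon>, A, p, q). comp_at \<delta> \<epsilon> A) ` negative_half_edges \<delta>"
  proof (intro equalityI subsetI)
    fix c assume "c \<in> (\<lambda>z. connected_component_of_set (curve_space \<delta>) z) ` curve \<delta>"
    then obtain \<epsilon> A p q z where n: "(\<epsilon>, A, p, q) \<in> negative_half_edges \<delta>" "z \<in> half_edge \<epsilon> A p q"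
      "c = connected_component_of_set (curve_space \<delta>) (proj z)"
      unfolding curve_def by blast
    then have "c = comp_at \<delta> \<epsilon> A"
      using comp_half_edge[OF n(1,2)] by simp
    then show "c \<in> (\<lambda>(\<epsilon>, A, p, q). comp_at \<delta> \<epsilon> A) ` negative_half_edges \<delta>"
      using n(1) by (intro image_eqI[of _ _ "(\<epsilon>, A, p, q)"]) simp_all
  next
    fix c assume "c \<in> (\<lambda>(\<epsilon>, A, p, q). comp_at \<delta> \<epsilon> A) ` negative_half_edges \<delta>"
    then obtain \<epsilon> A p q where n: "(\<epsilon>, A, p, q) \<in> negative_half_edges \<delta>" "c = comp_at \<delta> \<epsilon> A"
      by auto
    then have "p \<noteq> q"
      by (simp add: negative_half_edges_def)
    then have m: "(\<epsilon>, refl_map \<epsilon> ((1/2) *\<^sub>R p + (1/2) *\<^sub>R q)) \<in> half_edge \<epsilon> A p q"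
      by (rule midpoint_half_edge)
    then have "proj (\<epsilon>, refl_map \<epsilon> ((1/2) *\<^sub>R p + (1/2) *\<^sub>R q)) \<in> curve \<delta>"
      unfolding curve_def using n(1) by blast
    moreover have "c = connected_component_of_set (curve_space \<delta>) (proj (\<epsilon>, refl_map \<epsilon> ((1/2) *\<^sub>R p + (1/2) *\<^sub>R q)))"
      using comp_half_edge[OF n(1) m] n(2) by simp
    ultimately show "c \<in> (\<lambda>z. connected_component_of_set (curve_space \<delta>) z) ` curve \<delta>"
      by blast
  qed
  finally show ?thesis .
qed

lemma componentsE:
  assumes "c \<in> components \<delta>"
  obtains \<epsilon> A p q where "(\<epsilon>, A, p, q) \<in> negative_half_edges \<delta>" "c = comp_at \<delta> \<epsilon> A"
  using assms unfolding components_eq by auto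

lemma finite_negative_half_edges: "finite (negative_half_edges \<delta>)"
proof -
  have "negative_half_edges \<delta> \<subseteq> UNIV \<times> tris \<times> \<Union>tris \<times> \<Union>tris"
    by (auto simp: negative_half_edges_def)
  moreover have "finite (\<Union>tris)"
    using fin tri_finite by blast
  ultimately show ?thesis
    using fin finite_bit_pair by (meson finite_SigmaI finite_subset)
qed

lemma finite_components: "finite (components \<delta>)"
  unfolding components_eq using finite_negative_half_edges by blast

end

subsection \<open>The upper bound\<close>

context lattice_disc
begin

lemma card_components_le:
  assumes \<delta>: "\<And>p. p \<in> P \<inter> lattice \<Longrightarrow> \<delta> p = 1 \<or> \<delta> p = - 1"
  shows "card (components \<delta>) \<le> card (interior P \<inter> lattice) + 1"
proof (cases "components \<delta> = {}")
  case True
  then show ?thesis by simp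
next
  case False
  then obtain c0 where c0: "c0 \<in> components \<delta>"
    by blast
  have \<delta>v: "\<delta> p = 1 \<or> \<delta> p = - 1" if "A \<in> tris" "p \<in> A" for A p
    using \<delta> vertex_set that by blast
  \<comment> \<open>The cocycle of \<open>S\<close> is written multiplicatively:
    \<open>Z S p q\<close> is -1 iff exactly one of the two negative copies of the edge belongs to a
    component in \<open>S\<close>. A copy where the edge is positive contributes 1, which also
    discards the junk values of \<open>comp_at\<close>.\<close>
  define \<psi> :: "_ \<Rightarrow> _ \<Rightarrow> _ \<Rightarrow> real"
    where "\<psi> S \<epsilon> A = (if comp_at \<delta> \<epsilon> A \<in> S then - 1 else 1)" for S \<epsilon> A
  define trm where "trm S A p q \<epsilon> = (if opposite \<delta> \<epsilon> p q then \<psi> S \<epsilon> A else 1)" for S A p q \<epsilon>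
  define Z where "Z S p q = (if p = q then 1
      else \<Prod>\<epsilon>\<in>UNIV. trm S (SOME A. A \<in> tris \<and> p \<in> A \<and> q \<in> A) p q \<epsilon>)" for S p q
  have \<psi>1: "\<psi> S \<epsilon> A = 1 \<or> \<psi> S \<epsilon> A = - 1" for S \<epsilon> A
    by (simp add: \<psi>_def)
  have Z_eq: "Z S p q = (\<Prod>\<epsilon>\<in>UNIV. trm S A p q \<epsilon>)" if A: "A \<in> tris" "p \<in> A" "q \<in> A" "p \<noteq> q" for S A p q
  proof -
    define B where "B = (SOME A. A \<in> tris \<and> p \<in> A \<and> q \<in> A)"
    have B: "B \<in> tris \<and> p \<in> B \<and> q \<in> B"
      unfolding B_def by (rule someI[of _ A]) (use A in blast)
    \<comment> \<open>Independence of the chosen triangle: in a fixed copy the curve runs through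
      the edge from one triangle to the other.\<close>
    have "trm S B p q \<epsilon> = trm S A p q \<epsilon>" for \<epsilon>
    proof (cases "opposite \<delta> \<epsilon> p q")
      case True
      then have "comp_at \<delta> \<epsilon> B = comp_at \<delta> \<epsilon> A"
        using A B by (intro comp_adjacent[of \<epsilon> B p q \<delta> A]) (simp_all add: negative_half_edges_def)
      then show ?thesis
        by (simp add: trm_def \<psi>_def)
    qed (simp add: trm_def)
    then show ?thesis
      using A(4) by (simp add: Z_def B_def[symmetric])
  qed
  have trm1: "trm S A p q \<epsilon> = 1 \<or> trm S A p q \<epsilon> = - 1" for S A p q \<epsilon>
    using \<psi>1[of S \<epsilon> A] by (simp add: trm_def)
  have prod1: "prod h K = 1 \<or> prod h K = - 1" if "\<And>\<epsilon>. h \<epsilon> = 1 \<or> h \<epsilon> = - 1"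
    for h :: "bit \<times> bit \<Rightarrow> real" and K
    using finite_bit_pair[of K]
  proof induction
    case (insert x F)
    then show ?case
      using that[of x] by auto
  qed simp
  have Z1: "Z S p q = 1 \<or> Z S p q = - 1" for S p q
    unfolding Z_def using prod1 trm1 by auto
  have cocycle: "Z S p q * Z S q r = Z S p r" if A: "A \<in> tris" "p \<in> A" "q \<in> A" "r \<in> A" for S A p q r
  proof -
    have sym: "Z S p q = Z S q p" if "p \<in> A" "q \<in> A" for p q
    proof (cases "p = q")
      case False
      then show ?thesis
        using Z_eq[OF A(1) that False, of S] Z_eq[OF A(1) that(2,1), of S]
        by (simp add: trm_def opposite_sym)
    qed simp
    have sq: "Z S p q * Z S p q = 1" for p q
      using Z1[of S p q] by auto
    consider "p = q" | "q = r" | "p = r" | "p \<noteq> q" "q \<noteq> r" "p \<noteq> r"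
      by blast
    then show ?thesis
    proof cases
      case 1
      then show ?thesis by (simp add: Z_def)
    next
      case 2
      then show ?thesis by (simp add: Z_def)
    next
      case 3
      then show ?thesis
        using sym[OF A(2,3)] sq[of p q] by (simp add: Z_def)
    next
      case 4
      have "Z S p q * Z S q r * Z S p r = (\<Prod>\<epsilon>\<in>UNIV. trm S A p q \<epsilon> * trm S A q r \<epsilon> * trm S A p r \<epsilon>)"
        unfolding Z_eq[OF A(1,2,3) 4(1)] Z_eq[OF A(1,3,4) 4(2)] Z_eq[OF A(1,2,4) 4(3)]
        by (simp only: prod.distrib)
      \<comment> \<open>In each copy a triangle has no or two negative edges. In the latter case
        both carry the component \<open>comp_at \<delta> \<epsilon> A\<close>, so its sign occurs
        squared.\<close>
      also have "\<dots> = 1"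
      proof (rule prod.neutral, rule ballI)
        fix \<epsilon>
        have "opposite \<delta> \<epsilon> p r \<longleftrightarrow> opposite \<delta> \<epsilon> p q \<noteq> opposite \<delta> \<epsilon> q r"
          using copy_sign_pm[of \<delta> p \<epsilon>] copy_sign_pm[of \<delta> q \<epsilon>] copy_sign_pm[of \<delta> r \<epsilon>]
            \<delta>v[OF A(1,2)] \<delta>v[OF A(1,3)] \<delta>v[OF A(1,4)]
          by (auto simp: opposite_def)
        then show "trm S A p q \<epsilon> * trm S A q r \<epsilon> * trm S A p r \<epsilon> = 1"
          using \<psi>1[of S \<epsilon> A] by (auto simp: trm_def)
      qed
      finally have "Z S p q * Z S q r * Z S p r = 1" .
      then show ?thesis
        using Z1[of S p q] Z1[of S q r] Z1[of S p r] by auto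
    qed
  qed
  have ex_f: "\<exists>f. (\<forall>p. f p = 1 \<or> f p = - 1) \<and> (\<forall>A p q. A \<in> tris \<longrightarrow> p \<in> A \<longrightarrow> q \<in> A \<longrightarrow> Z S p q = f p * f q)" for S
  proof (rule cocycle_potential[of "Z S"])
    show "Z S p q = 1 \<or> Z S p q = - 1" for p q by (rule Z1)
    show "Z S p q * Z S q r = Z S p r" if "A \<in> tris" "p \<in> A" "q \<in> A" "r \<in> A" for A p q r
      by (rule cocycle[OF that])
    fix f :: "point \<Rightarrow> real"
    assume "\<And>p. f p = 1 \<or> f p = - 1" "\<And>A p q. A \<in> tris \<Longrightarrow> p \<in> A \<Longrightarrow> q \<in> A \<Longrightarrow> Z S p q = f p * f q"
    then show ?thesis by (intro exI[of _ f] conjI allI impI)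
  qed
  define f where "f S = (SOME f. (\<forall>p. f p = 1 \<or> f p = - 1) \<and>
      (\<forall>A p q. A \<in> tris \<longrightarrow> p \<in> A \<longrightarrow> q \<in> A \<longrightarrow> Z S p q = f p * f q))" for S
  have f1: "f S p = 1 \<or> f S p = - 1"
    and Zf: "A \<in> tris \<Longrightarrow> p \<in> A \<Longrightarrow> q \<in> A \<Longrightarrow> Z S p q = f S p * f S q" for S A p q
    using someI_ex[OF ex_f[of S]] unfolding f_def[symmetric] by blast+
  have two: "\<exists>\<epsilon>0 \<epsilon>1. \<epsilon>0 \<noteq> \<epsilon>1 \<and> {\<epsilon>. opposite \<delta> \<epsilon> p q} = {\<epsilon>0, \<epsilon>1} \<and> \<epsilon>1 = prod.swap (parity p + parity q) + \<epsilon>0"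
    if A: "A \<in> tris" "p \<in> A" "q \<in> A" "p \<noteq> q" for A p q
  proof -
    obtain \<epsilon>0 where e: "\<And>\<epsilon>. opposite \<delta> \<epsilon> p q \<longleftrightarrow> \<epsilon> = \<epsilon>0 \<or> \<epsilon> = prod.swap (parity p + parity q) + \<epsilon>0"
      and ne: "prod.swap (parity p + parity q) + \<epsilon>0 \<noteq> \<epsilon>0"
      using opposite_copies[of \<delta> p q, OF \<delta>v[OF A(1,2)] \<delta>v[OF A(1,3)] primitive_segment_parity[OF prim[OF A]]]
      by blast
    show ?thesis
    proof (intro exI conjI)
      show "\<epsilon>0 \<noteq> prod.swap (parity p + parity q) + \<epsilon>0"
        using ne by metis
      show "{\<epsilon>. opposite \<delta> \<epsilon> p q} = {\<epsilon>0, prod.swap (parity p + parity q) + \<epsilon>0}"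
        unfolding e by (rule set_eqI) (simp only: mem_Collect_eq insert_iff empty_iff simp_thms)
    qed (rule refl)
  qed
  have Z_two: "Z S p q = \<psi> S \<epsilon>0 A * \<psi> S \<epsilon>1 A"
    if A: "A \<in> tris" "p \<in> A" "q \<in> A" "p \<noteq> q" and e: "\<epsilon>0 \<noteq> \<epsilon>1" "{\<epsilon>. opposite \<delta> \<epsilon> p q} = {\<epsilon>0, \<epsilon>1}" for S A p q \<epsilon>0 \<epsilon>1
  proof -
    have "Z S p q = (\<Prod>\<epsilon>\<in>{\<epsilon>. opposite \<delta> \<epsilon> p q}. \<psi> S \<epsilon> A)"
      unfolding Z_eq[OF A] trm_def using finite_bit_pair
      by (simp add: prod.If_cases)
    then show ?thesis
      unfolding e(2) using e(1) by simp
  qed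
  have f_edge: "f S p = f S q" if pq: "(p, q) \<in> frontier_edges" for S p q
  proof -
    obtain A where A: "A \<in> tris" "p \<in> A" "q \<in> A" "p \<noteq> q" and fr: "closed_segment p q \<subseteq> frontier P"
      using pq unfolding frontier_edges_def by blast
    obtain \<epsilon>0 \<epsilon>1 where e: "\<epsilon>0 \<noteq> \<epsilon>1" "{\<epsilon>. opposite \<delta> \<epsilon> p q} = {\<epsilon>0, \<epsilon>1}" "\<epsilon>1 = prod.swap (parity p + parity q) + \<epsilon>0"
      using two[OF A] by blast
    have "(\<epsilon>0, A, p, q) \<in> negative_half_edges \<delta>"
      using A e(2) by (auto simp: negative_half_edges_def)
    then have "comp_at \<delta> \<epsilon>0 A = comp_at \<delta> \<epsilon>1 A"
      unfolding e(3) using fr by (rule comp_frontier)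
    \<comment> \<open>The two negative copies are glued into one component, whose sign is
      squared.\<close>
    then have "Z S p q = 1"
      using Z_two[OF A e(1,2)] by (simp add: \<psi>_def)
    then show ?thesis
      using Zf[OF A(1-3), of S] f1[of S p] f1[of S q] by auto
  qed
  obtain v0 where v0: "v0 \<in> frontier P" "v0 \<in> lattice"
    by (rule frontier_vertex)
  \<comment> \<open>A potential is determined only up to a global sign, removed here by comparison
    with a frontier vertex. On the whole frontier the potential has this same value, so interior
    points suffice.\<close>
  define F where "F S = {v \<in> interior P \<inter> lattice. f S v \<noteq> f S v0}" for S
  have fin_int: "finite (interior P \<inter> lattice)"
    by (intro finite_lattice bounded_interior compact_imp_bounded polygon_compact[OF poly])
  have same: "S = S' \<or> S = components \<delta> - S'"
    if S: "S \<subseteq> components \<delta>" "S' \<subseteq> components \<delta>" and FS: "F S = F S'" for S S'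
  proof -
    have fr: "f S v * f S v0 = f S' v * f S' v0" if v: "v \<in> P" "v \<in> lattice" for v
    proof (cases "v \<in> interior P")
      case True
      then have "f S v \<noteq> f S v0 \<longleftrightarrow> f S' v \<noteq> f S' v0"
        using FS v unfolding F_def by blast
      then show ?thesis
        using f1[of S v] f1[of S' v] f1[of S v0] f1[of S' v0] by auto
    next
      case False
      then have "v \<in> frontier P"
        using v(1) closure_subset unfolding frontier_def by blast
      then have "f T v = f T v0" for T
        using frontier_const[of "f T" v v0] f_edge v v0 by blast
      then show ?thesis
        using f1[of S v0] f1[of S' v0] by auto
    qed
    have ZZ: "Z S p q = Z S' p q" if A: "A \<in> tris" "p \<in> A" "q \<in> A" for A p q
    proof -
      have v: "p \<in> P" "p \<in> lattice" "q \<in> P" "q \<in> lattice"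
        using A vertex_set by blast+
      have "f T p * f T q = (f T p * f T v0) * (f T q * f T v0)" for T
        using f1[of T v0] by auto
      then show ?thesis
        unfolding Zf[OF A] using fr[OF v(1,2)] fr[OF v(3,4)] by metis
    qed
    \<comment> \<open>The value is 1 where \<open>S\<close> and \<open>S'\<close> agree on the
      component at this copy of the triangle. Equality of the two cocycles says that
      \<open>\<eta>\<close> has the same value on both negative copies of any edge.\<close>
    define \<eta> where "\<eta> \<epsilon> A = \<psi> S \<epsilon> A * \<psi> S' \<epsilon> A" for \<epsilon> A
    define act where "act \<epsilon> A p q \<longleftrightarrow> (\<epsilon>, A, p, q) \<in> negative_half_edges \<delta>" for \<epsilon> A p q
    have \<eta>1: "\<eta> \<epsilon> A = 1 \<or> \<eta> \<epsilon> A = - 1" for \<epsilon> A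
      using \<psi>1[of S \<epsilon> A] \<psi>1[of S' \<epsilon> A] by (auto simp: \<eta>_def)
    have edge: "\<eta> \<epsilon> A = \<eta> \<epsilon>' A" if a: "act \<epsilon> A p q" "act \<epsilon>' A p q" for \<epsilon> \<epsilon>' A p q
    proof -
      have A: "A \<in> tris" "p \<in> A" "q \<in> A" "p \<noteq> q" and o: "opposite \<delta> \<epsilon> p q" "opposite \<delta> \<epsilon>' p q"
        using a by (simp_all add: act_def negative_half_edges_def)
      obtain \<epsilon>0 \<epsilon>1 where e: "\<epsilon>0 \<noteq> \<epsilon>1" "{\<epsilon>. opposite \<delta> \<epsilon> p q} = {\<epsilon>0, \<epsilon>1}"
        using two[OF A] by blast
      have "\<psi> S \<epsilon>0 A * \<psi> S \<epsilon>1 A = \<psi> S' \<epsilon>0 A * \<psi> S' \<epsilon>1 A"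
        using ZZ[OF A(1-3)] unfolding Z_two[OF A e] .
      then have "\<eta> \<epsilon>0 A = \<eta> \<epsilon>1 A"
        unfolding \<eta>_def using \<psi>1[of S \<epsilon>0 A] \<psi>1[of S' \<epsilon>0 A] \<psi>1[of S \<epsilon>1 A] \<psi>1[of S' \<epsilon>1 A] by auto
      moreover have "\<epsilon> = \<epsilon>0 \<or> \<epsilon> = \<epsilon>1" "\<epsilon>' = \<epsilon>0 \<or> \<epsilon>' = \<epsilon>1"
        using o e(2) by blast+
      ultimately show ?thesis by auto
    qed
    have triangle: "\<eta> \<epsilon> A = \<eta> \<epsilon>' A" if a: "act \<epsilon> A p q" "act \<epsilon>' A p' q'" for \<epsilon> \<epsilon>' A p q p' q'
    proof -
      have A: "A \<in> tris" "p \<in> A" "q \<in> A" "p \<noteq> q" "p' \<in> A" "q' \<in> A" "p' \<noteq> q'"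
        and o: "opposite \<delta> \<epsilon> p q" "opposite \<delta> \<epsilon>' p' q'"
        using a by (simp_all add: act_def negative_half_edges_def)
      obtain r where Ar: "A = {p, q, r}" and n: "nondeg p q r"
        using triE[OF A(1-4)] .
      note dist = nondeg.distinct[OF n]
      have sg: "copy_sign \<delta> \<eta> x = 1 \<or> copy_sign \<delta> \<eta> x = - 1" if "x \<in> A" for x \<eta>
        using \<delta>v[OF A(1) that] by (rule copy_sign_pm)
      have opp: "opposite \<delta> \<eta> x y \<longleftrightarrow> copy_sign \<delta> \<eta> x \<noteq> copy_sign \<delta> \<eta> y" if "x \<in> A" "y \<in> A" for \<eta> x y
        using \<delta>v[OF A(1) that(1)] \<delta>v[OF A(1) that(2)] by (rule opposite_iff)
      \<comment> \<open>In each of the two copies two of the three edges are negative, so some edge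
        is negative in both.\<close>
      have "\<exists>x\<in>A. \<exists>y\<in>A. x \<noteq> y \<and> opposite \<delta> \<epsilon> x y \<and> opposite \<delta> \<epsilon>' x y"
      proof (cases "opposite \<delta> \<epsilon>' p q")
        case True
        then show ?thesis using A o by blast
      next
        case False
        have pqr: "p \<in> A" "q \<in> A" "r \<in> A" unfolding Ar by blast+
        have eq: "copy_sign \<delta> \<epsilon>' p = copy_sign \<delta> \<epsilon>' q"
          using False opp pqr by blast
        have r': "copy_sign \<delta> \<epsilon>' p \<noteq> copy_sign \<delta> \<epsilon>' r"
        proof
          assume "copy_sign \<delta> \<epsilon>' p = copy_sign \<delta> \<epsilon>' r"
          then have "copy_sign \<delta> \<epsilon>' p' = copy_sign \<delta> \<epsilon>' q'"
            using A(5,6) eq unfolding Ar by auto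
          then show False
            using o(2) opp[OF A(5,6)] by blast
        qed
        have "copy_sign \<delta> \<epsilon> p \<noteq> copy_sign \<delta> \<epsilon> q"
          using o(1) opp[OF A(2,3)] by blast
        then have "copy_sign \<delta> \<epsilon> p \<noteq> copy_sign \<delta> \<epsilon> r \<or> copy_sign \<delta> \<epsilon> q \<noteq> copy_sign \<delta> \<epsilon> r"
          by metis
        then show ?thesis
          using eq r' opp pqr dist by metis
      qed
      then obtain x y where "act \<epsilon> A x y" "act \<epsilon>' A x y"
        unfolding act_def negative_half_edges_def using A(1) by blast
      then show ?thesis by (rule edge)
    qed
    \<comment> \<open>The triangles through which \<open>S\<close> and \<open>S'\<close> agree.
      Agreement passes across an edge, because some copy of the edge is negative. So it holds
      everywhere or nowhere, and in the latter case \<open>S'\<close> is the complement of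
      \<open>S\<close>.\<close>
    define \<D> where "\<D> = {A \<in> tris. \<forall>\<epsilon> p q. act \<epsilon> A p q \<longrightarrow> \<eta> \<epsilon> A = 1}"
    have "\<D> = {} \<or> \<D> = tris"
    proof (rule dual_connected)
      show "\<D> \<subseteq> tris" unfolding \<D>_def by blast
      fix A B p q assume h: "A \<in> \<D>" "B \<in> tris" "p \<noteq> q" "{p, q} \<subseteq> A \<inter> B"
      have A: "A \<in> tris" "p \<in> A" "q \<in> A" and B: "p \<in> B" "q \<in> B"
        using h unfolding \<D>_def by blast+
      obtain \<epsilon> where o: "opposite \<delta> \<epsilon> p q"
        using two[OF A h(3)] by blast
      have a: "act \<epsilon> A p q" "act \<epsilon> B p q"
        unfolding act_def negative_half_edges_def using A B h(2,3) o by simp_all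
      have "\<eta> \<epsilon> A = \<eta> \<epsilon> B"
        using comp_adjacent[OF a[unfolded act_def]] by (simp add: \<eta>_def \<psi>_def)
      moreover have "\<eta> \<epsilon> A = 1"
        using h(1) a(1) unfolding \<D>_def by blast
      ultimately have "\<eta> \<epsilon> B = 1" by simp
      then show "B \<in> \<D>"
        unfolding \<D>_def using h(2) triangle[OF a(2)] by auto
    qed
    then show ?thesis
    proof
      assume D: "\<D> = tris"
      have "c \<in> S \<longleftrightarrow> c \<in> S'" if c: "c \<in> components \<delta>" for c
      proof -
        obtain \<epsilon> A p q where a: "act \<epsilon> A p q" "c = comp_at \<delta> \<epsilon> A"
          unfolding act_def by (rule componentsE[OF c])
        then have "A \<in> \<D>"
          unfolding D act_def negative_half_edges_def by simp
        then have "\<eta> \<epsilon> A = 1"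
          unfolding \<D>_def using a(1) by blast
        then show ?thesis
          unfolding a(2) \<eta>_def \<psi>_def by (auto split: if_splits)
      qed
      then show ?thesis using S by blast
    next
      assume D: "\<D> = {}"
      have "c \<in> S \<longleftrightarrow> c \<notin> S'" if c: "c \<in> components \<delta>" for c
      proof -
        obtain \<epsilon> A p q where a: "act \<epsilon> A p q" "c = comp_at \<delta> \<epsilon> A"
          unfolding act_def by (rule componentsE[OF c])
        then have "A \<in> tris" "A \<notin> \<D>"
          unfolding D act_def negative_half_edges_def by simp_all
        then obtain \<epsilon>' p' q' where "act \<epsilon>' A p' q'" "\<eta> \<epsilon>' A \<noteq> 1"
          unfolding \<D>_def by blast
        then have "\<eta> \<epsilon> A \<noteq> 1"
          using triangle[OF a(1)] by metis
        then show ?thesis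
          unfolding a(2) \<eta>_def \<psi>_def by (auto split: if_splits)
      qed
      then show ?thesis using S by blast
    qed
  qed
  \<comment> \<open>Leaving out one component selects a single member of each complementary pair.
    This accounts for the one extra component in the bound.\<close>
  have "inj_on F (Pow (components \<delta> - {c0}))"
  proof (rule inj_onI)
    fix S S' assume h: "S \<in> Pow (components \<delta> - {c0})" "S' \<in> Pow (components \<delta> - {c0})" "F S = F S'"
    then have "S = S' \<or> S = components \<delta> - S'"
      by (intro same) auto
    then show "S = S'"
      using h(1,2) c0 by blast
  qed
  moreover have "F ` Pow (components \<delta> - {c0}) \<subseteq> Pow (interior P \<inter> lattice)"
    unfolding F_def by blast
  ultimately have "card (Pow (components \<delta> - {c0})) \<le> card (Pow (interior P \<inter> lattice))"
    by (rule card_inj_on_le) (rule iffD2[OF finite_Pow_iff fin_int])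
  then have "(2::nat) ^ card (components \<delta> - {c0}) \<le> 2 ^ card (interior P \<inter> lattice)"
    by (simp only: card_Pow[OF fin_int] card_Pow[OF finite_Diff[OF finite_components]])
  then have "card (components \<delta> - {c0}) \<le> card (interior P \<inter> lattice)"
    by simp
  then show ?thesis
    using c0 finite_components by simp
qed

end

subsection \<open>Harnack sign distributions\<close>

text \<open>At parity \<open>(a, b)\<close> the exponent of the sign is
  \<open>(1 + a) * (1 + b)\<close> mod 2. Adding the linear form of a copy to this quadratic moves
  the exceptional class and changes at most the overall sign.\<close>

definition harnack :: "point \<Rightarrow> int"
  where "harnack p = (if parity p = (0, 0) then - 1 else 1)"

lemma harnack_pm: "harnack p = 1 \<or> harnack p = - 1"
  by (simp add: harnack_def)

text \<open>In every copy, exactly one parity class carries a sign different from the other three.\<close>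

lemma copy_sign_harnack:
  "copy_sign harnack \<epsilon> p =
    (if \<epsilon> = (0, 0) then 1 else - 1) * (if parity p = prod.swap \<epsilon> then - 1 else 1)"
proof -
  obtain a b where p: "parity p = (a, b)"
    by (metis surj_pair)
  obtain e f where \<epsilon>: "\<epsilon> = (e, f)"
    by (metis surj_pair)
  show ?thesis
    unfolding copy_sign_def harnack_def p \<epsilon>
    by (cases a; cases b; cases e; cases f) (simp_all add: m1pow_def)
qed

lemma opposite_harnack:
  "opposite harnack \<epsilon> p q \<longleftrightarrow> (parity p = prod.swap \<epsilon>) \<noteq> (parity q = prod.swap \<epsilon>)"
  unfolding opposite_def copy_sign_harnack by auto

lemma glue_sym:
  assumes "glue E z w"
  shows "glue E w z"
proof -
  obtain e y where e: "e \<in> E" "y \<in> e" "snd z = refl_map (fst z) y"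
    and w: "w = (prod.swap (segment_parity e) + fst z, refl_map (prod.swap (segment_parity e)) (snd z))"
    using assms unfolding glue_def by blast
  have bb: "b + b = 0" for b :: bit
    by (cases b) simp_all
  then have "\<eta> + (\<eta> + \<epsilon>) = \<epsilon>" for \<eta> \<epsilon> :: "bit \<times> bit"
    unfolding prod_eq_iff fst_add snd_add by (simp only: add.assoc[symmetric] bb add_0_left simp_thms)
  then have "z = (prod.swap (segment_parity e) + fst w, refl_map (prod.swap (segment_parity e)) (snd w))"
    unfolding w by (simp only: fst_conv snd_conv refl_map_involution prod.collapse)
  moreover have "snd w = refl_map (fst w) y"
    unfolding w by (simp only: fst_conv snd_conv e(3) refl_map_add)
  ultimately show ?thesis
    unfolding glue_def using e(1,2) by blast
qed

section \<open>The pieces of the Harnack curve\<close>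

context lattice_disc
begin

text \<open>A negative edge has exactly one end in the exceptional parity class
  \<open>prod.swap \<epsilon>\<close> of its copy; for such an edge this is that end.\<close>

definition isolated :: "bit \<times> bit \<Rightarrow> point \<Rightarrow> point \<Rightarrow> point"
  where "isolated \<epsilon> p q = (if parity p = prod.swap \<epsilon> then p else q)"

text \<open>\<open>None\<close> labels the piece of the curve that runs along the frontier.\<close>

definition label :: "bit \<times> bit \<Rightarrow> point \<Rightarrow> point \<Rightarrow> point option"
  where "label \<epsilon> p q = (if isolated \<epsilon> p q \<in> interior P then Some (isolated \<epsilon> p q) else None)"

definition piece :: "point option \<Rightarrow> ((bit \<times> bit) \<times> point) set"
  where "piece l = (\<Union>(\<epsilon>, A, p, q)\<in>{h \<in> negative_half_edges harnack. (case h of (\<epsilon>, A, p, q) \<Rightarrow> label \<epsilon> p q = l)}.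
    half_edge \<epsilon> A p q)"

lemma piece_iff:
  "z \<in> piece l \<longleftrightarrow> (\<exists>\<epsilon> A p q. (\<epsilon>, A, p, q) \<in> negative_half_edges harnack \<and> label \<epsilon> p q = l \<and> z \<in> half_edge \<epsilon> A p q)"
  unfolding piece_def by blast

lemma tri_parity_inj:
  assumes "A \<in> tris" "p \<in> A" "q \<in> A" "parity p = parity q"
  shows "p = q"
  using primitive_segment_parity[OF prim[OF assms(1-3)]] assms(4) by blast

lemma isolated_props:
  assumes "(\<epsilon>, A, p, q) \<in> negative_half_edges harnack"
  shows "isolated \<epsilon> p q \<in> {p, q}" "isolated \<epsilon> p q \<in> A" "parity (isolated \<epsilon> p q) = prod.swap \<epsilon>"
  using assms unfolding negative_half_edges_def opposite_harnack isolated_def by auto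

lemma half_edge_mem:
  "z \<in> half_edge \<epsilon> A p q \<longleftrightarrow>
    (\<exists>x \<in> closed_segment (barycenter (convex hull A)) (barycenter (closed_segment p q)). z = (\<epsilon>, refl_map \<epsilon> x))"
  unfolding half_edge_def dual_half_edge_def by auto

lemma half_edge_cases:
  assumes "A \<in> tris" "p \<in> A" "q \<in> A" "p \<noteq> q"
    and x: "x \<in> closed_segment (barycenter (convex hull A)) (barycenter (closed_segment p q))"
  shows "x = (1/2) *\<^sub>R p + (1/2) *\<^sub>R q \<or> x \<in> interior (convex hull A)"
  using half_open_interior[OF assms(1) midpoint_in_hull[OF assms(1-3)], of x] x
  unfolding barycenter_segment[OF assms(4)] by blast

text \<open>A common point forces the same copy. In one triangle at most one vertex has the
  exceptional parity, so the isolated end is the same; in two distinct triangles the point is the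
  midpoint of both edges, which then coincide.\<close>

lemma piece_disjoint:
  assumes "z \<in> piece l" "z \<in> piece l'"
  shows "l = l'"
proof -
  obtain \<epsilon> A p q where h: "(\<epsilon>, A, p, q) \<in> negative_half_edges harnack" "label \<epsilon> p q = l" "z \<in> half_edge \<epsilon> A p q"
    using assms(1) unfolding piece_iff by blast
  obtain \<epsilon>' B p' q' where h': "(\<epsilon>', B, p', q') \<in> negative_half_edges harnack" "label \<epsilon>' p' q' = l'" "z \<in> half_edge \<epsilon>' B p' q'"
    using assms(2) unfolding piece_iff by blast
  obtain x where x: "x \<in> closed_segment (barycenter (convex hull A)) (barycenter (closed_segment p q))" "z = (\<epsilon>, refl_map \<epsilon> x)"
    using h(3) unfolding half_edge_mem by blast
  obtain x' where x': "x' \<in> closed_segment (barycenter (convex hull B)) (barycenter (closed_segment p' q'))" "z = (\<epsilon>', refl_map \<epsilon>' x')"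
    using h'(3) unfolding half_edge_mem by blast
  have \<epsilon>: "\<epsilon>' = \<epsilon>" and xx: "x' = x"
    using x(2) x'(2) inj_refl_map[of \<epsilon>] by (auto dest: injD)
  have A: "A \<in> tris" "p \<in> A" "q \<in> A" "p \<noteq> q"
    using h(1) by (simp_all add: negative_half_edges_def)
  have B: "B \<in> tris" "p' \<in> B" "q' \<in> B" "p' \<noteq> q'"
    using h'(1) by (simp_all add: negative_half_edges_def)
  have xA: "x \<in> convex hull A" and xB: "x \<in> convex hull B"
    using half_edge_segment_subset[OF A] half_edge_segment_subset[OF B] x(1) x'(1) xx by blast+
  have "isolated \<epsilon> p q = isolated \<epsilon> p' q'"
  proof (cases "A = B")
    case True
    then show ?thesis
      using isolated_props[OF h(1)] isolated_props[OF h'(1)] tri_parity_inj[OF A(1)] unfolding \<epsilon> by metis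
  next
    case False
    have m: "x = (1/2) *\<^sub>R p + (1/2) *\<^sub>R q"
      using half_edge_cases[OF A x(1)] interior_meets_hull[OF A(1) B(1) _ xB] False by blast
    have m': "x = (1/2) *\<^sub>R p' + (1/2) *\<^sub>R q'"
      using half_edge_cases[OF B x'(1)] interior_meets_hull[OF B(1) A(1) _ xA] False xx by blast
    have "{p, q} \<subseteq> A" "{p', q'} \<subseteq> B"
      using A B by blast+
    moreover have "x \<in> convex hull {p, q}" "x \<in> convex hull {p', q'}"
      using m m' midpoint_in_segment unfolding segment_convex_hull by metis+
    ultimately have xc: "x \<in> convex hull ({p, q} \<inter> {p', q'})"
      using hull_inter[OF A(1) B(1)] by blast
    have "x \<notin> lattice"
      unfolding m by (rule midpoint_not_lattice[OF A])
    moreover have "A \<subseteq> lattice"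
      by (rule tri_lattice[OF A(1)])
    ultimately have nA: "x \<notin> A"
      by blast
    have "{p, q} \<inter> {p', q'} = {p, q}"
    proof (rule ccontr)
      assume "{p, q} \<inter> {p', q'} \<noteq> {p, q}"
      then have "{p, q} \<inter> {p', q'} \<subseteq> {p} \<or> {p, q} \<inter> {p', q'} \<subseteq> {q}"
        by blast
      then have "x \<in> convex hull {p} \<or> x \<in> convex hull {q}"
        using xc hull_mono by blast
      then show False
        using nA A by auto
    qed
    then have "p \<in> {p', q'}" "q \<in> {p', q'}"
      by blast+
    then have "{p, q} = {p', q'}"
      using A(4) by auto
    then have "isolated \<epsilon> p' q' \<in> {p, q}"
      using isolated_props(1)[OF h'(1)] unfolding \<epsilon> by simp
    then have "isolated \<epsilon> p' q' \<in> A"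
      using A by blast
    then show ?thesis
      using isolated_props(3)[OF h'(1)] isolated_props(2,3)[OF h(1)] tri_parity_inj[OF A(1)] unfolding \<epsilon> by metis
  qed
  then show ?thesis
    using h(2) h'(2) unfolding label_def \<epsilon> by metis
qed

text \<open>Only midpoints of frontier edges are glued. Both ends of such an edge lie on the
  frontier, so its label is \<open>None\<close> in every copy.\<close>

lemma piece_glue:
  assumes "z \<in> piece l" "glue E z w"
  shows "w \<in> piece l"
proof -
  obtain \<epsilon> A p q where h: "(\<epsilon>, A, p, q) \<in> negative_half_edges harnack" "label \<epsilon> p q = l" "z \<in> half_edge \<epsilon> A p q"
    using assms(1) unfolding piece_iff by blast
  obtain x where x: "x \<in> closed_segment (barycenter (convex hull A)) (barycenter (closed_segment p q))" "z = (\<epsilon>, refl_map \<epsilon> x)"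
    using h(3) unfolding half_edge_mem by blast
  have A: "A \<in> tris" "p \<in> A" "q \<in> A" "p \<noteq> q" and o: "opposite harnack \<epsilon> p q"
    using h(1) by (simp_all add: negative_half_edges_def)
  obtain s where s: "s \<in> E" "snd z \<in> refl_map (fst z) ` s"
    and w: "w = (prod.swap (segment_parity s) + fst z, refl_map (prod.swap (segment_parity s)) (snd z))"
    using assms(2) unfolding glue_def by blast
  have xs: "x \<in> s"
    using s(2) inj_refl_map[of \<epsilon>] unfolding x(2) by (auto dest: injD)
  then have "x \<in> frontier P"
    using s(1) polygon_frontier_edges[OF poly] by blast
  then have m: "x = (1/2) *\<^sub>R p + (1/2) *\<^sub>R q"
    using half_edge_cases[OF A x(1)] frontier_disjoint_interior[OF A(1)] by blast
  have "x \<in> closed_segment p q" "x \<notin> lattice"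
    unfolding m by (rule midpoint_in_segment, rule midpoint_not_lattice[OF A])
  then have sub: "closed_segment p q \<subseteq> s" and par: "segment_parity s = parity p + parity q"
    using edge_in_polygon_edge[OF A _ _ s(1) xs] by blast+
  have "p \<in> s" "q \<in> s"
    using sub by auto
  then have "p \<in> frontier P" "q \<in> frontier P"
    using s(1) polygon_frontier_edges[OF poly] by blast+
  then have none: "label \<eta> p q = None" for \<eta>
    unfolding label_def isolated_def by (auto simp: frontier_def)
  let ?\<eta> = "prod.swap (parity p + parity q) + \<epsilon>"
  have "(?\<eta>, A, p, q) \<in> negative_half_edges harnack"
    using A opposite_swap[OF o] by (simp add: negative_half_edges_def)
  moreover have "w \<in> half_edge ?\<eta> A p q"
    unfolding w par x(2) half_edge_mem fst_conv snd_conv using x(1)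
    by (intro bexI[of _ x]) (simp_all add: refl_map_add)
  ultimately show ?thesis
    unfolding piece_iff using none h(2) by metis
qed

lemma piece_saturated:
  assumes "z \<in> piece l" "proj z = proj w"
  shows "w \<in> piece l"
proof -
  have "(w, w) \<in> glue_equiv E"
    unfolding glue_equiv_def by simp
  then have "(z, w) \<in> glue_equiv E"
    using assms(2) by blast
  then have "equivclp (glue E) z w"
    unfolding glue_equiv_def by simp
  then show ?thesis
  proof (induction rule: equivclp_induct)
    case base
    then show ?case by (rule assms(1))
  next
    case (step y z)
    then show ?case
      using piece_glue glue_sym by blast
  qed
qed

lemma piece_topspace: "piece l \<subseteq> topspace (four_copies P)"
  unfolding piece_def using half_edge_subset_topspace by blast

lemma half_edge_closed:
  assumes "(\<epsilon>, A, p, q) \<in> negative_half_edges \<delta>"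
  shows "closedin (four_copies P) (half_edge \<epsilon> A p q)"
proof -
  let ?s = "closed_segment (barycenter (convex hull A)) (barycenter (closed_segment p q))"
  have sub: "half_edge \<epsilon> A p q \<subseteq> Sigma UNIV (\<lambda>\<epsilon>. refl_map \<epsilon> ` P)"
    using half_edge_subset_topspace[OF assms] by (simp add: topspace_four_copies)
  have "closedin (top_of_set (refl_map \<eta> ` P)) {x. (\<eta>, x) \<in> half_edge \<epsilon> A p q}" for \<eta>
  proof (cases "\<eta> = \<epsilon>")
    case True
    have eq: "{x. (\<eta>, x) \<in> half_edge \<epsilon> A p q} = refl_map \<epsilon> ` ?s"
      unfolding half_edge_mem True by auto
    have "compact (refl_map \<epsilon> ` ?s)"
      by (intro compact_continuous_image refl_map_cont compact_segment)
    moreover have "refl_map \<epsilon> ` ?s \<subseteq> refl_map \<eta> ` P"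
      using sub unfolding eq[symmetric] by auto
    ultimately show ?thesis
      unfolding eq by (intro closed_subset compact_imp_closed)
  next
    case False
    then have "{x. (\<eta>, x) \<in> half_edge \<epsilon> A p q} = {}"
      unfolding half_edge_mem by auto
    then show ?thesis by (simp only: closedin_empty)
  qed
  then show ?thesis
    using sub unfolding four_copies_def closedin_sum_topology by (simp add: o_def)
qed

lemma piece_closed: "closedin (four_copies P) (piece l)"
  unfolding piece_def
  by (intro closedin_Union) (use finite_negative_half_edges half_edge_closed in auto)

definition qpiece :: "point option \<Rightarrow> ((bit \<times> bit) \<times> point) set set"
  where "qpiece l = proj ` piece l"

text \<open>A piece is saturated for the gluing, hence equals the preimage of its image, and a
  quotient map detects closed sets by their preimages.\<close>

lemma qpiece_closed: "closedin (ambient_surface P E) (qpiece l)"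
proof -
  have sub: "qpiece l \<subseteq> topspace (ambient_surface P E)"
    unfolding qpiece_def
    using image_mono[OF piece_topspace] continuous_map_image_subset_topspace[OF proj_cont]
    by (rule order_trans)
  have pre: "{x \<in> topspace (four_copies P). proj x \<in> qpiece l} = piece l"
  proof
    show "{x \<in> topspace (four_copies P). proj x \<in> qpiece l} \<subseteq> piece l"
      unfolding qpiece_def using piece_saturated by (auto simp: image_iff)
    show "piece l \<subseteq> {x \<in> topspace (four_copies P). proj x \<in> qpiece l}"
      unfolding qpiece_def using piece_topspace by blast
  qed
  have "quotient_map (four_copies P) (ambient_surface P E) proj"
    unfolding ambient_surface_def by (rule quotient_map_quotient_topology)
  then have "closedin (four_copies P) {x \<in> topspace (four_copies P). proj x \<in> qpiece l} \<longleftrightarrow>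
      closedin (ambient_surface P E) (qpiece l)"
    unfolding quotient_map_closedin using sub by (elim conjE) blast
  then show ?thesis
    unfolding pre using piece_closed by blast
qed

lemma qpiece_disjoint:
  assumes "l \<noteq> l'"
  shows "qpiece l \<inter> qpiece l' = {}"
  using assms piece_disjoint piece_saturated unfolding qpiece_def by blast

definition labels :: "point option set"
  where "labels = insert None (Some ` (interior P \<inter> lattice))"

lemma finite_labels: "finite labels" and card_labels: "card labels = card (interior P \<inter> lattice) + 1"
proof -
  have "finite (interior P \<inter> lattice)"
    by (intro finite_lattice bounded_interior compact_imp_bounded polygon_compact[OF poly])
  then show "finite labels" "card labels = card (interior P \<inter> lattice) + 1"
    unfolding labels_def by (simp_all add: card_image)
qed

lemma label_in_labels:
  assumes "(\<epsilon>, A, p, q) \<in> negative_half_edges harnack"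
  shows "label \<epsilon> p q \<in> labels"
proof -
  have "A \<in> tris"
    using assms by (simp add: negative_half_edges_def)
  then have "isolated \<epsilon> p q \<in> lattice"
    using tri_lattice isolated_props(2)[OF assms] by blast
  then show ?thesis
    unfolding label_def labels_def by simp
qed

lemma qpiece_nonempty:
  assumes "l \<in> labels"
  shows "\<exists>z. z \<in> qpiece l \<inter> curve harnack"
proof -
  obtain v where v: "v \<in> P" "v \<in> lattice" "l = (if v \<in> interior P then Some v else None)"
  proof (cases l)
    case None
    obtain v where "v \<in> frontier P" "v \<in> lattice"
      by (rule frontier_vertex)
    moreover have "frontier P \<subseteq> P"
      using polygon_compact[OF poly] compact_imp_closed frontier_subset_closed by blast
    ultimately show ?thesis
      using that[of v] None by (auto simp: frontier_def)
  next
    case (Some v)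
    then show ?thesis
      using that[of v] assms interior_subset[of P] unfolding labels_def by auto
  qed
  obtain A where A: "A \<in> tris" "v \<in> A"
    using v(1,2) vertex_set by blast
  obtain q where q: "q \<in> A" "q \<noteq> v"
    using tri_two[OF A] .
  \<comment> \<open>The copy in which the parity of \<open>v\<close> is exceptional, so that every
    edge at \<open>v\<close> is negative there and isolates \<open>v\<close>.\<close>
  let ?\<epsilon> = "prod.swap (parity v)"
  have "parity q \<noteq> parity v"
    using tri_parity_inj[OF A(1) q(1) A(2)] q(2) by blast
  then have h: "(?\<epsilon>, A, v, q) \<in> negative_half_edges harnack"
    unfolding negative_half_edges_def opposite_harnack using A q by simp
  have "label ?\<epsilon> v q = l"
    unfolding label_def isolated_def using v(3) by simp
  moreover have m: "(?\<epsilon>, refl_map ?\<epsilon> ((1/2) *\<^sub>R v + (1/2) *\<^sub>R q)) \<in> half_edge ?\<epsilon> A v q"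
    using q(2) by (intro midpoint_half_edge) simp
  ultimately have "(?\<epsilon>, refl_map ?\<epsilon> ((1/2) *\<^sub>R v + (1/2) *\<^sub>R q)) \<in> piece l"
    unfolding piece_iff using h by blast
  then have "proj (?\<epsilon>, refl_map ?\<epsilon> ((1/2) *\<^sub>R v + (1/2) *\<^sub>R q)) \<in> qpiece l \<inter> curve harnack"
    unfolding qpiece_def curve_def using h m by blast
  then show ?thesis by blast
qed

lemma curve_pieces: "curve harnack = (\<Union>l\<in>labels. qpiece l)"
proof
  show "curve harnack \<subseteq> (\<Union>l\<in>labels. qpiece l)"
  proof
    fix x assume "x \<in> curve harnack"
    then obtain \<epsilon> A p q z where h: "(\<epsilon>, A, p, q) \<in> negative_half_edges harnack" "z \<in> half_edge \<epsilon> A p q" "x = proj z"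
      unfolding curve_def by blast
    then have "z \<in> piece (label \<epsilon> p q)"
      unfolding piece_iff by blast
    then show "x \<in> (\<Union>l\<in>labels. qpiece l)"
      unfolding qpiece_def h(3) using label_in_labels[OF h(1)] by blast
  qed
  show "(\<Union>l\<in>labels. qpiece l) \<subseteq> curve harnack"
    unfolding qpiece_def curve_def piece_def by blast
qed

text \<open>The curve is a disjoint union of finitely many nonempty closed pieces, one per label,
  and a component cannot meet two of them. So choosing a component that meets each piece is
  injective.\<close>

lemma card_components_harnack_ge: "card (interior P \<inter> lattice) + 1 \<le> card (components harnack)"
proof -
  have top: "topspace (curve_space harnack) = curve harnack"
    using curve_subset by (simp add: inf_absorb2)
  have cl: "closedin (curve_space harnack) (\<Union>l\<in>M. qpiece l)" if "M \<subseteq> labels" for M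
  proof -
    have "closedin (ambient_surface P E) (\<Union>l\<in>M. qpiece l)"
      using finite_subset[OF that finite_labels] qpiece_closed by (intro closedin_Union) auto
    moreover have "(\<Union>l\<in>M. qpiece l) \<subseteq> curve harnack"
      unfolding curve_pieces using that by blast
    ultimately show ?thesis
      by (simp add: closedin_subset_topspace)
  qed
  have unique: "l = l'" if c: "c \<in> components harnack" "l \<in> labels" "l' \<in> labels"
    "c \<inter> qpiece l \<noteq> {}" "c \<inter> qpiece l' \<noteq> {}" for c l l'
  proof (rule ccontr)
    assume ne: "l \<noteq> l'"
    have conn: "connectedin (curve_space harnack) c"
      using c(1) unfolding components_def by (rule connectedin_connected_components_of)
    have sub: "c \<subseteq> curve harnack"
      using connectedin_subset_topspace[OF conn] top by simp
    let ?X = "\<Union>l\<in>{l}. qpiece l" and ?Y = "\<Union>l\<in>labels - {l}. qpiece l"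
    have "closedin (curve_space harnack) ?X" "closedin (curve_space harnack) ?Y"
      using c(2) by (intro cl; blast)+
    moreover have "c \<subseteq> ?X \<union> ?Y"
      using sub unfolding curve_pieces by blast
    moreover have "?X \<inter> ?Y \<inter> c = {}"
      using qpiece_disjoint by blast
    moreover have "?X \<inter> c \<noteq> {}" "?Y \<inter> c \<noteq> {}"
      using c ne by blast+
    ultimately show False
      using conn unfolding connectedin_closedin by blast
  qed
  have "\<exists>c. c \<in> components harnack \<and> c \<inter> qpiece l \<noteq> {}" if l: "l \<in> labels" for l
  proof -
    obtain z where z: "z \<in> qpiece l" "z \<in> curve harnack"
      using qpiece_nonempty[OF l] by blast
    have "z \<in> \<Union>(components harnack)"
      unfolding components_def Union_connected_components_of top by (rule z(2))
    then show ?thesis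
      using z(1) by blast
  qed
  then obtain \<phi> where \<phi>: "\<And>l. l \<in> labels \<Longrightarrow> \<phi> l \<in> components harnack \<and> \<phi> l \<inter> qpiece l \<noteq> {}"
    by metis
  have "inj_on \<phi> labels"
  proof (rule inj_onI)
    fix l l' assume "l \<in> labels" "l' \<in> labels" "\<phi> l = \<phi> l'"
    then show "l = l'"
      using unique[of "\<phi> l" l l'] \<phi> by metis
  qed
  then have "card labels \<le> card (components harnack)"
    using \<phi> by (intro card_inj_on_le[OF _ _ finite_components]) auto
  then show ?thesis
    by (simp add: card_labels)
qed

end

subsection \<open>Primitive triangulations\<close>

definition triangle_vertices :: "point set set \<Rightarrow> point set set"
  where "triangle_vertices \<T> = {A. card A = 3 \<and> \<not> affine_dependent A \<and> convex hull A \<in> \<T>}"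

lemma hull_vertices:
  assumes "\<not> affine_dependent (A :: point set)"
  shows "{v. v extreme_point_of convex hull A} = A"
  using extreme_point_of_convex_hull_affine_independent[OF assms] by blast

lemma interior_finite_Union_empty:
  assumes "finite \<F>" "\<And>S. S \<in> \<F> \<Longrightarrow> closed S" "\<And>S. S \<in> \<F> \<Longrightarrow> interior S = {}"
  shows "interior (\<Union>\<F>) = {}"
  using assms
proof (induction \<F> rule: finite_induct)
  case empty
  then show ?case by simp
next
  case (insert S \<F>)
  then have "interior (S \<union> \<Union>\<F>) = interior S"
    by (intro interior_closed_Un_empty_interior) auto
  then show ?case
    using insert by simp
qed

lemma lattice_disc_triangle_vertices:
  assumes poly: "polygon P E" and T: "primitive_triangulation P \<T>"
  shows "lattice_disc P E (triangle_vertices \<T>)"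
proof
  have sc: "simplicial_complex \<T>" and UT: "\<Union>\<T> = P" and vT: "{v. {v} \<in> \<T>} = P \<inter> lattice"
    using T by (simp_all add: primitive_triangulation_def)
  have finT: "finite \<T>" and simpT: "\<And>S. S \<in> \<T> \<Longrightarrow> \<exists>n. n simplex S"
    and faceT: "\<And>F S. S \<in> \<T> \<Longrightarrow> F face_of S \<Longrightarrow> F \<in> \<T>"
    and intT: "\<And>S S'. S \<in> \<T> \<Longrightarrow> S' \<in> \<T> \<Longrightarrow> S \<inter> S' face_of S"
    using sc unfolding simplicial_complex_def by blast+
  have indep: "\<not> affine_dependent A" and hullT: "convex hull A \<in> \<T>" and card3: "card A = 3"
    if "A \<in> triangle_vertices \<T>" for A
    using that by (simp_all add: triangle_vertices_def)
  show "polygon P E" by (rule poly)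
  have "inj_on (\<lambda>A. convex hull A) (triangle_vertices \<T>)"
    by (rule inj_onI) (metis hull_vertices indep)
  moreover have "(\<lambda>A. convex hull A) ` triangle_vertices \<T> \<subseteq> \<T>"
    using hullT by blast
  ultimately show fin: "finite (triangle_vertices \<T>)"
    using finT finite_imageD finite_subset by metis
  show "\<exists>a b c. A = {a, b, c} \<and> nondeg a b c" if A: "A \<in> triangle_vertices \<T>" for A
  proof -
    obtain a b c where "A = {a, b, c}" "a \<noteq> b" "a \<noteq> c" "b \<noteq> c"
      using card3[OF A] by (auto simp: card_3_iff)
    then show ?thesis
      using nondeg_if_indep[of a b c] indep[OF A] by blast
  qed
  show "convex hull A \<inter> lattice = A" if A: "A \<in> triangle_vertices \<T>" for A
  proof
    show "convex hull A \<inter> lattice \<subseteq> A"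
    proof
      fix x assume x: "x \<in> convex hull A \<inter> lattice"
      then have "x \<in> P"
        using UT hullT[OF A] by blast
      then have "{x} \<in> \<T>"
        using vT x by blast
      then have "convex hull A \<inter> {x} face_of convex hull A"
        using intT hullT[OF A] by blast
      then have "{x} face_of convex hull A"
        using x by (simp add: Int_absorb1)
      then have "x extreme_point_of convex hull A"
        by (simp add: face_of_singleton)
      then show "x \<in> A"
        using hull_vertices[OF indep[OF A]] by blast
    qed
    show "A \<subseteq> convex hull A \<inter> lattice"
    proof
      fix x assume x: "x \<in> A"
      then have "x extreme_point_of convex hull A"
        using hull_vertices[OF indep[OF A]] by blast
      then have "{x} face_of convex hull A"
        by (simp add: face_of_singleton)
      then have "{x} \<in> \<T>"
        using faceT hullT[OF A] by blast
      then have "x \<in> P \<inter> lattice"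
        using vT by blast
      then show "x \<in> convex hull A \<inter> lattice"
        using hull_inc[OF x, of convex] by blast
    qed
  qed
  show "(\<Union>A\<in>triangle_vertices \<T>. convex hull A) = P"
  proof
    show "(\<Union>A\<in>triangle_vertices \<T>. convex hull A) \<subseteq> P"
      using UT hullT by blast
    let ?W = "\<Union>A\<in>triangle_vertices \<T>. convex hull A"
    let ?F = "{S \<in> \<T>. \<not> 2 simplex S}"
    have "closed (convex hull A)" if "A \<in> triangle_vertices \<T>" for A
      using simpT[OF hullT[OF that]] closed_simplex by blast
    then have clW: "closed ?W"
      using fin by (intro closed_UN) auto
    \<comment> \<open>Simplices of lower dimension cannot fill an open set. What the triangles miss
      in \<open>interior P\<close> is open and covered by such simplices, hence empty; closing up
      gives all of \<open>P\<close>.\<close>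
    have "interior (\<Union>?F) = {}"
    proof (rule interior_finite_Union_empty)
      show "finite ?F" using finT by simp
      fix S assume S: "S \<in> ?F"
      then obtain n where n: "n simplex S" "n \<noteq> 2"
        using simpT by blast
      show "closed S" using n(1) closed_simplex by blast
      have "aff_dim S \<noteq> 2"
        using aff_dim_simplex[OF n(1)] n(2) by simp
      then show "interior S = {}"
        using aff_dim_nonempty_interior[of S] by auto
    qed
    moreover have "interior P - ?W \<subseteq> \<Union>?F"
    proof
      fix x assume x: "x \<in> interior P - ?W"
      then obtain S where S: "S \<in> \<T>" "x \<in> S"
        using UT interior_subset by blast
      have "\<not> 2 simplex S"
      proof
        assume "2 simplex S"
        then obtain C where C: "\<not> affine_dependent C" "card C = 3" "S = convex hull C"
          unfolding simplex_def by auto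
        then have "C \<in> triangle_vertices \<T>"
          using S(1) by (simp add: triangle_vertices_def)
        then show False
          using x S(2) C(3) by blast
      qed
      then show "x \<in> \<Union>?F"
        using S by blast
    qed
    moreover have "open (interior P - ?W)"
      using clW by (intro open_Diff) auto
    ultimately have "interior P - ?W = {}"
      using interior_maximal[of "interior P - ?W" "\<Union>?F"] by simp
    then have "interior P \<subseteq> ?W"
      by blast
    then have "closure (interior P) \<subseteq> ?W"
      using clW by (rule closure_minimal)
    then show "P \<subseteq> ?W"
      by (simp only: polygon_closure_interior[OF poly])
  qed
  \<comment> \<open>The intersection is a face of both simplices, so it is spanned by a subset of
    \<open>A\<close> and by a subset of \<open>B\<close>. These agree, since each consists of the
    extreme points of the common face.\<close>
  show "convex hull A \<inter> convex hull B = convex hull (A \<inter> B)"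
    if A: "A \<in> triangle_vertices \<T>" and B: "B \<in> triangle_vertices \<T>" for A B
  proof
    show "convex hull (A \<inter> B) \<subseteq> convex hull A \<inter> convex hull B"
      by (simp add: hull_mono)
    have "convex hull A \<inter> convex hull B face_of convex hull A"
      by (rule intT[OF hullT[OF A] hullT[OF B]])
    then obtain C where C: "C \<subseteq> A" "convex hull A \<inter> convex hull B = convex hull C"
      unfolding face_of_convex_hull_affine_independent[OF indep[OF A]] by blast
    have "convex hull B \<inter> convex hull A face_of convex hull B"
      by (rule intT[OF hullT[OF B] hullT[OF A]])
    then obtain D where D: "D \<subseteq> B" "convex hull B \<inter> convex hull A = convex hull D"
      unfolding face_of_convex_hull_affine_independent[OF indep[OF B]] by blast
    have "\<not> affine_dependent C" "\<not> affine_dependent D"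
      using C(1) D(1) indep[OF A] indep[OF B] affine_dependent_subset by blast+
    moreover have "convex hull C = convex hull D"
      using C(2) D(2) by blast
    ultimately have "C = D"
      using hull_vertices by metis
    then show "convex hull A \<inter> convex hull B \<subseteq> convex hull (A \<inter> B)"
      using C D by (metis Int_greatest hull_mono)
  qed
qed

lemma T_curve_eq_curve:
  assumes poly: "polygon P E" and T: "primitive_triangulation P \<T>"
  shows "T_curve E \<T> \<delta> = lattice_disc.curve E (triangle_vertices \<T>) \<delta>"
proof -
  interpret lattice_disc P E "triangle_vertices \<T>"
    by (rule lattice_disc_triangle_vertices[OF assms])
  have sc: "simplicial_complex \<T>" and vT: "{v. {v} \<in> \<T>} = P \<inter> lattice"
    using T by (simp_all add: primitive_triangulation_def)
  have faceT: "\<And>F S. S \<in> \<T> \<Longrightarrow> F face_of S \<Longrightarrow> F \<in> \<T>"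
    using sc unfolding simplicial_complex_def by blast
  have sign: "edge_sign \<delta> \<epsilon> (closed_segment p q) = copy_sign \<delta> \<epsilon> p * copy_sign \<delta> \<epsilon> q" if "p \<noteq> q" for \<epsilon> p q
  proof -
    have "{v. v extreme_point_of closed_segment p q} = {p, q}"
      by (auto simp: extreme_point_of_segment)
    then show ?thesis
      unfolding edge_sign_def using that by simp
  qed
  have "{dual_half_edge \<epsilon> t e |\<epsilon> t e.
          t \<in> \<T> \<and> 2 simplex t \<and> e \<in> \<T> \<and> 1 simplex e \<and> e \<subseteq> t \<and> edge_sign \<delta> \<epsilon> e = - 1} =
      (\<lambda>(\<epsilon>, A, p, q). half_edge \<epsilon> A p q) ` negative_half_edges \<delta>"
  proof (intro equalityI subsetI)
    fix h assume "h \<in> {dual_half_edge \<epsilon> t e |\<epsilon> t e.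
          t \<in> \<T> \<and> 2 simplex t \<and> e \<in> \<T> \<and> 1 simplex e \<and> e \<subseteq> t \<and> edge_sign \<delta> \<epsilon> e = - 1}"
    then obtain \<epsilon> t e where h: "h = dual_half_edge \<epsilon> t e" "t \<in> \<T>" "2 simplex t" "e \<in> \<T>" "1 simplex e"
      "e \<subseteq> t" "edge_sign \<delta> \<epsilon> e = - 1"
      by blast
    obtain A where A: "\<not> affine_dependent A" "card A = 3" "t = convex hull A"
      using h(3) unfolding simplex_def by auto
    then have At: "A \<in> triangle_vertices \<T>"
      using h(2) by (simp add: triangle_vertices_def)
    obtain B where B: "\<not> affine_dependent B" "card B = 2" "e = convex hull B"
      using h(5) unfolding simplex_def by auto
    obtain p q where pq: "B = {p, q}" "p \<noteq> q"
      using B(2) by (auto simp: card_2_iff)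
    have e: "e = closed_segment p q"
      using B(3) pq(1) by (simp add: segment_convex_hull)
    \<comment> \<open>The definition of the curve only asks for \<open>e \<subseteq> t\<close>. The
      ends of \<open>e\<close> are lattice points in \<open>t\<close>, and those are the vertices of
      \<open>t\<close>.\<close>
    have "v \<in> A" if "v \<in> B" for v
    proof -
      have "v extreme_point_of e"
        using hull_vertices[OF B(1)] that B(3) by blast
      then have "{v} face_of e"
        by (simp add: face_of_singleton)
      then have "v \<in> P \<inter> lattice"
        using faceT[OF h(4)] vT by blast
      moreover have "v \<in> convex hull A"
        using hull_inc[OF that, of convex] B(3) h(6) A(3) by blast
      ultimately show ?thesis
        using lat[OF At] by blast
    qed
    then have "p \<in> A" "q \<in> A"
      using pq(1) by simp_all
    moreover have "opposite \<delta> \<epsilon> p q"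
      using h(7) unfolding e sign[OF pq(2)] opposite_def .
    ultimately have "(\<epsilon>, A, p, q) \<in> negative_half_edges \<delta>"
      unfolding negative_half_edges_def using At pq(2) by simp
    moreover have "h = half_edge \<epsilon> A p q"
      unfolding h(1) half_edge_def e A(3) ..
    ultimately show "h \<in> (\<lambda>(\<epsilon>, A, p, q). half_edge \<epsilon> A p q) ` negative_half_edges \<delta>"
      by (intro image_eqI[of _ _ "(\<epsilon>, A, p, q)"]) simp_all
  next
    fix h assume "h \<in> (\<lambda>(\<epsilon>, A, p, q). half_edge \<epsilon> A p q) ` negative_half_edges \<delta>"
    then obtain \<epsilon> A p q where n: "(\<epsilon>, A, p, q) \<in> negative_half_edges \<delta>" and h: "h = half_edge \<epsilon> A p q"
      by auto
    have A: "A \<in> triangle_vertices \<T>" "p \<in> A" "q \<in> A" "p \<noteq> q" and o: "opposite \<delta> \<epsilon> p q"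
      using n by (simp_all add: negative_half_edges_def)
    have ind: "\<not> affine_dependent A" "card A = 3" "convex hull A \<in> \<T>"
      using A(1) by (simp_all add: triangle_vertices_def)
    have t2: "2 simplex (convex hull A)"
      using ind by (intro simplex_convex_hull) simp_all
    have sub: "{p, q} \<subseteq> A"
      using A by blast
    then have "\<not> affine_dependent {p, q}"
      using ind(1) affine_dependent_subset by blast
    then have e1: "1 simplex (closed_segment p q)"
      unfolding segment_convex_hull using A(4) by (intro simplex_convex_hull) simp_all
    have "closed_segment p q face_of convex hull A"
      unfolding face_of_convex_hull_affine_independent[OF ind(1)] segment_convex_hull
      using sub by blast
    then have eT: "closed_segment p q \<in> \<T>"
      using faceT ind(3) by blast
    have "closed_segment p q \<subseteq> convex hull A"
      by (rule edge_subset_hull[OF A(1-3)])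
    moreover have "edge_sign \<delta> \<epsilon> (closed_segment p q) = - 1"
      using o unfolding sign[OF A(4)] opposite_def .
    ultimately show "h \<in> {dual_half_edge \<epsilon> t e |\<epsilon> t e.
          t \<in> \<T> \<and> 2 simplex t \<and> e \<in> \<T> \<and> 1 simplex e \<and> e \<subseteq> t \<and> edge_sign \<delta> \<epsilon> e = - 1}"
      unfolding h half_edge_def using ind(3) t2 eT e1 by blast
  qed
  then show ?thesis
    unfolding T_curve_def curve_def by simp
qed

lemma T_curve_components_eq:
  assumes "polygon P E" "primitive_triangulation P \<T>"
  shows "T_curve_components P E \<T> \<delta> = lattice_disc.components P E (triangle_vertices \<T>) \<delta>"
  unfolding T_curve_components_def T_curve_eq_curve[OF assms]
    lattice_disc.components_def[OF lattice_disc_triangle_vertices[OF assms]] ..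

subsection \<open>Unimodular triangulations\<close>

text \<open>Lattice triangles of area 1/2; equivalently, the edge vectors at a vertex form a basis
  of the lattice.\<close>

definition unimodular :: "point \<Rightarrow> point \<Rightarrow> point \<Rightarrow> bool"
  where "unimodular a b c \<longleftrightarrow>
    a \<in> lattice \<and> b \<in> lattice \<and> c \<in> lattice \<and> \<bar>det2 (b - a) (c - a)\<bar> = 1"

lemma unimodularD:
  assumes "unimodular a b c"
  shows "a \<in> lattice" "b \<in> lattice" "c \<in> lattice" "\<bar>det2 (b - a) (c - a)\<bar> = 1"
  using assms[unfolded unimodular_def] by (simp_all only: simp_thms)

lemma unimodular_nondeg: "unimodular a b c \<Longrightarrow> nondeg a b c"
  by (auto simp: unimodular_def nondeg_def)

lemma unimodular_cycle: "unimodular a b c \<Longrightarrow> unimodular b c a"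
  unfolding unimodular_def det2_cycle[of c b a] by (elim conjE, intro conjI)

lemma unimodular_flip: "unimodular a b c \<Longrightarrow> unimodular b a c"
  unfolding unimodular_def det2_flip[of a b c] abs_minus_cancel by (elim conjE, intro conjI)

lemma bary_unimodular_Ints:
  assumes "unimodular a b c" "x \<in> lattice"
  shows "bary a b c x \<in> \<int>"
proof -
  note L = unimodularD(1,2)[OF assms(1)]
  have d: "det2 (b - a) (c - a) = 1 \<or> det2 (b - a) (c - a) = - 1"
    using unimodularD(4)[OF assms(1)] by (auto simp: abs_if split: if_splits)
  have "det2 (b - a) (x - a) \<in> \<int>"
    by (intro det2_Ints lattice_diff L assms(2))
  then show ?thesis
    using d by (auto simp: bary_def)
qed

text \<open>Barycentric coordinates of lattice points are integers here. Three nonnegative integers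
  with sum 1 are 1, 0, 0 in some order.\<close>

lemma unimodular_hull_lattice:
  assumes u: "unimodular a b c"
  shows "convex hull {a, b, c} \<inter> lattice = {a, b, c}"
proof
  interpret nondeg a b c by (rule unimodular_nondeg[OF u])
  note L = unimodularD(1,2,3)[OF u]
  then show "{a, b, c} \<subseteq> convex hull {a, b, c} \<inter> lattice"
    by (intro Int_greatest hull_subset) (simp only: insert_subset empty_subsetI simp_thms)
  show "convex hull {a, b, c} \<inter> lattice \<subseteq> {a, b, c}"
  proof
    fix x assume x: "x \<in> convex hull {a, b, c} \<inter> lattice"
    then have xL: "x \<in> lattice" and xh: "x \<in> convex hull {a, b, c}"
      by blast+
    obtain i where i: "bary b c a x = of_int i"
      using bary_unimodular_Ints[OF unimodular_cycle[OF u] xL] by (auto elim: Ints_cases)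
    obtain j where j: "bary c a b x = of_int j"
      using bary_unimodular_Ints[OF unimodular_cycle[OF unimodular_cycle[OF u]] xL] by (auto elim: Ints_cases)
    obtain k where k: "bary a b c x = of_int k"
      using bary_unimodular_Ints[OF u xL] by (auto elim: Ints_cases)
    have "0 \<le> i" "0 \<le> j" "0 \<le> k"
      using xh i j k unfolding mem_hull by simp_all
    moreover have "real_of_int (i + j + k) = of_int 1"
      using bary_sum[of x] i j k by simp
    then have "i + j + k = 1"
      by (simp only: of_int_eq_iff)
    ultimately have "i = 1 \<and> j = 0 \<and> k = 0 \<or> i = 0 \<and> j = 1 \<and> k = 0 \<or> i = 0 \<and> j = 0 \<and> k = 1"
      by presburger
    then show "x \<in> {a, b, c}"
      using bary_expand[of x] i j k by auto
  qed
qed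

lemma unimodular_primitive:
  assumes u: "unimodular a b c"
  shows "primitive_segment a b"
proof -
  interpret nondeg a b c by (rule unimodular_nondeg[OF u])
  note L = unimodularD(1,2)[OF u]
  have "c \<notin> closed_segment a b"
    using bary_segment[of c] by auto
  moreover have "closed_segment a b \<subseteq> convex hull {a, b, c}"
    unfolding segment_convex_hull by (intro hull_mono) blast
  ultimately have "closed_segment a b \<inter> lattice \<subseteq> {a, b}"
    using unimodular_hull_lattice[OF u] by blast
  moreover have "{a, b} \<subseteq> closed_segment a b \<inter> lattice"
    using L by (simp only: insert_subset empty_subsetI simp_thms IntI ends_in_segment)
  ultimately show ?thesis
    unfolding primitive_segment_def using L distinct(1) by (intro conjI subset_antisym)
qed

text \<open>Triangles are only required to have disjoint interiors; that they meet in common faces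
  is derived in \<open>inter\<close>. This keeps the conditions easy to verify after a flip and
  after restriction to the polygon.\<close>

locale unimodular_triangulation =
  fixes Q :: "point set" and tris :: "point set set"
  assumes fin: "finite tris"
    and unimod: "\<And>A. A \<in> tris \<Longrightarrow> \<exists>a b c. A = {a, b, c} \<and> unimodular a b c"
    and disj: "\<And>A B. A \<in> tris \<Longrightarrow> B \<in> tris \<Longrightarrow> A \<noteq> B \<Longrightarrow>
      interior (convex hull A) \<inter> interior (convex hull B) = {}"
    and cover: "(\<Union>A\<in>tris. convex hull A) = Q"
begin

lemma triE:
  assumes "A \<in> tris" "p \<in> A" "q \<in> A" "p \<noteq> q"
  obtains r where "A = {p, q, r}" "unimodular p q r"
proof -
  obtain a b c where A: "A = {a, b, c}" and n: "unimodular a b c"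
    using unimod[OF assms(1)] by blast
  have ns: "unimodular b c a" "unimodular c a b" "unimodular b a c" "unimodular c b a" "unimodular a c b"
    using n unimodular_cycle unimodular_flip by blast+
  have eqs: "{a, b, c} = {b, c, a}" "{a, b, c} = {c, a, b}" "{a, b, c} = {b, a, c}"
    "{a, b, c} = {c, b, a}" "{a, b, c} = {a, c, b}"
    by blast+
  have "(p = a \<or> p = b \<or> p = c) \<and> (q = a \<or> q = b \<or> q = c)"
    using assms(2,3) A by simp
  then show ?thesis
    using that n ns eqs assms(4) A by metis
qed

lemma tri_indep: "A \<in> tris \<Longrightarrow> \<not> affine_dependent A"
  using unimod[of A] nondeg.indep[OF unimodular_nondeg] by blast

lemma tri_finite: "A \<in> tris \<Longrightarrow> finite A"
  using unimod[of A] by auto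

lemma tri_card: "A \<in> tris \<Longrightarrow> card A = 3"
  using unimod[of A] nondeg.distinct[OF unimodular_nondeg] by auto

lemma hull_lattice: "A \<in> tris \<Longrightarrow> convex hull A \<inter> lattice = A"
  using unimod[of A] unimodular_hull_lattice by blast

lemma tri_lattice: "A \<in> tris \<Longrightarrow> A \<subseteq> lattice"
  using hull_lattice by blast

lemma interior_nonempty: "A \<in> tris \<Longrightarrow> interior (convex hull A) \<noteq> {}"
  using unimod[of A] nondeg.barycenter_interior[OF unimodular_nondeg] by blast

lemma closure_interior_hull: "A \<in> tris \<Longrightarrow> closure (interior (convex hull A)) = convex hull A"
  using convex_closure_interior[OF convex_convex_hull interior_nonempty]
    closure_closed[OF compact_imp_closed[OF finite_imp_compact_convex_hull[OF tri_finite]]] by simp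

lemma hull_closed: "A \<in> tris \<Longrightarrow> closed (convex hull A)"
  using compact_imp_closed[OF finite_imp_compact_convex_hull[OF tri_finite]] .

lemma prim: "A \<in> tris \<Longrightarrow> p \<in> A \<Longrightarrow> q \<in> A \<Longrightarrow> p \<noteq> q \<Longrightarrow> primitive_segment p q"
  using triE unimodular_primitive by metis

lemma supporting_face:
  assumes A: "A \<in> tris" and le: "\<And>y. y \<in> convex hull A \<Longrightarrow> n \<bullet> y \<le> b"
    and x: "x \<in> convex hull A" "n \<bullet> x = b"
  shows "x \<in> convex hull {v \<in> A. n \<bullet> v = b}"
proof -
  have "convex hull A \<inter> {y. n \<bullet> y = b} face_of convex hull A"
    using le by (intro face_of_Int_supporting_hyperplane_le) auto
  then obtain C where C: "C \<subseteq> A" "convex hull A \<inter> {y. n \<bullet> y = b} = convex hull C"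
    unfolding face_of_convex_hull_affine_independent[OF tri_indep[OF A]] by blast
  have "C \<subseteq> convex hull C"
    by (rule hull_subset)
  then have "C \<subseteq> {v \<in> A. n \<bullet> v = b}"
    using C by blast
  moreover have "x \<in> convex hull C"
    using x C(2) by blast
  ultimately show ?thesis
    using hull_mono by blast
qed

lemma det2_orthogonal:
  assumes "n \<noteq> 0" "n \<bullet> u = 0" "n \<bullet> v = 0"
  shows "det2 u v = 0"
proof -
  have 1: "fst n * fst u + snd n * snd u = 0" "fst n * fst v + snd n * snd v = 0"
    using assms(2,3) by (simp_all add: inner_prod_def)
  have "fst n * det2 u v = (fst n * fst u + snd n * snd u) * snd v - snd u * (fst n * fst v + snd n * snd v)"
    by (simp add: det2_def algebra_simps)
  moreover have "snd n * det2 u v = fst u * (fst n * fst v + snd n * snd v) - (fst n * fst u + snd n * snd u) * fst v"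
    by (simp add: det2_def algebra_simps)
  ultimately have "fst n * det2 u v = 0" "snd n * det2 u v = 0"
    using 1 by simp_all
  then show ?thesis
    using assms(1) by (auto simp: prod_eq_iff)
qed

lemma level_proper:
  assumes "A \<in> tris" "n \<noteq> 0"
  shows "{v \<in> A. n \<bullet> v = b} \<noteq> A"
proof
  assume eq: "{v \<in> A. n \<bullet> v = b} = A"
  obtain p q r where A: "A = {p, q, r}" and u: "unimodular p q r"
    using unimod[OF assms(1)] by blast
  have "n \<bullet> p = b" "n \<bullet> q = b" "n \<bullet> r = b"
    using eq unfolding A by auto
  then have "n \<bullet> (q - p) = 0" "n \<bullet> (r - p) = 0"
    by (simp_all add: inner_diff_right)
  then have "det2 (q - p) (r - p) = 0"
    using det2_orthogonal[OF assms(2)] by blast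
  then show False
    using unimodular_nondeg[OF u] by (simp add: nondeg_def)
qed

lemma proper_subset_pair:
  assumes "A \<in> tris" "C \<subseteq> A" "C \<noteq> A" "x \<in> convex hull C" "x \<notin> lattice"
  obtains p q where "C = {p, q}" "p \<noteq> q"
proof -
  have fC: "finite C"
    using tri_finite[OF assms(1)] assms(2) finite_subset by blast
  have "card C < 3"
    using psubset_card_mono[OF tri_finite[OF assms(1)], of C] assms(2,3) tri_card[OF assms(1)] by auto
  moreover have "C \<noteq> {}"
    using assms(4) by auto
  moreover have "card C \<noteq> 1"
  proof
    assume "card C = 1"
    then obtain w where "C = {w}"
      by (auto simp: card_1_singleton_iff)
    then have "x \<in> A"
      using assms(2,4) by auto
    then show False
      using tri_lattice[OF assms(1)] assms(5) by blast
  qed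
  moreover have "card C \<noteq> 0"
    using \<open>C \<noteq> {}\<close> fC by simp
  ultimately have "card C = 2"
    by linarith
  then show ?thesis
    using that by (auto simp: card_2_iff)
qed

text \<open>A line separates the two interiors, so a common point lies on it and in a face of each
  triangle. If it is not a lattice point, these faces are primitive segments on one line that share
  a nonlattice point, and therefore equal.\<close>

lemma inter:
  assumes A: "A \<in> tris" and B: "B \<in> tris"
  shows "convex hull A \<inter> convex hull B = convex hull (A \<inter> B)"
proof (cases "A = B")
  case True
  then show ?thesis by simp
next
  case False
  show ?thesis
  proof
    show "convex hull (A \<inter> B) \<subseteq> convex hull A \<inter> convex hull B"
      by (simp add: hull_mono)
    obtain n b where n: "n \<noteq> 0" and nA: "\<forall>x\<in>interior (convex hull A). n \<bullet> x \<le> b"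
      and nB: "\<forall>x\<in>interior (convex hull B). n \<bullet> x \<ge> b"
      using separating_hyperplane_sets[OF convex_interior[OF convex_convex_hull] convex_interior[OF convex_convex_hull]
          interior_nonempty[OF A] interior_nonempty[OF B] disj[OF A B False]] by blast
    have "closure (interior (convex hull A)) \<subseteq> {x. n \<bullet> x \<le> b}"
      using nA by (intro closure_minimal closed_halfspace_le) blast
    then have hA: "n \<bullet> x \<le> b" if "x \<in> convex hull A" for x
      using that unfolding closure_interior_hull[OF A] by blast
    have "closure (interior (convex hull B)) \<subseteq> {x. n \<bullet> x \<ge> b}"
      using nB by (intro closure_minimal closed_halfspace_ge) blast
    then have hB: "n \<bullet> x \<ge> b" if "x \<in> convex hull B" for x
      using that unfolding closure_interior_hull[OF B] by blast
    define C D where "C = {v \<in> A. n \<bullet> v = b}" and "D = {v \<in> B. n \<bullet> v = b}"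
    have D_alt: "D = {v \<in> B. (- n) \<bullet> v = - b}"
      unfolding D_def by auto
    show "convex hull A \<inter> convex hull B \<subseteq> convex hull (A \<inter> B)"
    proof
      fix x assume "x \<in> convex hull A \<inter> convex hull B"
      then have xA: "x \<in> convex hull A" and xB: "x \<in> convex hull B"
        by blast+
      have xb: "n \<bullet> x = b"
        using hA[OF xA] hB[OF xB] by linarith
      have xC: "x \<in> convex hull C"
        unfolding C_def by (rule supporting_face[OF A hA xA xb])
      have xD: "x \<in> convex hull D"
        unfolding D_alt by (rule supporting_face[OF B _ xB]) (use hB xb in auto)
      show "x \<in> convex hull (A \<inter> B)"
      proof (cases "x \<in> lattice")
        case True
        then have "x \<in> A \<inter> B"
          using xA xB hull_lattice[OF A] hull_lattice[OF B] by blast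
        then show ?thesis
          by (rule hull_inc)
      next
        case False
        have CA: "C \<subseteq> A" "C \<noteq> A" and DB: "D \<subseteq> B" "D \<noteq> B"
          using level_proper[OF A n, of b] level_proper[OF B n, of b] unfolding C_def D_def by blast+
        obtain p q where pq: "C = {p, q}" "p \<noteq> q"
          using proper_subset_pair[OF A CA xC False] .
        obtain r s where rs: "D = {r, s}" "r \<noteq> s"
          using proper_subset_pair[OF B DB xD False] .
        have pqA: "p \<in> A" "q \<in> A" "n \<bullet> p = b" "n \<bullet> q = b"
          using pq(1) unfolding C_def by blast+
        have rsB: "r \<in> B" "s \<in> B" "n \<bullet> r = b" "n \<bullet> s = b"
          using rs(1) unfolding D_def by blast+
        have P1: "primitive_segment p q" and P2: "primitive_segment r s"
          using prim[OF A pqA(1,2) pq(2)] prim[OF B rsB(1,2) rs(2)] .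
        have z: "n \<bullet> (q - p) = 0" "n \<bullet> (s - r) = 0"
          using pqA rsB by (simp_all add: inner_diff_right)
        have d: "det2 (q - p) (s - r) = 0" "det2 (s - r) (q - p) = 0"
          using det2_orthogonal[OF n z] det2_orthogonal[OF n z(2,1)] .
        have x1: "x \<in> closed_segment p q" and x2: "x \<in> closed_segment r s"
          using xC xD unfolding pq(1) rs(1) segment_convex_hull .
        have "closed_segment p q = closed_segment r s"
          using primitive_subset_collinear[OF P1 primitive_segmentD(1,2,3)[OF P2] x1 x2 False d(1)]
            primitive_subset_collinear[OF P2 primitive_segmentD(1,2,3)[OF P1] x2 x1 False d(2)]
          by (rule subset_antisym)
        then have "{p, q} = {r, s}"
          using primitive_segmentD(4)[OF P1] primitive_segmentD(4)[OF P2] by simp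
        then have "C \<subseteq> A \<inter> B"
          using CA DB pq(1) rs(1) by blast
        then show ?thesis
          using xC hull_mono by blast
      qed
    qed
  qed
qed

lemma hull_inter:
  assumes "A \<in> tris" "B \<in> tris" "C \<subseteq> A" "D \<subseteq> B"
  shows "convex hull C \<inter> convex hull D = convex hull (C \<inter> D)"
  by (rule hull_inter_faces[OF tri_indep[OF assms(1)] tri_indep[OF assms(2)] inter[OF assms(1,2)] assms(3,4)])

lemma vertex_set: "\<Union>tris = Q \<inter> lattice"
proof
  show "\<Union>tris \<subseteq> Q \<inter> lattice"
    using hull_lattice cover by blast
  show "Q \<inter> lattice \<subseteq> \<Union>tris"
  proof
    fix x assume x: "x \<in> Q \<inter> lattice"
    then obtain A where "A \<in> tris" "x \<in> convex hull A"
      using cover by blast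
    then show "x \<in> \<Union>tris"
      using hull_lattice[of A] x by blast
  qed
qed

lemma primitive_triangulation: "primitive_triangulation Q {F. \<exists>A\<in>tris. F face_of convex hull A}"
proof -
  let ?T = "{F. \<exists>A\<in>tris. F face_of convex hull A}"
  have simplex_face: "\<exists>n. n simplex F" if A: "A \<in> tris" and F: "F face_of convex hull A" for A F
  proof -
    obtain C where C: "C \<subseteq> A" "F = convex hull C"
      using F unfolding face_of_convex_hull_affine_independent[OF tri_indep[OF A]] by blast
    have "\<not> affine_dependent C"
      using C(1) tri_indep[OF A] affine_dependent_subset by blast
    then have "(int (card C) - 1) simplex F"
      unfolding C(2) by (intro simplex_convex_hull) simp_all
    then show ?thesis ..
  qed
  have "?T = (\<Union>A\<in>tris. {F. F face_of convex hull A})"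
    by blast
  moreover have "finite {F. F face_of convex hull A}" if "A \<in> tris" for A
    using tri_finite[OF that] by (intro finite_polytope_faces polytope_convex_hull)
  ultimately have finT: "finite ?T"
    using fin by auto
  have "simplicial_complex ?T"
    unfolding simplicial_complex_def
  proof (intro conjI allI ballI impI finT)
    fix S assume "S \<in> ?T"
    then show "\<exists>n. n simplex S"
      using simplex_face by blast
  next
    fix F S assume "S \<in> ?T \<and> F face_of S"
    then show "F \<in> ?T"
      using face_of_trans by blast
  next
    fix S S' assume "S \<in> ?T \<and> S' \<in> ?T"
    then obtain A B where AB: "A \<in> tris" "B \<in> tris" and F: "S face_of convex hull A" "S' face_of convex hull B"
      by blast
    have "convex hull A \<inter> convex hull B face_of convex hull A"
      unfolding inter[OF AB] face_of_convex_hull_affine_independent[OF tri_indep[OF AB(1)]] by blast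
    moreover have "convex hull A \<inter> convex hull B face_of convex hull B"
      unfolding inter[OF AB] face_of_convex_hull_affine_independent[OF tri_indep[OF AB(2)]] by blast
    ultimately show "S \<inter> S' face_of S"
      using face_of_Int_subface F by blast
  qed
  moreover have "\<Union>?T = Q"
  proof
    show "\<Union>?T \<subseteq> Q"
      using cover face_of_imp_subset by blast
    show "Q \<subseteq> \<Union>?T"
      using cover face_of_refl[OF convex_convex_hull] by blast
  qed
  moreover have "{v. {v} \<in> ?T} = Q \<inter> lattice"
  proof -
    have "{v} face_of convex hull A \<longleftrightarrow> v \<in> A" if "A \<in> tris" for v A
      using hull_vertices[OF tri_indep[OF that]] by (auto simp: face_of_singleton)
    then show ?thesis
      unfolding vertex_set[symmetric] by blast
  qed
  ultimately show ?thesis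
    by (simp add: primitive_triangulation_def)
qed

end

subsection \<open>Flips\<close>

text \<open>Proper crossing: a common end or an end of one segment lying on the other does not
  count.\<close>

definition crosses :: "point \<Rightarrow> point \<Rightarrow> point \<Rightarrow> point \<Rightarrow> bool"
  where "crosses p q u v \<longleftrightarrow>
    det2 (v - u) (p - u) * det2 (v - u) (q - u) < 0 \<and> det2 (q - p) (u - p) * det2 (q - p) (v - p) < 0"

lemma crosses_sym: "crosses p q u v \<longleftrightarrow> crosses q p u v"
  unfolding crosses_def det2_flip[of q p] by (auto simp: mult.commute)

lemma crosses_commute: "crosses p q u v \<longleftrightarrow> crosses u v p q"
  unfolding crosses_def by auto

lemma crosses_point:
  assumes "crosses p q u v"
  obtains y \<mu> \<nu> where "y = p + \<mu> *\<^sub>R (q - p)" "0 < \<mu>" "\<mu> < 1" "y = u + \<nu> *\<^sub>R (v - u)" "0 < \<nu>" "\<nu> < 1"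
proof -
  define H where "H x = det2 (v - u) (x - u)" for x
  define K where "K x = det2 (q - p) (x - p)" for x
  have HK: "H p * H q < 0" "K u * K v < 0"
    using assms by (simp_all add: crosses_def H_def K_def)
  define \<mu> where "\<mu> = H p / (H p - H q)"
  define \<nu> where "\<nu> = K u / (K u - K v)"
  have frac: "0 < a / (a - b) \<and> a / (a - b) < 1" if "a * b < 0" for a b :: real
    using that by (auto simp: mult_less_0_iff divide_simps)
  have ne: "H p - H q \<noteq> 0" "K u - K v \<noteq> 0"
    using HK by (auto simp: mult_less_0_iff)
  define y where "y = p + \<mu> *\<^sub>R (q - p)"
  have "H y = H p + \<mu> * (H q - H p)"
    by (simp add: H_def y_def det2_def algebra_simps)
  also have "\<dots> = 0"
    using ne(1) by (simp add: \<mu>_def field_simps)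
  finally have "det2 (v - u) (y - u) = 0"
    by (simp add: H_def)
  moreover have "v - u \<noteq> 0"
    using HK(2) by (auto simp: K_def not_less)
  ultimately obtain k where k: "y - u = k *\<^sub>R (v - u)"
    by (rule det2_zeroD)
  have yk: "y = u + k *\<^sub>R (v - u)"
    using k by (simp add: algebra_simps)
  have "K y = K u + k * (K v - K u)"
    unfolding yk by (simp add: K_def det2_def algebra_simps)
  moreover have "K y = 0"
    by (simp add: K_def y_def det2_def)
  ultimately have "k = \<nu>"
    using ne(2) by (simp add: \<nu>_def field_simps)
  then show ?thesis
    using that[of y \<mu> k] y_def yk frac[OF HK(1)] frac[OF HK(2)] unfolding \<mu>_def \<nu>_def by blast
qed

text \<open>The assumption \<open>side\<close> says that \<open>r\<close> and \<open>v\<close> lie on the same side of the line \<open>p q\<close>.\<close>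

locale crossed_apex =
  fixes p q r u v :: point
  assumes uni: "unimodular p q r" and prim: "primitive_segment u v"
    and cross: "crosses p q u v"
    and side: "det2 (q - p) (r - p) * det2 (q - p) (v - p) > 0"
begin

definition height :: "point \<Rightarrow> real"
  where "height x = det2 (v - u) (x - u)"

lemma height_uv [simp]: "height u = 0" "height v = 0"
  by (simp_all add: height_def)

lemma lattice_pqr: "p \<in> lattice" "q \<in> lattice" "r \<in> lattice"
  by (rule unimodularD[OF uni])+

lemma lattice_uv: "u \<in> lattice" "v \<in> lattice"
  by (rule primitive_segmentD[OF prim])+

lemma height_Ints: "x \<in> lattice \<Longrightarrow> height x \<in> \<int>"
  unfolding height_def by (intro det2_Ints lattice_diff lattice_uv)

lemma height_pq: "height p * height q < 0"
  using cross by (simp add: crosses_def height_def)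

text \<open>The line \<open>u v\<close> enters the triangle through \<open>p q\<close> and, as
  \<open>p\<close> and \<open>r\<close> are on different sides of it, leaves through
  \<open>p r\<close>. The linear coordinate that is 0 on \<open>p q\<close> and 1 at
  \<open>r\<close> is an integer at \<open>v\<close>, hence at least 1, so \<open>v\<close> lies
  beyond the exit.\<close>

lemma apex_crosses:
  assumes pr: "height p * height r < 0"
  shows "crosses p r u v"
proof -
  let ?D = "det2 (q - p) (r - p)"
  \<comment> \<open>\<open>\<beta>\<close> and \<open>\<gamma>\<close> are the coordinates of
    \<open>x - p\<close> in the basis \<open>q - p\<close>, \<open>r - p\<close>. The determinant is
    1 or -1, so multiplying by it replaces dividing by it.\<close>
  define \<beta> where "\<beta> x = det2 (x - p) (r - p) * ?D" for x
  define \<gamma> where "\<gamma> x = det2 (q - p) (x - p) * ?D" for x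
  have D2: "?D * ?D = 1"
    using unimodularD(4)[OF uni] by (metis abs_mult_self_eq mult_1)
  have exp: "height x - height p = \<beta> x * (height q - height p) + \<gamma> x * (height r - height p)" for x
  proof -
    have "?D * (height x - height p) =
        det2 (x - p) (r - p) * (height q - height p) + det2 (q - p) (x - p) * (height r - height p)"
      by (simp add: height_def det2_def algebra_simps)
    then have "?D * (?D * (height x - height p)) =
        ?D * (det2 (x - p) (r - p) * (height q - height p) + det2 (q - p) (x - p) * (height r - height p))"
      by (simp only:)
    also have "\<dots> = \<beta> x * (height q - height p) + \<gamma> x * (height r - height p)"
      by (simp add: \<beta>_def \<gamma>_def algebra_simps)
    finally show ?thesis
      using D2 by (simp add: mult.assoc[symmetric])
  qed
  have \<gamma>I: "\<gamma> x \<in> \<int>" if "x \<in> lattice" for x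
    unfolding \<gamma>_def by (intro Ints_mult det2_Ints lattice_diff lattice_pqr that)
  have uv: "det2 (q - p) (u - p) * det2 (q - p) (v - p) < 0"
    using cross by (simp add: crosses_def)
  have "0 < \<gamma> v"
    using side by (simp add: \<gamma>_def mult.commute)
  moreover have "\<gamma> u < 0"
    using side uv by (auto simp: \<gamma>_def mult_less_0_iff zero_less_mult_iff)
  ultimately have g: "1 \<le> \<gamma> v" "\<gamma> u \<le> - 1"
    using \<gamma>I[OF lattice_uv(1)] \<gamma>I[OF lattice_uv(2)] by (auto elim!: Ints_cases)
  have eqv: "\<beta> v * (height q - height p) = - height p - \<gamma> v * (height r - height p)"
    and equ: "\<beta> u * (height q - height p) = - height p - \<gamma> u * (height r - height p)"
    using exp[of v] exp[of u] by simp_all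
  \<comment> \<open>Here \<open>x\<close> stands for the product of \<open>\<gamma>\<close> with a
    height difference, which keeps the four sign cases linear.\<close>
  have bounds: "b = - hp - x \<Longrightarrow> 1 * (hr - hp) \<le> x \<Longrightarrow> 0 < hr \<Longrightarrow> b < 0"
    "b = - hp - x \<Longrightarrow> x \<le> - 1 * (hr - hp) \<Longrightarrow> hp < 0 \<Longrightarrow> 0 < hr \<Longrightarrow> 0 < b"
    "b = - hp - x \<Longrightarrow> x \<le> 1 * (hr - hp) \<Longrightarrow> hr < 0 \<Longrightarrow> 0 < b"
    "b = - hp - x \<Longrightarrow> - 1 * (hr - hp) \<le> x \<Longrightarrow> 0 < hp \<Longrightarrow> hr < 0 \<Longrightarrow> b < 0"
    for b hp hr x :: real
    by (simp_all add: algebra_simps)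
  have "\<beta> u * \<beta> v < 0"
  proof (cases "height p < 0")
    case True
    then have pos: "height q > 0" "height r > 0"
      using height_pq pr by (auto simp: mult_less_0_iff)
    have "1 * (height r - height p) \<le> \<gamma> v * (height r - height p)"
      by (rule mult_right_mono) (use g True pos in auto)
    then have 1: "\<beta> v * (height q - height p) < 0"
      by (rule bounds(1)[OF eqv _ pos(2)])
    have "\<gamma> u * (height r - height p) \<le> - 1 * (height r - height p)"
      by (rule mult_right_mono) (use g True pos in auto)
    then have 2: "\<beta> u * (height q - height p) > 0"
      by (rule bounds(2)[OF equ _ True pos(2)])
    have "height q - height p > 0"
      using True pos by simp
    then show ?thesis
      using 1 2 by (simp add: mult_less_0_iff zero_less_mult_iff)
  next
    case False
    then have neg: "height p > 0" "height q < 0" "height r < 0"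
      using height_pq pr by (auto simp: mult_less_0_iff)
    have "\<gamma> v * (height r - height p) \<le> 1 * (height r - height p)"
      by (rule mult_right_mono_neg) (use g neg in auto)
    then have 1: "\<beta> v * (height q - height p) > 0"
      by (rule bounds(3)[OF eqv _ neg(3)])
    have "- 1 * (height r - height p) \<le> \<gamma> u * (height r - height p)"
      by (rule mult_right_mono_neg) (use g neg in auto)
    then have 2: "\<beta> u * (height q - height p) < 0"
      by (rule bounds(4)[OF equ _ neg(1,3)])
    have "height q - height p < 0"
      using neg by simp
    then show ?thesis
      using 1 2 by (simp add: mult_less_0_iff zero_less_mult_iff)
  qed
  moreover have "\<beta> x = - det2 (r - p) (x - p) * ?D" for x
    by (simp add: \<beta>_def det2_swap[of "r - p" "x - p"])
  then have "\<beta> u * \<beta> v = (det2 (r - p) (u - p) * det2 (r - p) (v - p)) * (?D * ?D)"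
    by simp
  ultimately have "det2 (r - p) (u - p) * det2 (r - p) (v - p) < 0"
    using D2 by simp
  then show ?thesis
    using pr by (simp add: crosses_def height_def)
qed

text \<open>With equal heights, \<open>q r\<close> would be parallel to \<open>u v\<close>, and both
  being primitive, \<open>v - u\<close> would be \<open>r - q\<close> up to sign. By unimodularity
  the heights of \<open>p\<close> and \<open>q\<close> would differ by exactly 1, but integers of
  opposite sign differ by at least 2.\<close>

lemma apex_height_neq: "height r \<noteq> height q"
proof
  assume eq: "height r = height q"
  have rq: "r - q \<noteq> 0"
    using nondeg.distinct(3)[OF unimodular_nondeg[OF uni]] by simp
  have "det2 (r - q) (v - u) = height q - height r"
    by (simp add: height_def det2_def algebra_simps)
  then obtain k where k: "v - u = k *\<^sub>R (r - q)"
    using det2_zeroD[of "r - q" "v - u"] eq rq by auto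
  have "u - v \<noteq> 0"
    using primitive_segmentD(3)[OF prim] by simp
  then have k0: "k \<noteq> 0"
    using k by (metis minus_diff_eq neg_equal_0_iff_equal scale_eq_0_iff)
  have uqr: "primitive_segment q r"
    using unimodular_primitive[OF unimodular_cycle[OF uni]] .
  have "q + k *\<^sub>R (r - q) = q + (v - u)"
    using k by simp
  then have "q + k *\<^sub>R (r - q) \<in> lattice"
    using lattice_add[OF lattice_pqr(2) lattice_diff[OF lattice_uv(2,1)]] by simp
  then have "k \<in> \<int>"
    by (rule primitive_segment_line[OF uqr])
  then obtain i where i: "k = of_int i"
    by (rule Ints_cases)
  have "u + (1 / k) *\<^sub>R (v - u) = u + (r - q)"
    unfolding k using k0 by simp
  then have "u + (1 / k) *\<^sub>R (v - u) \<in> lattice"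
    using lattice_add[OF lattice_uv(1) lattice_diff[OF lattice_pqr(3,2)]] by simp
  then have "1 / k \<in> \<int>"
    by (rule primitive_segment_line[OF prim])
  then obtain j where j: "1 / k = of_int j"
    by (rule Ints_cases)
  have "real_of_int (i * j) = of_int 1"
    using i j k0 by (metis nonzero_mult_div_cancel_left of_int_1 of_int_mult times_divide_eq_right mult_1_right)
  then have "i * j = 1"
    by (simp only: of_int_eq_iff)
  then have "\<bar>i\<bar> = 1"
    by (metis abs_mult abs_one abs_zmult_eq_1)
  then have "\<bar>k\<bar> = 1"
    using i by (metis of_int_1 of_int_abs)
  moreover have "height q - height p = k * det2 (r - q) (q - p)"
  proof -
    have "height q - height p = det2 (v - u) (q - p)"
      by (simp add: height_def det2_def algebra_simps)
    then show ?thesis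
      unfolding k by (simp add: det2_def algebra_simps)
  qed
  moreover have "\<bar>det2 (r - q) (q - p)\<bar> = 1"
  proof -
    have "det2 (r - q) (q - p) = - det2 (q - p) (r - p)"
      by (simp add: det2_def algebra_simps)
    then show ?thesis
      using unimodularD(4)[OF uni] by simp
  qed
  ultimately have "\<bar>height q - height p\<bar> = 1"
    by (simp add: abs_mult)
  then show False
    using height_pq height_Ints[OF lattice_pqr(1)] height_Ints[OF lattice_pqr(2)]
    by (auto elim!: Ints_cases simp: mult_less_0_iff abs_if split: if_splits)
qed

end

lemma crossed_apex_flip:
  assumes "crossed_apex p q r u v"
  shows "crossed_apex q p r u v"
proof -
  interpret crossed_apex p q r u v by (rule assms)
  show ?thesis
    using unimodular_flip[OF uni] prim crosses_sym[of p q u v] cross side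
    by (simp add: crossed_apex_def det2_flip[of p q])
qed

text \<open>An apex above \<open>q\<close> would make \<open>p r\<close> a crossing edge higher than
  \<open>p q\<close>, and one below \<open>p\<close> would do the same for \<open>q r\<close>.
  Equality is excluded by \<open>apex_height_neq\<close>.\<close>

lemma apex_between:
  assumes apex: "crossed_apex p q r u v"
    and H: "det2 (v - u) (p - u) < 0"
    and max: "\<And>a b. a \<in> {p, q} \<Longrightarrow> b = r \<Longrightarrow> crosses a b u v \<Longrightarrow>
      \<bar>det2 (v - u) (b - u) - det2 (v - u) (a - u)\<bar> \<le> \<bar>det2 (v - u) (q - u) - det2 (v - u) (p - u)\<bar>"
  shows "det2 (v - u) (p - u) < det2 (v - u) (r - u)" "det2 (v - u) (r - u) < det2 (v - u) (q - u)"
proof -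
  interpret crossed_apex p q r u v by (rule apex)
  interpret flip: crossed_apex q p r u v by (rule crossed_apex_flip[OF apex])
  have Hp: "height p < 0" and Hq: "height q > 0"
    using H height_pq by (auto simp: height_def mult_less_0_iff)
  have "height p < height r \<and> height r < height q"
  proof (cases "height r" "0 :: real" rule: linorder_cases)
    case greater
    then have "crosses p r u v"
      using Hp by (intro apex_crosses) (simp add: mult_less_0_iff)
    then have "\<bar>height r - height p\<bar> \<le> \<bar>height q - height p\<bar>"
      using max[of p r] by (simp add: height_def)
    then show ?thesis
      using greater Hp Hq apex_height_neq by linarith
  next
    case less
    then have "crosses q r u v"
      using Hq by (intro flip.apex_crosses) (simp add: mult_less_0_iff)
    then have "\<bar>height r - height q\<bar> \<le> \<bar>height q - height p\<bar>"
      using max[of q r] by (simp add: height_def)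
    then show ?thesis
      using less Hp Hq flip.apex_height_neq by linarith
  next
    case equal
    then show ?thesis using Hp Hq by simp
  qed
  then show "det2 (v - u) (p - u) < det2 (v - u) (r - u)" "det2 (v - u) (r - u) < det2 (v - u) (q - u)"
    by (simp_all add: height_def)
qed

text \<open>The hypothesis says that \<open>p q\<close> and \<open>r s\<close> are the diagonals of
  a parallelogram. The end of the first diagonal with the smaller weight can be eliminated by
  expressing it through the other three vertices.\<close>

lemma parallelogram_hull:
  assumes "r + s = p + (q :: point)"
  shows "convex hull {p, q, r} \<subseteq> convex hull {p, r, s} \<union> convex hull {q, r, s}"
proof
  fix x assume "x \<in> convex hull {p, q, r}"
  then obtain a b c where x: "0 \<le> a" "0 \<le> b" "0 \<le> c" "a + b + c = 1" "x = a *\<^sub>R p + b *\<^sub>R q + c *\<^sub>R r"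
    by (auto simp: convex_hull_3)
  have q: "q = r + s - p" and p: "p = r + s - q"
    using assms by (simp_all add: algebra_simps)
  show "x \<in> convex hull {p, r, s} \<union> convex hull {q, r, s}"
  proof (cases "b \<le> a")
    case True
    have "x = (a - b) *\<^sub>R p + (b + c) *\<^sub>R r + b *\<^sub>R s"
      unfolding x(5) q by (simp add: algebra_simps)
    moreover have "(a - b) + (b + c) + b = 1" "0 \<le> a - b" "0 \<le> b + c"
      using x True by simp_all
    ultimately have "x \<in> convex hull {p, r, s}"
      unfolding convex_hull_3 using x(2) by blast
    then show ?thesis ..
  next
    case False
    have "x = (b - a) *\<^sub>R q + (a + c) *\<^sub>R r + a *\<^sub>R s"
      unfolding x(5) p by (simp add: algebra_simps)
    moreover have "(b - a) + (a + c) + a = 1" "0 \<le> b - a" "0 \<le> a + c"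
      using x False by simp_all
    ultimately have "x \<in> convex hull {q, r, s}"
      unfolding convex_hull_3 using x(1) by blast
    then show ?thesis ..
  qed
qed

definition tri_edge :: "point set set \<Rightarrow> point \<Rightarrow> point \<Rightarrow> bool"
  where "tri_edge \<A> p q \<longleftrightarrow> p \<noteq> q \<and> (\<exists>A\<in>\<A>. p \<in> A \<and> q \<in> A)"

lemma tri_edge_sym: "tri_edge \<A> p q \<longleftrightarrow> tri_edge \<A> q p"
  by (auto simp: tri_edge_def)

section \<open>Triangles along a segment, and the flip\<close>

context unimodular_triangulation
begin

text \<open>Finitely many triangles cover the open segment, so its end \<open>y\<close> is in the
  closure of the part inside a single one of them.\<close>

lemma ray_triangle:
  assumes "y \<noteq> z" "closed_segment y z \<subseteq> Q"
  obtains A t where "A \<in> tris" "y \<in> convex hull A" "0 < t" "t < 1" "y + t *\<^sub>R (z - y) \<in> convex hull A"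
proof -
  have "open_segment y z \<subseteq> (\<Union>A\<in>tris. convex hull A \<inter> open_segment y z)"
    using assms(2) segment_open_subset_closed cover by blast
  also have "\<dots> \<subseteq> (\<Union>A\<in>tris. closure (convex hull A \<inter> open_segment y z))"
    by (intro UN_mono subset_refl closure_subset)
  finally have "closure (open_segment y z) \<subseteq> (\<Union>A\<in>tris. closure (convex hull A \<inter> open_segment y z))"
    using fin by (intro closure_minimal closed_UN) auto
  then have "y \<in> (\<Union>A\<in>tris. closure (convex hull A \<inter> open_segment y z))"
    using assms(1) by auto
  then obtain A where A: "A \<in> tris" "y \<in> closure (convex hull A \<inter> open_segment y z)"
    by blast
  have "closure (convex hull A \<inter> open_segment y z) \<subseteq> convex hull A"
    by (intro closure_minimal hull_closed[OF A(1)]) blast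
  then have "y \<in> convex hull A"
    using A(2) by blast
  moreover have "convex hull A \<inter> open_segment y z \<noteq> {}"
    using A(2) by (metis closure_empty empty_iff)
  then obtain w where "w \<in> convex hull A" "w \<in> open_segment y z"
    by blast
  then obtain t where "0 < t" "t < 1" "w = (1 - t) *\<^sub>R y + t *\<^sub>R z" "w \<in> convex hull A"
    unfolding in_segment by blast
  moreover have "(1 - t) *\<^sub>R y + t *\<^sub>R z = y + t *\<^sub>R (z - y)" for t
    by (simp add: algebra_simps)
  ultimately show ?thesis
    using that A(1) by metis
qed

text \<open>In a triangle at \<open>u\<close> into which the segment runs, \<open>v - u\<close>
  combines the two edge vectors with nonnegative integer coefficients. If both are positive, their
  sum is at least 2 and \<open>v\<close> lies beyond the opposite side, which is then crossed. If
  one vanishes, primitivity makes \<open>v\<close> a vertex of the triangle.\<close>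

lemma visible_edge:
  assumes prim_uv: "primitive_segment u v" and sub: "closed_segment u v \<subseteq> Q"
    and nc: "\<And>p q. tri_edge tris p q \<Longrightarrow> \<not> crosses p q u v"
  shows "tri_edge tris u v"
proof -
  note L = primitive_segmentD[OF prim_uv]
  obtain A t where A: "A \<in> tris" "u \<in> convex hull A" "0 < t" "t < 1" "u + t *\<^sub>R (v - u) \<in> convex hull A"
    using ray_triangle[OF L(3) sub] .
  have uA: "u \<in> A"
    using A(2) L(1) hull_lattice[OF A(1)] by blast
  obtain a b c where "A = {a, b, c}" "unimodular a b c"
    using unimod[OF A(1)] by blast
  then have "\<exists>q\<in>A. q \<noteq> u"
    using nondeg.distinct(1)[OF unimodular_nondeg] by (metis insertCI)
  then obtain b where b: "b \<in> A" "u \<noteq> b"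
    by blast
  obtain c where Ac: "A = {u, b, c}" and uni: "unimodular u b c"
    using triE[OF A(1) uA b] .
  interpret nondeg u b c by (rule unimodular_nondeg[OF uni])
  interpret n1: nondeg b c u by (rule nondeg_cycle)
  interpret n2: nondeg c u b by (rule n1.nondeg_cycle)
  let ?D = "det2 (b - u) (c - u)"
  define \<beta> where "\<beta> = det2 (v - u) (c - u) * ?D"
  define \<gamma> where "\<gamma> = det2 (b - u) (v - u) * ?D"
  have D2: "?D * ?D = 1"
    using unimodularD(4)[OF uni] by (metis abs_mult_self_eq mult_1)
  have Dinv: "x / ?D = x * ?D" for x
    using D2 nondeg by (simp add: field_simps)
  have LL: "b \<in> lattice" "c \<in> lattice"
    using unimodularD[OF uni] by blast+
  have "\<beta> \<in> \<int>" "\<gamma> \<in> \<int>"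
    unfolding \<beta>_def \<gamma>_def by (intro Ints_mult det2_Ints lattice_diff L LL)+
  then obtain i j where ij: "\<beta> = of_int i" "\<gamma> = of_int j"
    by (metis Ints_cases)
  have "?D *\<^sub>R (v - u) = det2 (v - u) (c - u) *\<^sub>R (b - u) + det2 (b - u) (v - u) *\<^sub>R (c - u)"
    by (simp add: det2_def prod_eq_iff algebra_simps)
  then have "?D *\<^sub>R (?D *\<^sub>R (v - u)) = \<beta> *\<^sub>R (b - u) + \<gamma> *\<^sub>R (c - u)"
    by (simp add: \<beta>_def \<gamma>_def scaleR_add_right mult.commute)
  then have d: "v - u = \<beta> *\<^sub>R (b - u) + \<gamma> *\<^sub>R (c - u)"
    using D2 by simp
  have "bary u b c (u + t *\<^sub>R (v - u)) = t * \<gamma>"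
    unfolding bary_add \<gamma>_def by (simp add: Dinv)
  then have "0 \<le> t * \<gamma>"
    using A(5) unfolding Ac mem_hull by simp
  then have g0: "0 \<le> \<gamma>"
    using A(3) by (simp add: zero_le_mult_iff)
  have "bary c u b (u + t *\<^sub>R (v - u)) = t * (det2 (u - c) (v - u) / det2 (u - c) (b - c))"
    unfolding n2.bary_add by simp
  moreover have "det2 (u - c) (v - u) = det2 (v - u) (c - u)"
    by (simp add: det2_def algebra_simps)
  moreover have "det2 (u - c) (b - c) = ?D"
    by (simp add: det2_def algebra_simps)
  ultimately have "bary c u b (u + t *\<^sub>R (v - u)) = t * \<beta>"
    by (simp add: \<beta>_def Dinv)
  then have "0 \<le> t * \<beta>"
    using A(5) unfolding Ac mem_hull by simp
  then have b0: "0 \<le> \<beta>"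
    using A(3) by (simp add: zero_le_mult_iff)
  have on_edge: "tri_edge tris u v" if w: "w \<in> A" "w \<noteq> u" "w \<in> lattice" "v - u = of_int k *\<^sub>R (w - u)" "0 \<le> k" for w and k :: int
  proof -
    have "k \<noteq> 0"
      using w(4) L(3) by auto
    then have k1: "1 \<le> real_of_int k"
      using w(5) by simp
    have "w = u + (1 / real_of_int k) *\<^sub>R (v - u)"
      unfolding w(4) using k1 by simp
    moreover have "\<dots> = (1 - 1 / real_of_int k) *\<^sub>R u + (1 / real_of_int k) *\<^sub>R v"
      by (simp add: algebra_simps)
    ultimately have "w \<in> closed_segment u v"
      unfolding in_segment using k1 by (intro exI[of _ "1 / real_of_int k"]) simp
    then have "w \<in> {u, v}"
      using w(3) L(4) by blast
    then have "w = v"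
      using w(2) by blast
    then show ?thesis
      unfolding tri_edge_def using uA A(1) w(1) L(3) by blast
  qed
  have cA: "c \<in> A" "b \<in> A"
    unfolding Ac by blast+
  have "0 \<le> i" "0 \<le> j"
    using b0 g0 ij by simp_all
  then consider "j = 0" | "i = 0" | "1 \<le> i" "1 \<le> j"
    by linarith
  then consider "\<gamma> = 0" | "\<beta> = 0" | "1 \<le> \<beta>" "1 \<le> \<gamma>"
    by cases (simp_all add: ij)
  then show ?thesis
  proof cases
    case 1
    then have "v - u = of_int i *\<^sub>R (b - u)"
      using d ij by simp
    moreover have "0 \<le> i"
      using b0 ij by simp
    ultimately show ?thesis
      using on_edge[OF cA(2) _ LL(1)] b(2) by metis
  next
    case 2
    then have "v - u = of_int j *\<^sub>R (c - u)"
      using d ij by simp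
    moreover have "0 \<le> j"
      using g0 ij by simp
    ultimately show ?thesis
      using on_edge[OF cA(1) _ LL(2)] distinct(2) by metis
  next
    case 3
    have e1: "det2 (v - u) (b - u) = - (\<gamma> * ?D)"
      unfolding d by (simp add: det2_def algebra_simps)
    have e2: "det2 (v - u) (c - u) = \<beta> * ?D"
      unfolding d by (simp add: det2_def algebra_simps)
    have e3: "det2 (c - b) (u - b) = ?D"
      by (simp add: det2_def algebra_simps)
    have "det2 (c - b) (v - b) = det2 (c - b) (u - b) + det2 (c - b) (v - u)"
      by (simp add: det2_def algebra_simps)
    also have "det2 (c - b) (v - u) = - ((\<beta> + \<gamma>) * ?D)"
      unfolding d by (simp add: det2_def algebra_simps)
    finally have e4: "det2 (c - b) (v - b) = (1 - \<beta> - \<gamma>) * ?D"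
      unfolding e3 by (simp add: algebra_simps)
    have "det2 (v - u) (b - u) * det2 (v - u) (c - u) = - (\<beta> * \<gamma>) * (?D * ?D)"
      unfolding e1 e2 by (simp add: algebra_simps)
    then have "det2 (v - u) (b - u) * det2 (v - u) (c - u) < 0"
      using 3 D2 by simp
    moreover have "det2 (c - b) (u - b) * det2 (c - b) (v - b) = (1 - \<beta> - \<gamma>) * (?D * ?D)"
      unfolding e3 e4 by (simp add: algebra_simps)
    then have "det2 (c - b) (u - b) * det2 (c - b) (v - b) < 0"
      using 3 D2 by simp
    ultimately have "crosses b c u v"
      by (simp add: crosses_def)
    moreover have "tri_edge tris b c"
      unfolding tri_edge_def using cA A(1) distinct(3) by blast
    ultimately show ?thesis
      using nc by blast
  qed
qed

text \<open>Start at the crossing point and move towards \<open>v\<close>. The triangle entered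
  contains a nonlattice point of \<open>p q\<close>, hence the whole edge, and its third vertex is
  on the side of \<open>v\<close>.\<close>

lemma crossing_apex:
  assumes prim_uv: "primitive_segment u v" and sub: "closed_segment u v \<subseteq> Q"
    and pq: "tri_edge tris p q" and cr: "crosses p q u v"
  obtains r where "{p, q, r} \<in> tris" "crossed_apex p q r u v"
proof -
  obtain y \<mu> \<nu> where y: "y = p + \<mu> *\<^sub>R (q - p)" "0 < \<mu>" "\<mu> < 1" "y = u + \<nu> *\<^sub>R (v - u)" "0 < \<nu>" "\<nu> < 1"
    using crosses_point[OF cr] .
  obtain A0 where A0: "A0 \<in> tris" "p \<in> A0" "q \<in> A0" "p \<noteq> q"
    using pq unfolding tri_edge_def by blast
  note P = prim[OF A0]
  have ypq: "y \<in> closed_segment p q"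
    unfolding in_segment using y(1,2,3) by (intro exI[of _ \<mu>]) (simp add: algebra_simps)
  have "y \<notin> lattice"
  proof
    assume "y \<in> lattice"
    then have "\<mu> \<in> \<int>"
      using primitive_segment_line[OF P] y(1) by simp
    then show False
      using y(2,3) by (auto elim!: Ints_cases)
  qed
  have yuv: "y \<in> closed_segment u v"
    unfolding in_segment using y(4,5,6) by (intro exI[of _ \<nu>]) (simp add: algebra_simps)
  then have "closed_segment y v \<subseteq> Q"
    using sub by (meson closed_segment_subset convex_closed_segment ends_in_segment(2) order_trans)
  moreover have "y \<noteq> v"
    using \<open>y \<notin> lattice\<close> primitive_segmentD(2)[OF prim_uv] by blast
  ultimately obtain A t where A: "A \<in> tris" "y \<in> convex hull A" "0 < t" "t < 1" "y + t *\<^sub>R (v - y) \<in> convex hull A"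
    using ray_triangle by blast
  have "{p, q} \<subseteq> A0"
    using A0 by blast
  then have "convex hull {p, q} \<inter> convex hull A = convex hull ({p, q} \<inter> A)"
    using hull_inter[OF A0(1) A(1) _ subset_refl] by blast
  then have yh: "y \<in> convex hull ({p, q} \<inter> A)"
    using ypq A(2) unfolding segment_convex_hull by blast
  have pqA: "p \<in> A \<and> q \<in> A"
  proof (rule ccontr)
    assume "\<not> (p \<in> A \<and> q \<in> A)"
    then have "{p, q} \<inter> A \<subseteq> {p} \<or> {p, q} \<inter> A \<subseteq> {q}"
      by blast
    then have "y \<in> convex hull {p} \<or> y \<in> convex hull {q}"
      using yh hull_mono by blast
    then have "y \<in> A0"
      using A0 by auto
    then show False
      using tri_lattice[OF A0(1)] \<open>y \<notin> lattice\<close> by blast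
  qed
  obtain r where Ar: "A = {p, q, r}" and uni: "unimodular p q r"
    using triE[OF A(1)] pqA A0(4) by blast
  interpret nondeg p q r by (rule unimodular_nondeg[OF uni])
  have "bary p q r (y + t *\<^sub>R (v - y)) = t * (det2 (q - p) (v - y) / det2 (q - p) (r - p))"
    unfolding bary_add using bary_segment[OF ypq] by simp
  moreover have "det2 (q - p) (v - y) = det2 (q - p) (v - p)"
    unfolding y(1) by (simp add: det2_def algebra_simps)
  moreover have "0 \<le> bary p q r (y + t *\<^sub>R (v - y))"
    using A(5) unfolding Ar mem_hull by blast
  ultimately have "0 \<le> t * (det2 (q - p) (v - p) / det2 (q - p) (r - p))"
    by simp
  then have "0 \<le> det2 (q - p) (v - p) / det2 (q - p) (r - p)"
    using A(3) by (simp only: zero_le_mult_iff) auto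
  moreover have "det2 (q - p) (v - p) \<noteq> 0"
    using cr by (auto simp: crosses_def)
  ultimately have "det2 (q - p) (r - p) * det2 (q - p) (v - p) > 0"
    using nondeg by (auto simp: zero_le_divide_iff zero_less_mult_iff)
  then have "crossed_apex p q r u v"
    using uni prim_uv cr by (simp add: crossed_apex_def)
  then show ?thesis
    using that A(1) Ar by blast
qed

text \<open>The two triangles form a parallelogram, and its other diagonal cuts it into unimodular
  triangles as well.\<close>

lemma flip:
  assumes A: "{p, q, r} \<in> tris" and B: "{p, q, s} \<in> tris" and rs: "r \<noteq> s" "r + s = p + q"
    and uni: "unimodular p q r"
  shows "unimodular_triangulation Q (tris - {{p, q, r}, {p, q, s}} \<union> {{p, r, s}, {q, r, s}})"
proof
  let ?N = "{{p, r, s}, {q, r, s}}"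
  let ?O = "tris - {{p, q, r}, {p, q, s}}"
  have s: "s = p + q - r" and q: "q = r + s - p"
    using rs(2) by (simp_all add: algebra_simps)
  note L = unimodularD[OF uni]
  have sL: "s \<in> lattice"
    unfolding s by (intro lattice_diff lattice_add L)
  have d1: "det2 (r - p) (s - p) = - det2 (q - p) (r - p)"
    unfolding s by (simp add: det2_def algebra_simps)
  have u1: "unimodular p r s"
    unfolding unimodular_def d1 abs_minus_cancel using L sL by (intro conjI)
  have d2: "det2 (r - q) (s - q) = det2 (q - p) (r - p)"
    unfolding s by (simp add: det2_def algebra_simps)
  have u2: "unimodular q r s"
    unfolding unimodular_def d2 using L sL by (intro conjI)
  show "finite (?O \<union> ?N)"
    using fin by simp
  show "\<exists>a b c. C = {a, b, c} \<and> unimodular a b c" if "C \<in> ?O \<union> ?N" for C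
    using that unimod u1 u2 by blast
  have perm: "{p, r, s} = {r, s, p}" "{q, r, s} = {r, s, q}" "{p, q, r} = {q, p, r}" "{r, s, p} = {s, r, p}"
     "{r, s, q} = {s, r, q}" "{r, p, q} = {p, q, r}" "{s, p, q} = {p, q, s}"
    by blast+
  have H: "convex hull {p, q, r} \<union> convex hull {p, q, s} = convex hull {p, r, s} \<union> convex hull {q, r, s}"
  proof
    have 1: "convex hull {p, q, r} \<subseteq> convex hull {p, r, s} \<union> convex hull {q, r, s}"
      by (rule parallelogram_hull[OF rs(2)])
    have "s + r = p + q"
      using rs(2) by (simp add: add.commute)
    then have "convex hull {p, q, s} \<subseteq> convex hull {p, s, r} \<union> convex hull {q, s, r}"
      by (rule parallelogram_hull)
    then have 2: "convex hull {p, q, s} \<subseteq> convex hull {p, r, s} \<union> convex hull {q, r, s}"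
      by (simp only: insert_commute)
    show "convex hull {p, q, r} \<union> convex hull {p, q, s} \<subseteq> convex hull {p, r, s} \<union> convex hull {q, r, s}"
      using 1 2 by blast
    have "convex hull {r, s, p} \<subseteq> convex hull {r, p, q} \<union> convex hull {s, p, q}"
      by (rule parallelogram_hull[OF rs(2)[symmetric]])
    then have 3: "convex hull {p, r, s} \<subseteq> convex hull {p, q, r} \<union> convex hull {p, q, s}"
      unfolding perm(1,6,7) .
    have "q + p = r + s"
      using rs(2) by (simp add: add.commute)
    then have "convex hull {r, s, q} \<subseteq> convex hull {r, q, p} \<union> convex hull {s, q, p}"
      by (rule parallelogram_hull)
    moreover have "{r, q, p} = {p, q, r}" "{s, q, p} = {p, q, s}"
      by blast+
    ultimately have 4: "convex hull {q, r, s} \<subseteq> convex hull {p, q, r} \<union> convex hull {p, q, s}"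
      unfolding perm(2) by simp
    show "convex hull {p, r, s} \<union> convex hull {q, r, s} \<subseteq> convex hull {p, q, r} \<union> convex hull {p, q, s}"
      using 3 4 by blast
  qed
  have "(\<Union>C\<in>tris. convex hull C) = (\<Union>C\<in>?O. convex hull C) \<union> (convex hull {p, q, r} \<union> convex hull {p, q, s})"
    using A B by blast
  then show "(\<Union>C\<in>?O \<union> ?N. convex hull C) = Q"
    unfolding H using cover by auto
  \<comment> \<open>An open set inside the union of two triangles but disjoint from both interiors
    is empty: removing one closed triangle leaves an open subset of the other.\<close>
  have old: "interior (convex hull N) \<inter> interior (convex hull C) = {}" if N: "N \<in> ?N" and C: "C \<in> ?O" for N C
  proof -
    let ?I = "interior (convex hull N) \<inter> interior (convex hull C)"
    have op: "open ?I" by (intro open_Int open_interior)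
    have sub: "?I \<subseteq> convex hull {p, q, r} \<union> convex hull {p, q, s}"
      unfolding H using N interior_subset[of "convex hull N"] by blast
    have dA: "?I \<inter> interior (convex hull {p, q, r}) = {}" and dB: "?I \<inter> interior (convex hull {p, q, s}) = {}"
      using disj[of C "{p, q, r}"] disj[of C "{p, q, s}"] A B C by blast+
    have "open (?I - convex hull {p, q, s})"
      using op hull_closed[OF B] by (rule open_Diff)
    moreover have "?I - convex hull {p, q, s} \<subseteq> convex hull {p, q, r}"
      using sub by blast
    ultimately have "?I - convex hull {p, q, s} \<subseteq> interior (convex hull {p, q, r})"
      by (rule interior_maximal[rotated])
    then have "?I \<subseteq> convex hull {p, q, s}"
      using dA by blast
    then have "?I \<subseteq> interior (convex hull {p, q, s})"
      using op by (rule interior_maximal)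
    then show ?thesis
      using dB by blast
  qed
  have new: "interior (convex hull {p, r, s}) \<inter> interior (convex hull {q, r, s}) = {}"
  proof -
    interpret n1: nondeg r s p by (rule unimodular_nondeg[OF unimodular_cycle[OF u1]])
    interpret n2: nondeg r s q by (rule unimodular_nondeg[OF unimodular_cycle[OF u2]])
    have "det2 (s - r) (q - r) = - det2 (s - r) (p - r)"
      unfolding q by (simp add: det2_def algebra_simps)
    then have "bary r s q x = - bary r s p x" for x
      by (simp add: bary_def)
    then show ?thesis
      unfolding perm(1,2) using n1.mem_interior n2.mem_interior by force
  qed
  show "interior (convex hull C) \<inter> interior (convex hull D) = {}"
    if C: "C \<in> ?O \<union> ?N" and D: "D \<in> ?O \<union> ?N" and CD: "C \<noteq> D" for C D
  proof -
    show ?thesis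
    proof (rule UnE[OF C]; rule UnE[OF D])
      assume "C \<in> ?O" "D \<in> ?O"
      then show ?thesis using disj[OF _ _ CD] by (metis DiffD1)
    next
      assume "C \<in> ?O" "D \<in> ?N"
      then show ?thesis using old by (metis Int_commute)
    next
      assume "C \<in> ?N" "D \<in> ?O"
      then show ?thesis by (rule old)
    next
      assume "C \<in> ?N" "D \<in> ?N"
      then have "C = {p, r, s} \<and> D = {q, r, s} \<or> C = {q, r, s} \<and> D = {p, r, s}"
        using CD by blast
      then show ?thesis
        using new by blast
    qed
  qed
qed

end

section \<open>Flipping away all crossings with a segment\<close>

lemma crosses_rev: "crosses p q v u \<longleftrightarrow> crosses p q u v"
  by (metis crosses_commute crosses_sym)

definition crossing_edges :: "point set set \<Rightarrow> point \<Rightarrow> point \<Rightarrow> (point \<times> point) set"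
  where "crossing_edges \<A> u v = {(p, q). tri_edge \<A> p q \<and> crosses p q u v}"

text \<open>For lattice points the determinant is an integer, so the floor loses nothing; natural
  numbers serve for induction on the total.\<close>

definition edge_height :: "point \<Rightarrow> point \<Rightarrow> point \<times> point \<Rightarrow> nat"
  where "edge_height u v e = nat \<lfloor>\<bar>det2 (v - u) (snd e - fst e)\<bar>\<rfloor>"

text \<open>Flipping a highest crossing edge decreases the total height of the crossing edges.\<close>

lemma flip_step:
  assumes T: "unimodular_triangulation Q \<A>"
    and prim_uv: "primitive_segment u v" and sub: "closed_segment u v \<subseteq> Q"
    and ne: "crossing_edges \<A> u v \<noteq> {}"
  obtains \<B> where "unimodular_triangulation Q \<B>"
    "sum (edge_height u v) (crossing_edges \<B> u v) < sum (edge_height u v) (crossing_edges \<A> u v)"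
    "\<And>a b. tri_edge \<A> a b \<Longrightarrow> \<not> crosses a b u v \<Longrightarrow> tri_edge \<B> a b"
proof -
  interpret unimodular_triangulation Q \<A> by (rule T)
  define H where "H x = det2 (v - u) (x - u)" for x
  have det_H: "det2 (v - u) (y - x) = H y - H x" for x y
    by (simp add: H_def det2_def algebra_simps)
  have det_H': "det2 (u - v) (x - v) = - H x" for x
    by (simp add: H_def det2_def algebra_simps)
  have H_Ints: "H x \<in> \<int>" if "x \<in> lattice" for x
    unfolding H_def by (intro det2_Ints lattice_diff primitive_segmentD[OF prim_uv] that)
  have "crossing_edges \<A> u v \<subseteq> \<Union>\<A> \<times> \<Union>\<A>"
    by (auto simp: crossing_edges_def tri_edge_def)
  moreover have "finite (\<Union>\<A>)"
    using fin tri_finite by blast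
  ultimately have finX: "finite (crossing_edges \<A> u v)"
    by (meson finite_SigmaI finite_subset)
  define h where "h e = \<bar>H (snd e) - H (fst e)\<bar>" for e :: "point \<times> point"
  have "Max (h ` crossing_edges \<A> u v) \<in> h ` crossing_edges \<A> u v"
    using finX ne by (intro Max_in) auto
  then obtain e where e: "e \<in> crossing_edges \<A> u v" "h e = Max (h ` crossing_edges \<A> u v)"
    by auto
  have emax: "h e' \<le> h e" if "e' \<in> crossing_edges \<A> u v" for e'
    unfolding e(2) using finX that by (intro Max_ge) auto
  have swap: "(q, p) \<in> crossing_edges \<A> u v" if "(p, q) \<in> crossing_edges \<A> u v" for p q
    using that tri_edge_sym[of \<A> p q] crosses_sym[of p q u v] by (simp add: crossing_edges_def)
  \<comment> \<open>Orients a highest crossing edge so that \<open>p\<close> is below and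
    \<open>q\<close> above the line \<open>u v\<close>.\<close>
  obtain p q where pqX: "(p, q) \<in> crossing_edges \<A> u v" and Hp: "H p < 0"
    and max: "\<And>a b. tri_edge \<A> a b \<Longrightarrow> crosses a b u v \<Longrightarrow> \<bar>H b - H a\<bar> \<le> \<bar>H q - H p\<bar>"
  proof -
    obtain p q where pq: "e = (p, q)"
      by (cases e)
    have m: "\<bar>H b - H a\<bar> \<le> \<bar>H q - H p\<bar>" if "tri_edge \<A> a b" "crosses a b u v" for a b
      using emax[of "(a, b)"] that by (simp add: h_def pq crossing_edges_def)
    have "H p * H q < 0"
      using e(1) by (simp add: pq crossing_edges_def crosses_def H_def)
    then consider "H p < 0" | "H q < 0"
      by (auto simp: mult_less_0_iff)
    then show ?thesis
    proof cases
      case 1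
      then show ?thesis using that[of p q] e(1) m pq by simp
    next
      case 2
      then show ?thesis using that[of q p] swap[of p q] e(1) m pq by (simp add: abs_minus_commute)
    qed
  qed
  have pq: "tri_edge \<A> p q" and cr: "crosses p q u v"
    using pqX by (simp_all add: crossing_edges_def)
  have pq_ne: "p \<noteq> q"
    using pq by (simp add: tri_edge_def)
  have "H p * H q < 0"
    using cr by (simp add: crosses_def H_def)
  then have Hq: "0 < H q"
    using Hp by (simp add: mult_less_0_iff)
  obtain r where r: "{p, q, r} \<in> \<A>" and ar: "crossed_apex p q r u v"
    using crossing_apex[OF prim_uv sub pq cr] .
  have sub': "closed_segment v u \<subseteq> Q" and cr': "crosses p q v u"
    using sub cr by (simp_all add: closed_segment_commute crosses_rev)
  \<comment> \<open>The apex on the side of \<open>u\<close>, obtained by reversing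
    \<open>u v\<close>. Reversal changes the sign of all heights, whence the signs in
    \<open>Hs\<close>.\<close>
  obtain s where s: "{p, q, s} \<in> \<A>" and as: "crossed_apex p q s v u"
    using crossing_apex[OF primitive_segment_sym[OF prim_uv] sub' pq cr'] .
  note uni_r = crossed_apex.uni[OF ar] and uni_s = crossed_apex.uni[OF as]
  note dist_r = nondeg.distinct[OF unimodular_nondeg[OF uni_r]]
    and dist_s = nondeg.distinct[OF unimodular_nondeg[OF uni_s]]
  have er: "tri_edge \<A> a r" if "a \<in> {p, q}" for a
  proof -
    have "a \<in> {p, q, r}" "r \<in> {p, q, r}" "a \<noteq> r"
      using that dist_r by auto
    then show ?thesis
      unfolding tri_edge_def using r by metis
  qed
  have es: "tri_edge \<A> a s" if "a \<in> {q, p}" for a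
  proof -
    have "a \<in> {p, q, s}" "s \<in> {p, q, s}" "a \<noteq> s"
      using that dist_s by auto
    then show ?thesis
      unfolding tri_edge_def using s by metis
  qed
  have Hr: "H p < H r" "H r < H q"
  proof -
    have "\<bar>det2 (v - u) (b - u) - det2 (v - u) (a - u)\<bar> \<le> \<bar>det2 (v - u) (q - u) - det2 (v - u) (p - u)\<bar>"
      if "a \<in> {p, q}" "b = r" "crosses a b u v" for a b
      using max[of a b] er[OF that(1)] that(2,3) unfolding H_def by simp
    then show "H p < H r" "H r < H q"
      using apex_between[OF ar Hp[unfolded H_def]] unfolding H_def by blast+
  qed
  have Hs: "- H q < - H s" "- H s < - H p"
  proof -
    have m: "\<bar>det2 (u - v) (b - v) - det2 (u - v) (a - v)\<bar> \<le> \<bar>det2 (u - v) (p - v) - det2 (u - v) (q - v)\<bar>"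
      if "a \<in> {q, p}" "b = s" "crosses a b v u" for a b
    proof -
      have "\<bar>H b - H a\<bar> \<le> \<bar>H q - H p\<bar>"
        using max[of a b] es[OF that(1)] that(2,3) by (simp add: crosses_rev)
      then show ?thesis
        unfolding det_H' by linarith
    qed
    have n: "det2 (u - v) (q - v) < 0"
      unfolding det_H' using Hq by simp
    show "- H q < - H s" "- H s < - H p"
      using apex_between[OF crossed_apex_flip[OF as] n m] unfolding det_H' by blast+
  qed
  define K where "K x = det2 (q - p) (x - p)" for x
  have Kr: "K r * K v > 0" and Ks: "K s * K u > 0"
    using crossed_apex.side[OF ar] crossed_apex.side[OF as] by (simp_all add: K_def)
  have Kuv: "K u * K v < 0"
    using cr by (simp add: crosses_def K_def)
  \<comment> \<open>Both values are 1 or -1 by unimodularity, with opposite signs because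
    \<open>u\<close> and \<open>v\<close> are separated by the line \<open>p q\<close>. So
    \<open>r + s - 2 p\<close> is an integer multiple \<open>k\<close> of
    \<open>q - p\<close>.\<close>
  have "K r + K s = 0"
    using unimodularD(4)[OF uni_r] unimodularD(4)[OF uni_s] Kr Ks Kuv unfolding K_def[symmetric]
    by (auto simp: abs_if zero_less_mult_iff mult_less_0_iff split: if_splits)
  moreover have "det2 (q - p) (r + s - p - p) = K r + K s"
    by (simp add: K_def det2_def algebra_simps)
  moreover have "q - p \<noteq> 0"
    using pq_ne by simp
  ultimately obtain k where k: "r + s - p - p = k *\<^sub>R (q - p)"
    using det2_zeroD[of "q - p" "r + s - p - p"] by auto
  have "p + k *\<^sub>R (q - p) = r + s - p"
    unfolding k[symmetric] by simp
  then have "p + k *\<^sub>R (q - p) \<in> lattice"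
    using lattice_diff[OF lattice_add[OF unimodularD(3)[OF uni_r] unimodularD(3)[OF uni_s]] unimodularD(1)[OF uni_r]]
    by simp
  then have "k \<in> \<int>"
    by (rule primitive_segment_line[OF unimodular_primitive[OF uni_r]])
  then obtain i where i: "k = of_int i"
    by (rule Ints_cases)
  have "H r + H s - H p - H p = det2 (v - u) (r + s - p - p)"
    by (simp add: H_def det2_def algebra_simps)
  also have "\<dots> = k * (H q - H p)"
    unfolding k by (simp add: H_def det2_def algebra_simps)
  finally have Hk: "k * (H q - H p) = H r + H s - H p - H p"
    by simp
  have pos: "0 < H q - H p"
    using Hp Hq by simp
  \<comment> \<open>Both apexes have heights strictly between those of \<open>p\<close> and
    \<open>q\<close>. This puts \<open>k\<close> strictly between 0 and 2, and \<open>k = 1\<close>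
    is the parallelogram condition.\<close>
  have "0 < k * (H q - H p)" "k * (H q - H p) < 2 * (H q - H p)"
    unfolding Hk using Hr Hs by simp_all
  then have "0 < k" "k < 2"
    using pos mult_less_cancel_right_pos[OF pos, of k 2] mult_less_cancel_right_pos[OF pos, of 0 k] by simp_all
  then have "k = 1"
    using i by simp
  then have rs: "r + s = p + q"
    using k by (simp add: algebra_simps)
  have rs_ne: "r \<noteq> s"
    using Kr Ks Kuv by (auto simp: zero_less_mult_iff mult_less_0_iff)
  define \<B> where "\<B> = \<A> - {{p, q, r}, {p, q, s}} \<union> {{p, r, s}, {q, r, s}}"
  have TB: "unimodular_triangulation Q \<B>"
    unfolding \<B>_def by (rule flip[OF r s rs_ne rs uni_r])
  interpret B: unimodular_triangulation Q \<B> by (rule TB)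
  \<comment> \<open>The diagonals share their midpoint but no end, so they cannot both be edges of
    one triangulation.\<close>
  have pqB: "\<not> tri_edge \<B> p q"
  proof
    assume "tri_edge \<B> p q"
    then obtain C where C: "C \<in> \<B>" "{p, q} \<subseteq> C"
      unfolding tri_edge_def by blast
    have D: "{p, r, s} \<in> \<B>" "{r, s} \<subseteq> {p, r, s}"
      unfolding \<B>_def by blast+
    have "{p, q} \<inter> {r, s} = {}"
      using dist_r dist_s by blast
    then have "convex hull {p, q} \<inter> convex hull {r, s} = {}"
      using B.hull_inter[OF C(1) D(1) C(2) D(2)] by simp
    moreover have "(1/2) *\<^sub>R p + (1/2) *\<^sub>R q = (1/2) *\<^sub>R r + (1/2) *\<^sub>R s"
      using rs by (simp flip: scaleR_add_right)
    ultimately show False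
      using midpoint_in_segment[of p q] midpoint_in_segment[of r s] unfolding segment_convex_hull by auto
  qed
  have edges_B: "tri_edge \<A> a b \<or> (a, b) \<in> {(r, s), (s, r)}" if ab: "tri_edge \<B> a b" for a b
  proof -
    obtain C where C: "C \<in> \<B>" "a \<in> C" "b \<in> C" "a \<noteq> b"
      using ab unfolding tri_edge_def by blast
    have pr: "tri_edge \<A> p r" "tri_edge \<A> q r" "tri_edge \<A> p s" "tri_edge \<A> q s"
      using er es by simp_all
    note pr = pr pr[THEN tri_edge_sym[THEN iffD1]]
    from C(1) consider "C \<in> \<A>" | "C = {p, r, s}" | "C = {q, r, s}"
      unfolding \<B>_def by blast
    then show ?thesis
    proof cases
      case 1
      then show ?thesis using C unfolding tri_edge_def by blast
    next
      case 2
      then show ?thesis using C(2,3,4) pr by auto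
    next
      case 3
      then show ?thesis using C(2,3,4) pr by auto
    qed
  qed
  let ?X = "crossing_edges \<A> u v" and ?X' = "crossing_edges \<B> u v"
  let ?R = "{(p, q), (q, p)}" and ?N = "{(r, s), (s, r)}"
  have X': "?X' \<subseteq> (?X - ?R) \<union> ?N"
  proof
    fix e assume "e \<in> ?X'"
    then obtain a b where ab: "e = (a, b)" "tri_edge \<B> a b" "crosses a b u v"
      by (auto simp: crossing_edges_def)
    have "(a, b) \<notin> ?R"
      using ab(2) pqB pqB[unfolded tri_edge_sym[of \<B> p]] by auto
    then show "e \<in> (?X - ?R) \<union> ?N"
      using edges_B[OF ab(2)] ab by (auto simp: crossing_edges_def)
  qed
  have less: "edge_height u v (r, s) < edge_height u v (p, q)" "edge_height u v (s, r) < edge_height u v (p, q)"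
    and eq: "edge_height u v (q, p) = edge_height u v (p, q)"
  proof -
    have "\<bar>H q - H p\<bar> \<in> \<int>"
      using H_Ints unimodularD(1,2)[OF uni_r] by (intro Ints_abs Ints_diff) blast+
    then obtain z where z: "\<bar>H q - H p\<bar> = of_int z"
      by (rule Ints_cases)
    \<comment> \<open>The new diagonal is the only new edge, and its ends have heights strictly
      between those of \<open>p\<close> and \<open>q\<close>. So the total drops even if it still
      crosses \<open>u v\<close>.\<close>
    have lt: "\<bar>H s - H r\<bar> < \<bar>H q - H p\<bar>"
      using Hr Hs by linarith
    have z0: "0 < z"
      using z pos by simp
    have pq: "edge_height u v (p, q) = nat z"
      unfolding edge_height_def fst_conv snd_conv det_H z by simp
    have "\<lfloor>\<bar>H s - H r\<bar>\<rfloor> < z"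
      using lt z by (simp add: floor_less_iff)
    then have "nat \<lfloor>\<bar>H s - H r\<bar>\<rfloor> < nat z"
      using z0 by (simp add: nat_mono_iff)
    then show "edge_height u v (r, s) < edge_height u v (p, q)"
      unfolding pq by (simp only: edge_height_def fst_conv snd_conv det_H)
    then show "edge_height u v (s, r) < edge_height u v (p, q)"
      by (simp add: edge_height_def det_H abs_minus_commute)
    show "edge_height u v (q, p) = edge_height u v (p, q)"
      by (simp add: edge_height_def det_H abs_minus_commute)
  qed
  have finR: "finite (?X - ?R)" "finite ?N" "finite ?R"
    using finX by simp_all
  have "sum (edge_height u v) ?X' \<le> sum (edge_height u v) ((?X - ?R) \<union> ?N)"
    using X' finR by (intro sum_mono2) auto
  also have "\<dots> \<le> sum (edge_height u v) (?X - ?R) + sum (edge_height u v) ?N"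
    unfolding sum_Un_nat[OF finR(1,2)] by (rule diff_le_self)
  also have "sum (edge_height u v) ?N < sum (edge_height u v) ?R"
    using less eq rs_ne pq_ne by simp
  also have "sum (edge_height u v) (?X - ?R) + sum (edge_height u v) ?R = sum (edge_height u v) ?X"
    by (rule sum.subset_diff[symmetric]) (use finX pqX swap[OF pqX] in auto)
  finally have dec: "sum (edge_height u v) ?X' < sum (edge_height u v) ?X"
    by simp
  show ?thesis
  proof (rule that[OF TB dec])
    fix a b assume ab: "tri_edge \<A> a b" "\<not> crosses a b u v"
    then obtain C where C: "C \<in> \<A>" "a \<in> C" "b \<in> C" "a \<noteq> b"
      unfolding tri_edge_def by blast
    have nab: "{a, b} \<noteq> {p, q}"
      using ab(2) cr crosses_sym[of p q u v] by (auto simp: doubleton_eq_iff)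
    consider "C \<in> \<B>" | "C = {p, q, r}" | "C = {p, q, s}"
      using C(1) unfolding \<B>_def by blast
    then show "tri_edge \<B> a b"
    proof cases
      case 1
      then show ?thesis using C unfolding tri_edge_def by blast
    next
      case 2
      then have "{a, b} \<subseteq> {p, r, s} \<or> {a, b} \<subseteq> {q, r, s}"
        using C nab by auto
      then show ?thesis
        using C(4) unfolding tri_edge_def \<B>_def by blast
    next
      case 3
      then have "{a, b} \<subseteq> {p, r, s} \<or> {a, b} \<subseteq> {q, r, s}"
        using C nab by auto
      then show ?thesis
        using C(4) unfolding tri_edge_def \<B>_def by blast
    qed
  qed
qed

text \<open>Induction on the total height of the crossing edges; when none is left,
  \<open>visible_edge\<close> applies. Keeping the noncrossing edges is what allows several segments
  to be inserted in turn.\<close>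

lemma insert_edge:
  assumes "unimodular_triangulation Q \<A>"
    and "primitive_segment u v" "closed_segment u v \<subseteq> Q"
  shows "\<exists>\<B>. unimodular_triangulation Q \<B> \<and> tri_edge \<B> u v \<and>
    (\<forall>a b. tri_edge \<A> a b \<longrightarrow> \<not> crosses a b u v \<longrightarrow> tri_edge \<B> a b)"
  using assms(1)
proof (induction "sum (edge_height u v) (crossing_edges \<A> u v)" arbitrary: \<A> rule: less_induct)
  case less
  show ?case
  proof (cases "crossing_edges \<A> u v = {}")
    case True
    have "\<not> crosses p q u v" if "tri_edge \<A> p q" for p q
      using that True unfolding crossing_edges_def by blast
    then have "tri_edge \<A> u v"
      by (rule unimodular_triangulation.visible_edge[OF less.prems assms(2,3)])
    then show ?thesis
      using less.prems by blast
  next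
    case False
    obtain \<B> where B: "unimodular_triangulation Q \<B>"
      "sum (edge_height u v) (crossing_edges \<B> u v) < sum (edge_height u v) (crossing_edges \<A> u v)"
      "\<And>a b. tri_edge \<A> a b \<Longrightarrow> \<not> crosses a b u v \<Longrightarrow> tri_edge \<B> a b"
      using flip_step[OF less.prems assms(2,3) False] by blast
    obtain \<C> where C: "unimodular_triangulation Q \<C>" "tri_edge \<C> u v"
      "\<forall>a b. tri_edge \<B> a b \<longrightarrow> \<not> crosses a b u v \<longrightarrow> tri_edge \<C> a b"
      using less.hyps[OF B(2,1)] by blast
    then show ?thesis
      using B(3) by blast
  qed
qed

lemma insert_edges:
  assumes T: "unimodular_triangulation Q \<A>" and fin: "finite G"
    and G: "\<And>u v. (u, v) \<in> G \<Longrightarrow> primitive_segment u v \<and> closed_segment u v \<subseteq> Q"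
    and nc: "\<And>u v a b. (u, v) \<in> G \<Longrightarrow> (a, b) \<in> G \<Longrightarrow> \<not> crosses a b u v"
  shows "\<exists>\<B>. unimodular_triangulation Q \<B> \<and> (\<forall>(u, v)\<in>G. tri_edge \<B> u v)"
  using fin G nc
proof (induction G rule: finite_induct)
  case empty
  then show ?case using T by auto
next
  case (insert g G)
  obtain u v where g: "g = (u, v)"
    by (cases g)
  have "\<exists>\<B>. unimodular_triangulation Q \<B> \<and> (\<forall>(u, v)\<in>G. tri_edge \<B> u v)"
    using insert.prems by (intro insert.IH) blast+
  then obtain \<B> where B: "unimodular_triangulation Q \<B>" "\<forall>(u, v)\<in>G. tri_edge \<B> u v"
    by blast
  have uv: "primitive_segment u v" "closed_segment u v \<subseteq> Q"
    using insert.prems(1)[of u v] g by blast+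
  obtain \<C> where C: "unimodular_triangulation Q \<C>" "tri_edge \<C> u v"
    "\<And>a b. tri_edge \<B> a b \<Longrightarrow> \<not> crosses a b u v \<Longrightarrow> tri_edge \<C> a b"
    using insert_edge[OF B(1) uv] by blast
  have "tri_edge \<C> a b" if "(a, b) \<in> insert g G" for a b
  proof (cases "(a, b) = g")
    case True
    then show ?thesis using C(2) g by simp
  next
    case False
    then have "(a, b) \<in> G" using that by blast
    then show ?thesis
      using B(2) C(3)[of a b] insert.prems(2)[of u v a b] g by blast
  qed
  then show ?case
    using C(1) by blast
qed

subsection \<open>Existence of primitive triangulations\<close>

definition lower_tri :: "nat \<Rightarrow> nat \<Rightarrow> point set"
  where "lower_tri i j = {(real i, real j), (real i + 1, real j), (real i, real j + 1)}"

definition upper_tri :: "nat \<Rightarrow> nat \<Rightarrow> point set"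
  where "upper_tri i j = {(real i + 1, real j + 1), (real i + 1, real j), (real i, real j + 1)}"

lemma nat_lattice: "(real i, real j) \<in> lattice" "(real i + 1, real j) \<in> lattice"
  "(real i, real j + 1) \<in> lattice" "(real i + 1, real j + 1) \<in> lattice"
  by (simp_all add: mem_Times_iff)

lemma lower_unimodular: "unimodular (real i, real j) (real i + 1, real j) (real i, real j + 1)"
  unfolding unimodular_def using nat_lattice by (intro conjI) (simp_all add: det2_def)

lemma upper_unimodular: "unimodular (real i + 1, real j + 1) (real i + 1, real j) (real i, real j + 1)"
  unfolding unimodular_def using nat_lattice by (intro conjI) (simp_all add: det2_def)

lemma lower_hull:
  "x \<in> convex hull (lower_tri i j) \<longleftrightarrow> real i \<le> fst x \<and> real j \<le> snd x \<and> fst x + snd x \<le> real i + real j + 1"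
  "x \<in> interior (convex hull (lower_tri i j)) \<longleftrightarrow> real i < fst x \<and> real j < snd x \<and> fst x + snd x < real i + real j + 1"
  unfolding lower_tri_def nondeg.mem_hull[OF unimodular_nondeg[OF lower_unimodular]]
    nondeg.mem_interior[OF unimodular_nondeg[OF lower_unimodular]]
  by (auto simp: bary_def det2_def)

lemma upper_hull:
  "x \<in> convex hull (upper_tri i j) \<longleftrightarrow> fst x \<le> real i + 1 \<and> snd x \<le> real j + 1 \<and> real i + real j + 1 \<le> fst x + snd x"
  "x \<in> interior (convex hull (upper_tri i j)) \<longleftrightarrow> fst x < real i + 1 \<and> snd x < real j + 1 \<and> real i + real j + 1 < fst x + snd x"
  unfolding upper_tri_def nondeg.mem_hull[OF unimodular_nondeg[OF upper_unimodular]]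
    nondeg.mem_interior[OF unimodular_nondeg[OF upper_unimodular]]
  by (auto simp: bary_def det2_def)

lemma unit_interval_cover:
  assumes "0 \<le> x" "x \<le> real N" "0 < N"
  shows "\<exists>i<N. real i \<le> x \<and> x \<le> real i + 1"
proof (cases "x = real N")
  case True
  then show ?thesis
    using assms(3) by (intro exI[of _ "N - 1"]) (simp add: of_nat_diff)
next
  case False
  then have "nat \<lfloor>x\<rfloor> < N"
    using assms by (simp add: nat_less_iff floor_less_iff)
  moreover have "real (nat \<lfloor>x\<rfloor>) \<le> x" "x \<le> real (nat \<lfloor>x\<rfloor>) + 1"
    using assms(1) by (simp_all add: less_imp_le)
  ultimately show ?thesis by blast
qed

lemma square_triangulation:
  assumes "0 < N"
  shows "unimodular_triangulation ({0..real N} \<times> {0..real N})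
    (case_prod lower_tri ` ({..<N} \<times> {..<N}) \<union> case_prod upper_tri ` ({..<N} \<times> {..<N}))"
proof
  let ?I = "{..<N} \<times> {..<N}"
  show "finite (case_prod lower_tri ` ?I \<union> case_prod upper_tri ` ?I)"
    by simp
  show "\<exists>a b c. A = {a, b, c} \<and> unimodular a b c"
    if A: "A \<in> case_prod lower_tri ` ?I \<union> case_prod upper_tri ` ?I" for A
  proof -
    obtain i j where "A = lower_tri i j \<or> A = upper_tri i j"
      using A by auto
    then show ?thesis
      using lower_unimodular[of i j] upper_unimodular[of i j] unfolding lower_tri_def upper_tri_def
      by (elim disjE) (intro exI conjI, assumption+)+
  qed
  have nat_eq: "i = j" if "real i < x" "x < real i + 1" "real j < x" "x < real j + 1" for i j x
    using that by linarith
  \<comment> \<open>A point in the interior of such a triangle has both coordinates strictly inside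
    one unit square, which determines the indices.\<close>
  have ll: "i = k \<and> j = l" if "x \<in> interior (convex hull (lower_tri i j))" "x \<in> interior (convex hull (lower_tri k l))" for x i j k l
    using that unfolding lower_hull by (auto intro!: nat_eq[of i "fst x" k] nat_eq[of j "snd x" l])
  have uu: "i = k \<and> j = l" if "x \<in> interior (convex hull (upper_tri i j))" "x \<in> interior (convex hull (upper_tri k l))" for x i j k l
    using that unfolding upper_hull by (auto intro!: nat_eq[of i "fst x" k] nat_eq[of j "snd x" l])
  have lu: False if "x \<in> interior (convex hull (lower_tri i j))" "x \<in> interior (convex hull (upper_tri k l))" for x i j k l
  proof -
    have "i = k" "j = l"
      using that unfolding lower_hull upper_hull by (auto intro!: nat_eq[of i "fst x" k] nat_eq[of j "snd x" l])
    then show False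
      using that unfolding lower_hull upper_hull by linarith
  qed
  show "interior (convex hull A) \<inter> interior (convex hull B) = {}"
    if A: "A \<in> case_prod lower_tri ` ?I \<union> case_prod upper_tri ` ?I"
      and B: "B \<in> case_prod lower_tri ` ?I \<union> case_prod upper_tri ` ?I" and ne: "A \<noteq> B" for A B
  proof (rule ccontr)
    assume "interior (convex hull A) \<inter> interior (convex hull B) \<noteq> {}"
    then obtain x where x: "x \<in> interior (convex hull A)" "x \<in> interior (convex hull B)"
      by blast
    obtain i j where A': "A = lower_tri i j \<or> A = upper_tri i j"
      using A by auto
    obtain k l where B': "B = lower_tri k l \<or> B = upper_tri k l"
      using B by auto
    show False
      using A' B' x ne ll[of x i j k l] uu[of x i j k l] lu[of x i j k l] lu[of x k l i j] by blast
  qed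
  show "(\<Union>A\<in>case_prod lower_tri ` ?I \<union> case_prod upper_tri ` ?I. convex hull A) = {0..real N} \<times> {0..real N}"
  proof
    show "(\<Union>A\<in>case_prod lower_tri ` ?I \<union> case_prod upper_tri ` ?I. convex hull A) \<subseteq> {0..real N} \<times> {0..real N}"
    proof
      fix x assume "x \<in> (\<Union>A\<in>case_prod lower_tri ` ?I \<union> case_prod upper_tri ` ?I. convex hull A)"
      then obtain i j where ij: "i < N" "j < N" and x: "x \<in> convex hull (lower_tri i j) \<or> x \<in> convex hull (upper_tri i j)"
        by auto
      have "real i + 1 \<le> real N" "real j + 1 \<le> real N"
        using ij by linarith+
      then have "0 \<le> fst x" "0 \<le> snd x" "fst x \<le> real N" "snd x \<le> real N"
        using x unfolding lower_hull upper_hull by linarith+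
      then show "x \<in> {0..real N} \<times> {0..real N}"
        by (simp add: mem_Times_iff)
    qed
    show "{0..real N} \<times> {0..real N} \<subseteq> (\<Union>A\<in>case_prod lower_tri ` ?I \<union> case_prod upper_tri ` ?I. convex hull A)"
    proof
      fix x :: point assume "x \<in> {0..real N} \<times> {0..real N}"
      then have "0 \<le> fst x" "0 \<le> snd x" "fst x \<le> real N" "snd x \<le> real N"
        by (simp_all add: mem_Times_iff)
      then obtain i j where ij: "i < N" "j < N" "real i \<le> fst x" "fst x \<le> real i + 1" "real j \<le> snd x" "snd x \<le> real j + 1"
        using unit_interval_cover[OF _ _ assms] by meson
      then have "x \<in> convex hull (lower_tri i j) \<or> x \<in> convex hull (upper_tri i j)"
        unfolding lower_hull upper_hull by linarith
      then show "x \<in> (\<Union>A\<in>case_prod lower_tri ` ?I \<union> case_prod upper_tri ` ?I. convex hull A)"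
      proof
        assume "x \<in> convex hull (lower_tri i j)"
        then show ?thesis
          using ij(1,2) by (intro UN_I[of "lower_tri i j"] UnI1) auto
      next
        assume "x \<in> convex hull (upper_tri i j)"
        then show ?thesis
          using ij(1,2) by (intro UN_I[of "upper_tri i j"] UnI2) auto
      qed
    qed
  qed
qed

text \<open>Of three arms at \<open>y\<close>, two are sent by \<open>\<psi>\<close> to the same
  side of \<open>\<psi> y\<close>. Their images are intervals that overlap beyond
  \<open>\<psi> y\<close>, against injectivity.\<close>

lemma no_triod_real:
  fixes \<psi> :: "point \<Rightarrow> real"
  assumes cont: "continuous_on S \<psi>" and inj: "inj_on \<psi> S"
    and sub: "\<And>e. e \<in> {a, b, c} \<Longrightarrow> closed_segment y e \<subseteq> S"
    and ne: "a \<noteq> y" "b \<noteq> y" "c \<noteq> y"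
    and meet: "closed_segment y a \<inter> closed_segment y b = {y}"
      "closed_segment y b \<inter> closed_segment y c = {y}"
      "closed_segment y c \<inter> closed_segment y a = {y}"
  shows False
proof -
  have conn: "connected (\<psi> ` closed_segment y e)" if "e \<in> {a, b, c}" for e
    using continuous_on_subset[OF cont sub[OF that]] by (intro connected_continuous_image) (simp_all add: convex_connected)
  have img: "\<psi> y \<in> \<psi> ` closed_segment y e" "\<psi> e \<in> \<psi> ` closed_segment y e" for e
    by simp_all
  have key: "\<not> (\<psi> d - \<psi> y) * (\<psi> e - \<psi> y) > 0"
    if d: "d \<in> {a, b, c}" and e: "e \<in> {a, b, c}" and de: "closed_segment y d \<inter> closed_segment y e = {y}" for d e
  proof
    assume "(\<psi> d - \<psi> y) * (\<psi> e - \<psi> y) > 0"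
    \<comment> \<open>The common value is whichever of \<open>\<psi> d\<close> and
      \<open>\<psi> e\<close> is nearer to \<open>\<psi> y\<close>.\<close>
    then have "\<exists>t. t \<noteq> \<psi> y \<and> t \<in> \<psi> ` closed_segment y d \<and> t \<in> \<psi> ` closed_segment y e"
    proof (cases "\<psi> d > \<psi> y")
      case True
      then have "\<psi> e > \<psi> y"
        using \<open>(\<psi> d - \<psi> y) * (\<psi> e - \<psi> y) > 0\<close> by (simp add: zero_less_mult_iff)
      then show ?thesis
        using True connectedD_interval[OF conn[OF d] img(1) img(2), of "min (\<psi> d) (\<psi> e)"]
          connectedD_interval[OF conn[OF e] img(1) img(2), of "min (\<psi> d) (\<psi> e)"]
        by (intro exI[of _ "min (\<psi> d) (\<psi> e)"]) auto
    next
      case False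
      then have "\<psi> e < \<psi> y" "\<psi> d < \<psi> y"
        using \<open>(\<psi> d - \<psi> y) * (\<psi> e - \<psi> y) > 0\<close> by (auto simp: zero_less_mult_iff)
      then show ?thesis
        using connectedD_interval[OF conn[OF d] img(2) img(1), of "max (\<psi> d) (\<psi> e)"]
          connectedD_interval[OF conn[OF e] img(2) img(1), of "max (\<psi> d) (\<psi> e)"]
        by (intro exI[of _ "max (\<psi> d) (\<psi> e)"]) auto
    qed
    then obtain z w where zw: "z \<in> closed_segment y d" "w \<in> closed_segment y e" "\<psi> z = \<psi> w" "\<psi> z \<noteq> \<psi> y"
      by (metis imageE)
    have "z = w"
      using inj zw(3) subsetD[OF sub[OF d] zw(1)] subsetD[OF sub[OF e] zw(2)] by (simp add: inj_on_eq_iff)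
    then have "z = y"
      using zw(1,2) de by blast
    then show False
      using zw(4) by blast
  qed
  have yS: "y \<in> S"
    using sub[of a] by auto
  have "\<psi> e \<noteq> \<psi> y" if "e \<in> {a, b, c}" for e
  proof -
    have "e \<in> S" "e \<noteq> y"
      using sub[OF that] that ne by auto
    then show ?thesis
      using inj yS by (simp add: inj_on_eq_iff)
  qed
  then have "\<psi> a - \<psi> y \<noteq> 0" "\<psi> b - \<psi> y \<noteq> 0" "\<psi> c - \<psi> y \<noteq> 0"
    by simp_all
  moreover have "\<not> (\<psi> a - \<psi> y) * (\<psi> b - \<psi> y) > 0" "\<not> (\<psi> b - \<psi> y) * (\<psi> c - \<psi> y) > 0"
    "\<not> (\<psi> c - \<psi> y) * (\<psi> a - \<psi> y) > 0"
    using key meet by simp_all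
  ultimately show False
    by (auto simp: zero_less_mult_iff)
qed

text \<open>A circle without one point is a line, so any point \<open>w\<close> off the three arms
  reduces the claim to \<open>no_triod_real\<close>.\<close>

lemma circle_no_triod:
  fixes S :: "point set"
  assumes S: "S homeomorphic (sphere 0 1 :: point set)" and w: "w \<in> S"
    and sub: "\<And>e. e \<in> {a, b, c} \<Longrightarrow> closed_segment y e \<subseteq> S - {w}"
    and ne: "a \<noteq> y" "b \<noteq> y" "c \<noteq> y"
    and meet: "closed_segment y a \<inter> closed_segment y b = {y}"
      "closed_segment y b \<inter> closed_segment y c = {y}"
      "closed_segment y c \<inter> closed_segment y a = {y}"
  shows False
proof -
  obtain f g where fg: "homeomorphism S (sphere 0 1 :: point set) f g"
    using S by (auto simp: homeomorphic_def)
  have fS: "f ` S = sphere 0 1" and injf: "inj_on f S" and cf: "continuous_on S f"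
    using fg by (auto simp: homeomorphism_def intro: inj_on_inverseI)
  have fw: "f w \<in> sphere 0 1"
    using fS w by blast
  have "(sphere 0 1 - {f w}) homeomorphic (UNIV :: real set)"
    using fw by (intro homeomorphic_punctured_sphere_affine) simp_all
  then obtain \<phi> \<phi>' where \<phi>: "homeomorphism (sphere 0 1 - {f w}) (UNIV :: real set) \<phi> \<phi>'"
    by (auto simp: homeomorphic_def)
  have c\<phi>: "continuous_on (sphere 0 1 - {f w}) \<phi>" and inj\<phi>: "inj_on \<phi> (sphere 0 1 - {f w})"
    using \<phi> by (auto simp: homeomorphism_def intro: inj_on_inverseI)
  have im: "f ` (S - {w}) \<subseteq> sphere 0 1 - {f w}"
    using fS injf w by (auto simp: inj_on_eq_iff)
  have c: "continuous_on (S - {w}) (\<phi> \<circ> f)"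
    using cf im by (intro continuous_on_compose continuous_on_subset[OF c\<phi>]) (auto intro: continuous_on_subset)
  have i: "inj_on (\<phi> \<circ> f) (S - {w})"
    by (intro comp_inj_on inj_on_subset[OF inj\<phi> im] inj_on_subset[OF injf]) blast
  show False
    by (rule no_triod_real[OF c i sub ne meet])
qed

text \<open>At a crossing point \<open>y\<close> the segments to \<open>p\<close>, \<open>q\<close>
  and \<open>u\<close> would form a triod in the frontier, which is a circle. The fourth end
  \<open>v\<close> is off these arms, being separated from \<open>u\<close> by the line
  \<open>p q\<close>, and serves as the removed point.\<close>

lemma frontier_no_crossing:
  assumes poly: "polygon P E"
    and pq: "closed_segment p q \<subseteq> frontier P" and uv: "closed_segment u v \<subseteq> frontier P"
  shows "\<not> crosses p q u v"
proof
  assume cr: "crosses p q u v"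
  obtain y \<mu> \<nu> where y: "y = p + \<mu> *\<^sub>R (q - p)" "0 < \<mu>" "\<mu> < 1" "y = u + \<nu> *\<^sub>R (v - u)" "0 < \<nu>" "\<nu> < 1"
    using crosses_point[OF cr] .
  have K: "det2 (q - p) (u - p) * det2 (q - p) (v - p) < 0"
    using cr by (simp add: crosses_def)
  define K where "K x = det2 (q - p) (x - p)" for x
  have Ku: "K u \<noteq> 0" and Kv: "K v \<noteq> 0"
    using K by (auto simp: K_def)
  have Kaff: "K ((1 - t) *\<^sub>R a + t *\<^sub>R b) = (1 - t) * K a + t * K b" for t a b
    by (simp add: K_def det2_def algebra_simps)
  have Kp: "K p = 0" "K q = 0"
    by (simp_all add: K_def)
  have y1: "y = (1 - \<mu>) *\<^sub>R p + \<mu> *\<^sub>R q"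
    using y(1) by (simp add: algebra_simps)
  have y2: "y = (1 - \<nu>) *\<^sub>R u + \<nu> *\<^sub>R v"
    using y(4) by (simp add: algebra_simps)
  have Ky: "K y = 0"
    unfolding y1 Kaff Kp by simp
  have ypq: "y \<in> closed_segment p q"
    unfolding in_segment using y1 y(2,3) by (intro exI[of _ \<mu>]) simp
  have yuv: "y \<in> closed_segment u v"
    unfolding in_segment using y2 y(5,6) by (intro exI[of _ \<nu>]) simp
  have Kpq: "K x = 0" if "x \<in> closed_segment p q" for x
    using that by (auto simp: in_segment Kaff Kp)
  have Kyu: "x = y" if "x \<in> closed_segment y u" "K x = 0" for x
    using that Ku Ky by (auto simp: in_segment Kaff)
  have sub: "closed_segment y p \<subseteq> closed_segment p q" "closed_segment y q \<subseteq> closed_segment p q"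
    "closed_segment y u \<subseteq> closed_segment u v"
    using ypq yuv by (simp_all add: closed_segment_subset)
  have pq_ne: "p \<noteq> q"
    using Ku by (auto simp: K_def)
  have ne: "p \<noteq> y" "q \<noteq> y" "u \<noteq> y"
  proof -
    have "y - p = \<mu> *\<^sub>R (q - p)" "q - y = (1 - \<mu>) *\<^sub>R (q - p)"
      using y(1) by (simp_all add: algebra_simps)
    then show "p \<noteq> y" "q \<noteq> y"
      using pq_ne y(2,3) by auto
    show "u \<noteq> y"
      using Ku Ky by blast
  qed
  have vp: "v \<notin> closed_segment p q"
    using Kpq Kv by blast
  have vu: "v \<notin> closed_segment y u"
  proof
    assume "v \<in> closed_segment y u"
    then obtain t where t: "0 \<le> t" "t \<le> 1" "v = (1 - t) *\<^sub>R y + t *\<^sub>R u"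
      unfolding in_segment by blast
    have "K v = t * K u"
      unfolding t(3) Kaff Ky by simp
    then have "0 \<le> K u * K v"
      using t(1) by (simp add: mult.left_commute)
    then show False
      using K by (simp add: K_def)
  qed
  have m1: "closed_segment y p \<inter> closed_segment y q = {y}"
    using Int_closed_segment[of y p q] ypq by (simp add: closed_segment_commute)
  have m2: "closed_segment y q \<inter> closed_segment y u = {y}"
    using Kyu Kpq sub(2) by auto
  have m3: "closed_segment y u \<inter> closed_segment y p = {y}"
    using Kyu Kpq sub(1) by auto
  have vfr: "v \<in> frontier P"
    using uv by auto
  show False
  proof (rule circle_no_triod[OF polygon_frontier_sphere[OF poly] vfr _ ne m1 m2 m3])
    fix e assume "e \<in> {p, q, u}"
    then have "closed_segment y e \<subseteq> frontier P \<and> v \<notin> closed_segment y e"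
      using sub pq uv vp vu by blast
    then show "closed_segment y e \<subseteq> frontier P - {v}"
      by blast
  qed
qed

text \<open>A pair of lattice points at minimal distance among those whose segment contains
  \<open>x\<close>; a lattice point between them would give a shorter such pair.\<close>

lemma primitive_subsegment:
  assumes uv: "u \<in> lattice" "v \<in> lattice" "u \<noteq> v" and x: "x \<in> closed_segment u v"
  obtains p q where "primitive_segment p q" "x \<in> closed_segment p q" "closed_segment p q \<subseteq> closed_segment u v"
proof -
  let ?S = "closed_segment u v \<inter> lattice"
  let ?X = "{(p, q) \<in> ?S \<times> ?S. p \<noteq> q \<and> x \<in> closed_segment p q}"
  have "finite ?S"
    by (intro finite_lattice compact_imp_bounded compact_segment)
  then have "finite (?S \<times> ?S)"
    by simp
  then have finX: "finite ?X"
    by (rule finite_subset[rotated]) blast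
  have "(u, v) \<in> ?X"
    using uv x by simp
  then have ne: "?X \<noteq> {}"
    by blast
  define d where "d e = dist (fst e) (snd e)" for e :: "point \<times> point"
  have "Min (d ` ?X) \<in> d ` ?X"
    using finX ne by (intro Min_in) auto
  then obtain e where e: "e \<in> ?X" "d e = Min (d ` ?X)"
    by (metis (no_types, lifting) imageE)
  obtain p q where epq: "e = (p, q)"
    by (cases e)
  have min: "dist p q \<le> dist a b" if "(a, b) \<in> ?X" for a b
  proof -
    have "d e \<le> d (a, b)"
      unfolding e(2) using finX that by (intro Min_le) blast+
    then show ?thesis
      by (simp add: d_def epq)
  qed
  have pq: "p \<in> closed_segment u v" "q \<in> closed_segment u v" "p \<in> lattice" "q \<in> lattice" "p \<noteq> q" "x \<in> closed_segment p q"
    using e(1) unfolding epq by blast+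
  have sub: "closed_segment p q \<subseteq> closed_segment u v"
    using pq(1,2) by (simp add: closed_segment_subset)
  have "closed_segment p q \<inter> lattice \<subseteq> {p, q}"
  proof
    fix z assume z: "z \<in> closed_segment p q \<inter> lattice"
    show "z \<in> {p, q}"
    proof (rule ccontr)
      assume nz: "z \<notin> {p, q}"
      have zpq: "z \<in> closed_segment p q" and zL: "z \<in> lattice"
        using z by blast+
      have zo: "z \<in> open_segment p q"
        using zpq nz by (simp add: open_segment_def)
      have zS: "z \<in> ?S" "p \<in> ?S" "q \<in> ?S"
        using zpq zL sub pq by blast+
      have "x \<in> closed_segment p z \<or> x \<in> closed_segment z q"
        using Un_closed_segment[OF zpq] pq(6) by blast
      then show False
      proof
        assume "x \<in> closed_segment p z"
        then have "(p, z) \<in> ?X"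
          using zS nz by blast
        then have "dist p q \<le> dist p z"
          by (rule min)
        moreover have "dist p z < dist p q"
          using dist_in_open_segment[OF zo] by (simp add: dist_commute)
        ultimately show False by simp
      next
        assume "x \<in> closed_segment z q"
        then have "(z, q) \<in> ?X"
          using zS nz by blast
        then have "dist p q \<le> dist z q"
          by (rule min)
        moreover have "dist z q < dist p q"
          using dist_in_open_segment[OF zo] by simp
        ultimately show False by simp
      qed
    qed
  qed
  moreover have "{p, q} \<subseteq> closed_segment p q \<inter> lattice"
    using pq(3,4) by (simp only: insert_subset empty_subsetI simp_thms IntI ends_in_segment)
  ultimately have "primitive_segment p q"
    unfolding primitive_segment_def using pq by (intro conjI subset_antisym)
  then show ?thesis
    using that pq(6) sub by blast
qed

lemma polygon_primitive_triangulation: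
  assumes poly: "polygon P E" and pos: "P \<subseteq> {0..} \<times> {0..}"
  obtains \<T> where "primitive_triangulation P \<T>"
proof -
  have comp: "compact P"
    by (rule polygon_compact[OF poly])
  obtain r where r: "\<And>x. x \<in> P \<Longrightarrow> norm x \<le> r"
    using compact_imp_bounded[OF comp] unfolding bounded_iff by blast
  \<comment> \<open>Since \<open>P\<close> lies in the first quadrant, a square at the origin
    contains it once its side is at least the norm bound. The added 1 keeps the side
    positive.\<close>
  define N where "N = nat \<lceil>r\<rceil> + 1"
  have N: "0 < N" "r \<le> real N"
    unfolding N_def by linarith+
  let ?Q = "{0..real N} \<times> {0..real N}"
  have PQ: "P \<subseteq> ?Q"
  proof
    fix x assume x: "x \<in> P"
    have "0 \<le> fst x" "0 \<le> snd x"
      using pos x by (auto simp: mem_Times_iff)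
    moreover have "fst x \<le> norm x" "snd x \<le> norm x"
      using norm_fst_le[of "fst x" "snd x"] norm_snd_le[of "snd x" "fst x"] by simp_all
    ultimately show "x \<in> ?Q"
      using r[OF x] N(2) by (simp add: mem_Times_iff)
  qed
  have clP: "closed P"
    using comp by (rule compact_imp_closed)
  have frP: "frontier P \<subseteq> P"
    using clP frontier_subset_closed by blast
  let ?G = "{(p, q). primitive_segment p q \<and> closed_segment p q \<subseteq> frontier P}"
  have "?G \<subseteq> (frontier P \<inter> lattice) \<times> (frontier P \<inter> lattice)"
  proof
    fix e assume "e \<in> ?G"
    then obtain p q where pq: "e = (p, q)" "primitive_segment p q" "closed_segment p q \<subseteq> frontier P"
      by blast
    have "p \<in> frontier P" "q \<in> frontier P"
      using pq(3) by auto
    then show "e \<in> (frontier P \<inter> lattice) \<times> (frontier P \<inter> lattice)"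
      unfolding pq(1) using primitive_segmentD(1,2)[OF pq(2)] by blast
  qed
  moreover have "finite ((frontier P \<inter> lattice) \<times> (frontier P \<inter> lattice))"
    by (intro finite_cartesian_product finite_lattice compact_imp_bounded compact_frontier comp)
  ultimately have finG: "finite ?G"
    by (rule finite_subset)
  have "\<exists>\<B>. unimodular_triangulation ?Q \<B> \<and> (\<forall>(u, v)\<in>?G. tri_edge \<B> u v)"
  proof (rule insert_edges[OF square_triangulation[OF N(1)] finG])
    show "primitive_segment u v \<and> closed_segment u v \<subseteq> ?Q" if "(u, v) \<in> ?G" for u v
      using that frP PQ by blast
    show "\<not> crosses a b u v" if "(u, v) \<in> ?G" "(a, b) \<in> ?G" for u v a b
      using that by (intro frontier_no_crossing[OF poly]) blast+
  qed
  then obtain \<B> where B: "unimodular_triangulation ?Q \<B>" and edges: "\<And>u v. (u, v) \<in> ?G \<Longrightarrow> tri_edge \<B> u v"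
    by blast
  interpret B: unimodular_triangulation ?Q \<B> by (rule B)
  have frontier_edge: "\<exists>p q. x \<in> closed_segment p q \<and> tri_edge \<B> p q" if x: "x \<in> frontier P" for x
  proof -
    obtain s where s: "s \<in> E" "x \<in> s"
      using x polygon_frontier_edges[OF poly] by blast
    obtain u v where uv: "u \<in> lattice" "v \<in> lattice" "u \<noteq> v" "s = closed_segment u v"
      using polygon_edges_lattice_segments[OF poly s(1)] unfolding lattice_segment_def by blast
    obtain p q where pq: "primitive_segment p q" "x \<in> closed_segment p q" "closed_segment p q \<subseteq> closed_segment u v"
      using primitive_subsegment[OF uv(1-3)] s(2) uv(4) by metis
    have "closed_segment p q \<subseteq> frontier P"
      using pq(3) uv(4) s(1) polygon_frontier_edges[OF poly] by blast
    then show ?thesis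
      using edges[of p q] pq by blast
  qed
  \<comment> \<open>The frontier is covered by edges of \<open>\<B>\<close>. A point on an edge lies
    in a triangle having this edge, and it can be interior neither to this triangle nor to another
    one.\<close>
  have avoid: "interior (convex hull A) \<inter> frontier P = {}" if A: "A \<in> \<B>" for A
  proof (rule ccontr)
    assume "interior (convex hull A) \<inter> frontier P \<noteq> {}"
    then obtain x where x: "x \<in> interior (convex hull A)" "x \<in> frontier P"
      by blast
    obtain p q where pq: "x \<in> closed_segment p q" "tri_edge \<B> p q"
      using frontier_edge[OF x(2)] by blast
    obtain C where C: "C \<in> \<B>" "p \<in> C" "q \<in> C" "p \<noteq> q"
      using pq(2) unfolding tri_edge_def by blast
    have xh: "x \<in> convex hull {p, q}"
      using pq(1) by (simp add: segment_convex_hull)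
    moreover have "{p, q} \<subseteq> C"
      using C by blast
    ultimately have xC: "x \<in> convex hull C"
      using hull_mono by blast
    show False
    proof (cases "A = C")
      case True
      obtain r where Cr: "C = {p, q, r}" and uni: "unimodular p q r"
        using B.triE[OF C] .
      have "{p, q} \<noteq> {p, q, r}"
        using nondeg.distinct[OF unimodular_nondeg[OF uni]] by auto
      then show False
        using nondeg.proper_face_not_interior[OF unimodular_nondeg[OF uni] _ _ xh] x(1) True Cr by blast
    next
      case False
      have "x \<in> closure (interior (convex hull C))"
        using xC B.closure_interior_hull[OF C(1)] by simp
      then have "interior (convex hull A) \<inter> interior (convex hull C) \<noteq> {}"
        using x(1) open_Int_closure_eq_empty[OF open_interior, of "convex hull A" "interior (convex hull C)"] by blast
      then show False
        using B.disj[OF A C(1) False] by blast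
    qed
  qed
  define \<A> where "\<A> = {A \<in> \<B>. convex hull A \<subseteq> P}"
  \<comment> \<open>An open triangle is connected and misses the frontier, so it lies inside
    \<open>P\<close> as soon as it meets \<open>interior P\<close>.\<close>
  have inside: "A \<in> \<A>" if A: "A \<in> \<B>" "interior (convex hull A) \<inter> interior P \<noteq> {}" for A
  proof -
    have "connected (interior (convex hull A))"
      by (intro convex_connected convex_interior convex_convex_hull)
    moreover have "interior (convex hull A) \<inter> P \<noteq> {}"
      using A(2) interior_subset by blast
    ultimately have "interior (convex hull A) - P = {}"
      using connected_Int_frontier[of "interior (convex hull A)" P] avoid[OF A(1)] by blast
    then have "interior (convex hull A) \<subseteq> P"
      by blast
    then have "closure (interior (convex hull A)) \<subseteq> P"
      using clP by (rule closure_minimal)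
    then show ?thesis
      unfolding \<A>_def B.closure_interior_hull[OF A(1)] using A(1) by blast
  qed
  have "unimodular_triangulation P \<A>"
  proof
    show fin: "finite \<A>"
      unfolding \<A>_def using B.fin by simp
    show "\<exists>a b c. A = {a, b, c} \<and> unimodular a b c" if "A \<in> \<A>" for A
      using that B.unimod unfolding \<A>_def by blast
    show "interior (convex hull A) \<inter> interior (convex hull C) = {}" if "A \<in> \<A>" "C \<in> \<A>" "A \<noteq> C" for A C
      using that B.disj unfolding \<A>_def by blast
    show "(\<Union>A\<in>\<A>. convex hull A) = P"
    proof
      show "(\<Union>A\<in>\<A>. convex hull A) \<subseteq> P"
        unfolding \<A>_def by blast
      have cl: "closed (\<Union>A\<in>\<A>. convex hull A)"
        using fin B.hull_closed by (intro closed_UN) (auto simp: \<A>_def)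
      \<comment> \<open>Uncovered interior points form an open set. If it contained a point of some
        triangle of \<open>\<B>\<close>, it would meet the interior of that triangle, which would
        then belong to \<open>\<A>\<close>.\<close>
      have "interior P \<subseteq> (\<Union>A\<in>\<A>. convex hull A)"
      proof (rule ccontr)
        assume "\<not> interior P \<subseteq> (\<Union>A\<in>\<A>. convex hull A)"
        then obtain x where x: "x \<in> interior P - (\<Union>A\<in>\<A>. convex hull A)"
          by blast
        have "x \<in> ?Q"
          using x PQ interior_subset by blast
        then obtain A where A: "A \<in> \<B>" "x \<in> convex hull A"
          using B.cover by blast
        have "open (interior P - (\<Union>A\<in>\<A>. convex hull A))"
          using cl by (intro open_Diff open_interior)
        moreover have "x \<in> closure (interior (convex hull A))"
          using A(2) B.closure_interior_hull[OF A(1)] by simp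
        ultimately have "(interior P - (\<Union>A\<in>\<A>. convex hull A)) \<inter> interior (convex hull A) \<noteq> {}"
          using x open_Int_closure_eq_empty by blast
        then obtain w where w: "w \<in> interior P" "w \<notin> (\<Union>A\<in>\<A>. convex hull A)" "w \<in> interior (convex hull A)"
          by blast
        have "A \<in> \<A>"
          using inside[OF A(1)] w by blast
        then show False
          using w interior_subset by blast
      qed
      then have "closure (interior P) \<subseteq> (\<Union>A\<in>\<A>. convex hull A)"
        using cl by (rule closure_minimal)
      then show "P \<subseteq> (\<Union>A\<in>\<A>. convex hull A)"
        by (simp only: polygon_closure_interior[OF poly])
    qed
  qed
  then show ?thesis
    using that unimodular_triangulation.primitive_triangulation by blast
qed

theorem theorem41:
  fixes P :: "(real \<times> real) set" and E :: "(real \<times> real) set set"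
  assumes "polygon P E" and "P \<subseteq> {0..} \<times> {0..}"
  shows "(\<forall>\<T> \<delta>. primitive_triangulation P \<T> \<and> sign_distribution P \<delta> \<longrightarrow>
            finite (T_curve_components P E \<T> \<delta>) \<and>
            card (T_curve_components P E \<T> \<delta>) \<le> card (interior P \<inter> lattice) + 1)
       \<and> (\<exists>\<T> \<delta>. primitive_triangulation P \<T> \<and> sign_distribution P \<delta> \<and>
            finite (T_curve_components P E \<T> \<delta>) \<and>
            card (T_curve_components P E \<T> \<delta>) = card (interior P \<inter> lattice) + 1)"
proof -
  have bound: "finite (T_curve_components P E \<T> \<delta>) \<and>
      card (T_curve_components P E \<T> \<delta>) \<le> card (interior P \<inter> lattice) + 1"
    if T: "primitive_triangulation P \<T>" and \<delta>: "sign_distribution P \<delta>" for \<T> \<delta>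
  proof -
    interpret lattice_disc P E "triangle_vertices \<T>"
      by (rule lattice_disc_triangle_vertices[OF assms(1) T])
    have "\<delta> p = 1 \<or> \<delta> p = - 1" if "p \<in> P \<inter> lattice" for p
      using \<delta> that unfolding sign_distribution_def by blast
    then show ?thesis
      unfolding T_curve_components_eq[OF assms(1) T]
      using finite_components card_components_le by blast
  qed
  obtain \<T> where T: "primitive_triangulation P \<T>"
    using polygon_primitive_triangulation[OF assms] .
  have \<delta>: "sign_distribution P harnack"
    unfolding sign_distribution_def using harnack_pm by blast
  have "card (interior P \<inter> lattice) + 1 \<le> card (T_curve_components P E \<T> harnack)"
    unfolding T_curve_components_eq[OF assms(1) T]
    by (rule lattice_disc.card_components_harnack_ge[OF lattice_disc_triangle_vertices[OF assms(1) T]])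
  then have "card (T_curve_components P E \<T> harnack) = card (interior P \<inter> lattice) + 1"
    using bound[OF T \<delta>] by simp
  then show ?thesis
    using bound T \<delta> by blast
qed

end
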